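(* Let $(X, \mathcal{F}, \mu, T)$ be an invertible ergodic probability measure-preserving system, let $f\in L^\infty(\mu)$, and let $k \geq 2$. Then the following are equivalent: (1) $f \in L^2(\mathcal{Z}_{k})^\perp$. (2a) For all collections $(g_\eta)_{\eta\in V_{k-1}}$ with $g_\eta\in L^\infty(\mu)$ and some $g_\eta = f$, we have $$\lim_{N\to\infty} \frac{1}{N^{k-1}} \sum_{h \in [N]^{k-1}} \sup_{t\in\mathbb{R}} \left| \frac{1}{N} \sum_{n=1}^N e^{2\pi i n t} \left[\prod_{\eta\in V_{k-1}} c^{|\eta|} g_\eta \circ T^{h \cdot \eta} \right](T^{n} x) \right|^2 = 0$$ for $\mu$-a.e. $x$. (2b) $$\lim_{N\to\infty} \frac{1}{N^{k-1}} \sum_{h \in [N]^{k-1}} \sup_{t\in\mathbb{R}} \left| \frac{1}{N} \sum_{n=1}^N e^{2\pi i n t} \left[\prod_{\eta\in V_{k-1}} c^{|\eta|} f \circ T^{h \cdot \eta} \right](T^{n} x) \right|^2 = 0$$ for $\mu$-a.e. $x$. (3a) For all collections $(g_\eta)_{\eta\in V_{k-1}}$ with $g_\eta\in L^\infty(\mu)$ and some $g_\eta = f$, we have $$\lim_{N\to\infty} \frac{1}{N^{k-1}} \sum_{h \in [N]^{k-1}}\left \| \sup_{t\in\mathbb{R}} \left| \frac{1}{N} \sum_{n=1}^N e^{2\pi i n t} \left[\prod_{\eta\in V_{k-1}} c^{|\eta|} g_\eta \circ T^{h \cdot \eta} \right]\circ T^{n} \right| \right\|_2^2 = 0.$$ (3b)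 $$\lim_{N\to\infty} \frac{1}{N^{k-1}} \sum_{h \in [N]^{k-1}}\left \| \sup_{t\in\mathbb{R}} \left| \frac{1}{N} \sum_{n=1}^N e^{2\pi i n t} \left[\prod_{\eta\in V_{k-1}} c^{|\eta|} f \circ T^{h \cdot \eta} \right]\circ T^{n} \right| \right\|_2^2 = 0.$$ (4a) For all collections $(g_\eta)_{\eta\in V_{k-1}}$ with $g_\eta\in L^\infty(\mu)$ and some $g_\eta = f$, we have $$\lim_{N\to\infty} \frac{1}{\lfloor \sqrt{N} \rfloor^{k-1}} \sum_{h \in [\lfloor \sqrt{N} \rfloor]^{k-1}}\left \| \sup_{t\in\mathbb{R}} \left| \frac{1}{N} \sum_{n=1}^N e^{2\pi i n t} \left[\prod_{\eta\in V_{k-1}} c^{|\eta|} g_\eta \circ T^{h \cdot \eta} \right] \circ T^{n} \right| \right\|_2^{2/3} = 0 .$$ (4b) $$\lim_{N\to\infty} \frac{1}{\lfloor \sqrt{N} \rfloor^{k-1}} \sum_{h \in [\lfloor \sqrt{N} \rfloor]^{k-1}}\left \| \sup_{t\in\mathbb{R}} \left| \frac{1}{N} \sum_{n=1}^N e^{2\pi i n t} \left[\prod_{\eta\in V_{k-1}} c^{|\eta|} f \circ T^{h \cdot \eta} \right] \circ T^{n} \right| \right\|_2^{2/3} = 0.$$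
   Context: Notation: $\|\cdot\|_2$ is the $L^2(\mu)$-norm; $[M]=\{1,\dots,M\}$; $V_k=\{0,1\}^k$; for $\eta\in V_k$, $|\eta|=\sum_j\eta_j$ and $h\cdot\eta=\sum_j h_j\eta_j$; $c$ is complex conjugation, so $c^{|\eta|}g$ equals $g$ if $|\eta|$ is even and $\overline g$ if $|\eta|$ is odd. Host-Kra-Ziegler factors. For an ergodic system and $f\in L^\infty(\mu)$ put $|||f|||_2^4=\lim_H\frac1H\sum_{h=1}^H\left|\int f\cdot\overline{f\circ T^h}\,d\mu\right|^2$ and, for $k\ge3$, $|||f|||_k^{2^k}=\lim_H\frac1H\sum_{h=1}^H|||f\cdot\overline{f\circ T^h}|||_{k-1}^{2^{k-1}}$. For $k\ge1$, $\mathcal{Z}_k$ is the $k$-th Host-Kra-Ziegler factor: the invariant sub-$\sigma$-algebra characterized by $\mathbb{E}(f|\mathcal{Z}_k)=0\iff|||f|||_{k+1}=0$ for $f\in L^\infty(\mu)$. $L^2(\mathcal{Z}_k)^\perp=\{f\in L^2(\mu):\mathbb{E}(f|\mathcal{Z}_k)=0\}$. Equivalently (a known fact), a bounded $f$ lies in $L^2(\mathcal{Z}_k)^\perp$ if and only if for all $f_1,\dots,f_{k+1}\in L^\infty(\mu)$ with $f_j=f$ for some $j$, $\lim_N\left\|\frac1N\sum_{n=1}^N\prod_{j=1}^{k+1}f_j\circ T^{jn}\right\|_2=0$. *)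

theory Defs
  imports "HOL-Probability.Probability"
begin

section \<open>Invertible ergodic systems\<close>

definition invertible_ergodic_system :: "'a measure \<Rightarrow> ('a \<Rightarrow> 'a) \<Rightarrow> bool" where
  "invertible_ergodic_system M T \<longleftrightarrow>
     prob_space M \<and>
     T \<in> measurable M M \<and> distr M M T = M \<and>
     bij_betw T (space M) (space M) \<and> the_inv_into (space M) T \<in> measurable M M \<and>
     (\<forall>A\<in>sets M. T -` A \<inter> space M = A \<longrightarrow> measure M A = 0 \<or> measure M A = 1)"

text \<open>Elements of \<open>L\<^sup>\<infinity>(\<mu>)\<close> are represented by functions; equality of two elements is
  equality almost everywhere.\<close>

definition Linfty :: "'a measure \<Rightarrow> ('a \<Rightarrow> complex) set" where
  "Linfty M = {f \<in> borel_measurable M. \<exists>C. AE x in M. cmod (f x) \<le> C}"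

definition L2norm :: "'a measure \<Rightarrow> ('a \<Rightarrow> real) \<Rightarrow> real" where
  "L2norm M F = sqrt (\<integral>x. (F x)\<^sup>2 \<partial>M)"

section \<open>Host--Kra--Ziegler factors\<close>

text \<open>The library's conditional expectation is real-valued.\<close>

definition complex_cond_exp :: "'a measure \<Rightarrow> 'a measure \<Rightarrow> ('a \<Rightarrow> complex) \<Rightarrow> 'a \<Rightarrow> complex" where
  "complex_cond_exp M Z f x =
     Complex (real_cond_exp M Z (\<lambda>y. Re (f y)) x) (real_cond_exp M Z (\<lambda>y. Im (f y)) x)"

text \<open>\<open>HK_power M T m f\<close> is the power \<open>|||f|||\<^sub>k\<close> to the \<open>2\<^sup>k\<close> with \<open>k = m + 2\<close>: the recursion
  starts at \<open>k = 2\<close>. For bounded \<open>f\<close> in an ergodic system the limits exist.\<close>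

primrec HK_power :: "'a measure \<Rightarrow> ('a \<Rightarrow> 'a) \<Rightarrow> nat \<Rightarrow> ('a \<Rightarrow> complex) \<Rightarrow> real" where
  "HK_power M T 0 f =
     lim (\<lambda>H. (1 / real H) * (\<Sum>h=1..H. (cmod (\<integral>x. f x * cnj (f ((T ^^ h) x)) \<partial>M))\<^sup>2))"
| "HK_power M T (Suc m) f =
     lim (\<lambda>H. (1 / real H) * (\<Sum>h=1..H. HK_power M T m (\<lambda>x. f x * cnj (f ((T ^^ h) x)))))"

text \<open>Only meaningful for \<open>k \<ge> 2\<close>.\<close>

definition HK_seminorm :: "'a measure \<Rightarrow> ('a \<Rightarrow> 'a) \<Rightarrow> nat \<Rightarrow> ('a \<Rightarrow> complex) \<Rightarrow> real" where
  "HK_seminorm M T k f = root (2 ^ k) (HK_power M T (k - 2) f)"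

text \<open>The characterization determines \<open>\<Z>\<^sub>k\<close> only up to null sets, so being the \<open>k\<close>-th factor
  is a predicate satisfied by every version of it.\<close>

definition HKZ_factor :: "'a measure \<Rightarrow> ('a \<Rightarrow> 'a) \<Rightarrow> nat \<Rightarrow> 'a measure \<Rightarrow> bool" where
  "HKZ_factor M T k Z \<longleftrightarrow>
     subalgebra M Z \<and>
     (\<lambda>A. T -` A \<inter> space M) ` sets Z = sets Z \<and>
     (\<forall>f\<in>Linfty M. (AE x in M. complex_cond_exp M Z f x = 0) \<longleftrightarrow> HK_seminorm M T (k + 1) f = 0)"

definition L2_perp :: "'a measure \<Rightarrow> 'a measure \<Rightarrow> ('a \<Rightarrow> complex) set" where
  "L2_perp M Z = {f \<in> borel_measurable M.
     integrable M (\<lambda>x. (cmod (f x))\<^sup>2) \<and> (AE x in M. complex_cond_exp M Z f x = 0)}"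

section \<open>Averages over cubes\<close>

text \<open>Vectors of length \<open>d\<close> are extensional functions on \<open>{1..d}\<close>.\<close>

definition cube :: "nat \<Rightarrow> (nat \<Rightarrow> nat) set" where
  "cube d = ({1..d} \<rightarrow>\<^sub>E {0, 1})"

definition hbox :: "nat \<Rightarrow> nat \<Rightarrow> (nat \<Rightarrow> nat) set" where
  "hbox d N = ({1..d} \<rightarrow>\<^sub>E {1..N})"

definition cube_prod ::
  "('a \<Rightarrow> 'a) \<Rightarrow> nat \<Rightarrow> ((nat \<Rightarrow> nat) \<Rightarrow> 'a \<Rightarrow> complex) \<Rightarrow> (nat \<Rightarrow> nat) \<Rightarrow> 'a \<Rightarrow> complex" where
  "cube_prod T d g h x =
     (\<Prod>\<eta>\<in>cube d. (cnj ^^ (\<Sum>j=1..d. \<eta> j)) (g \<eta> ((T ^^ (\<Sum>j=1..d. h j * \<eta> j)) x)))"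

definition WW_sup :: "('a \<Rightarrow> 'a) \<Rightarrow> nat \<Rightarrow> ('a \<Rightarrow> complex) \<Rightarrow> 'a \<Rightarrow> real" where
  "WW_sup T N F x =
     (SUP t::real. cmod ((1 / of_nat N) *
        (\<Sum>n=1..N. exp (2 * of_real pi * \<i> * of_nat n * of_real t) * F ((T ^^ n) x))))"

definition cube_family ::
  "'a measure \<Rightarrow> nat \<Rightarrow> ('a \<Rightarrow> complex) \<Rightarrow> ((nat \<Rightarrow> nat) \<Rightarrow> 'a \<Rightarrow> complex) \<Rightarrow> bool" where
  "cube_family M d f g \<longleftrightarrow>
     (\<forall>\<eta>\<in>cube d. g \<eta> \<in> Linfty M) \<and> (\<exists>\<eta>\<in>cube d. AE x in M. g \<eta> x = f x)"

definition pointwise_vanishing ::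
  "'a measure \<Rightarrow> ('a \<Rightarrow> 'a) \<Rightarrow> nat \<Rightarrow> ((nat \<Rightarrow> nat) \<Rightarrow> 'a \<Rightarrow> complex) \<Rightarrow> bool" where
  "pointwise_vanishing M T d g \<longleftrightarrow>
     (AE x in M. (\<lambda>N. (1 / real N ^ d) *
        (\<Sum>h\<in>hbox d N. (WW_sup T N (cube_prod T d g h) x)\<^sup>2)) \<longlonglongrightarrow> 0)"

definition norm_vanishing ::
  "'a measure \<Rightarrow> ('a \<Rightarrow> 'a) \<Rightarrow> nat \<Rightarrow> ((nat \<Rightarrow> nat) \<Rightarrow> 'a \<Rightarrow> complex) \<Rightarrow> bool" where
  "norm_vanishing M T d g \<longleftrightarrow>
     (\<lambda>N. (1 / real N ^ d) *
        (\<Sum>h\<in>hbox d N. (L2norm M (WW_sup T N (cube_prod T d g h)))\<^sup>2)) \<longlonglongrightarrow> 0"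

definition sqrt_norm_vanishing ::
  "'a measure \<Rightarrow> ('a \<Rightarrow> 'a) \<Rightarrow> nat \<Rightarrow> ((nat \<Rightarrow> nat) \<Rightarrow> 'a \<Rightarrow> complex) \<Rightarrow> bool" where
  "sqrt_norm_vanishing M T d g \<longleftrightarrow>
     (\<lambda>N. (1 / real (nat \<lfloor>sqrt (real N)\<rfloor>) ^ d) *
        (\<Sum>h\<in>hbox d (nat \<lfloor>sqrt (real N)\<rfloor>).
           L2norm M (WW_sup T N (cube_prod T d g h)) powr (2 / 3))) \<longlonglongrightarrow> 0"

end

theory Submission
  imports Defs
begin

text \<open>
  Write \<open>d = k - 1\<close> and \<open>\<Delta>\<^sub>r f = f \<cdot> cnj (f \<circ> T\<^sup>r)\<close>. By the characterization of the factor, condition (1)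
  says \<open>|||f|||\<^sub>d\<^sub>+\<^sub>2 = 0\<close>.

  The seminorms are handled through the kernels \<open>K(i,j) = |||f \<circ> T\<^sup>i \<cdot> cnj (f \<circ> T\<^sup>j)|||\<^sub>k\<close> to the power \<open>2\<^sup>k\<close>,
  which are stationary and positive semidefinite by induction on \<open>k\<close>. Hence they obey a mean ergodic
  theorem: the limits defining the next seminorm exist, and they are at most
  \<open>N\<^sup>-\<^sup>2 \<Sum>\<^sub>i\<^sub>,\<^sub>j\<^sub><\<^sub>N K(i,j)\<close> for every \<open>N\<close>. Iterating this monotonicity bounds \<open>|||f|||\<^sub>d\<^sub>+\<^sub>2\<close> by an average over a
  box of \<open>|||F\<^sub>h|||\<^sub>2\<close>, where \<open>F\<^sub>h\<close> is the product over the cube, and Parseval bounds \<open>|||F\<^sub>h|||\<^sub>2\<close> by the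
  \<open>L\<^sup>2\<close> norm of the Wiener--Wintner supremum at any scale. So every vanishing condition implies (1).

  Conversely, along a generic orbit the averages live on a cyclic group of order \<open>(d + 1) N\<close>. One van der
  Corput step removes the supremum over \<open>t\<close>, another the absolute value inside the average over \<open>h\<close>, and
  \<open>d - 1\<close> Cauchy--Schwarz steps remove all functions except \<open>f\<close>. Each step uses shifts of bounded length, so
  Birkhoff's theorem for the countably many iterated differences \<open>\<Delta>\<^sub>r\<^sub>1 \<dots> \<Delta>\<^sub>r\<^sub>j f\<close> identifies the limit, which
  is bounded by a power of \<open>|||f|||\<^sub>d\<^sub>+\<^sub>2\<close>. This works for any range of \<open>h\<close> that tends to infinity and is at most
  \<open>N\<close>, in particular for \<open>N\<close> and \<open>\<lfloor>\<surd>N\<rfloor>\<close>.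
\<close>

section \<open>Stationary positive semidefinite kernels\<close>

text \<open>The obstacle is that the range of h grows together with the length N of the averages, so
  the limit in n cannot be taken before the one in h. One direction meets it with an inequality
  valid for every box size: at each level the power of the seminorm is the infimum of window
  averages, not only their limit. This is what positive semidefiniteness is carried along for; as
  \<open>lim\<close> is a total operator, it also supplies the convergence without which the
  recursion says nothing. The other direction meets it by spreading all indices n + h \<cdot> \<eta>
  over one period: the large shifts are absorbed by translation invariance of a finite group, and f
  is differenced only by shifts up to some H that is fixed before N grows. Hence only f has to
  follow a generic orbit; the other functions enter through the bound 1 alone. The exponents 2^j
  arise because each step squares the quantity it bounds, in parallel with the recursion of the
  seminorms. Everything is normalized to functions bounded by 1, and homogeneity restores the
  general case.\<close>

lemma shift_sum_diff:
  fixes w :: "nat \<Rightarrow> 'b::real_normed_vector"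
  assumes "\<And>i. norm (w i) \<le> B"
  shows "norm ((\<Sum>i<R. w (i + k)) - (\<Sum>i<R. w i)) \<le> 2 * real k * B"
proof (induction k)
  case (Suc k)
  have "(\<Sum>i<R. w (i + Suc k)) - (\<Sum>i<R. w (i + k)) = w (R + k) - w k"
    by (simp add: sum_subtractf[symmetric] sum_lessThan_telescope[of "\<lambda>i. w (i + k)", simplified])
  then have "norm ((\<Sum>i<R. w (i + Suc k)) - (\<Sum>i<R. w (i + k))) \<le> 2 * B"
    using norm_triangle_ineq4[of "w (R + k)" "w k"] assms[of "R+k"] assms[of k] by simp
  moreover have "norm ((\<Sum>i<R. w (i + Suc k)) - (\<Sum>i<R. w i)) \<le>
      norm ((\<Sum>i<R. w (i + Suc k)) - (\<Sum>i<R. w (i + k))) + norm ((\<Sum>i<R. w (i + k)) - (\<Sum>i<R. w i))"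
    using norm_triangle_ineq[of "(\<Sum>i<R. w (i + Suc k)) - (\<Sum>i<R. w (i + k))"
        "(\<Sum>i<R. w (i + k)) - (\<Sum>i<R. w i)"] by simp
  ultimately show ?case using Suc by (simp add: algebra_simps)
qed auto

lemmas shift_sum_diff_real = shift_sum_diff[where 'b = real, unfolded real_norm_def]

text \<open>Truncated subtraction makes \<open>(i - j) + (j - i)\<close> the distance of \<open>i\<close> and \<open>j\<close>.\<close>

lemma sum_dist_le:
  fixes \<gamma> :: "nat \<Rightarrow> real"
  assumes pos: "\<And>r. 0 \<le> \<gamma> r"
  shows "(\<Sum>i<n. \<Sum>j<n. \<gamma> ((i - j) + (j - i))) \<le> real n * \<gamma> 0 + 2 * real n * (\<Sum>r=1..n. \<gamma> r)"
proof -
  have row: "(\<Sum>j<n. \<gamma> ((i - j) + (j - i))) \<le> \<gamma> 0 + 2 * (\<Sum>r=1..n. \<gamma> r)" if "i < n" for i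
  proof -
    have "(\<Sum>j<n. \<gamma> ((i - j) + (j - i))) =
        (\<Sum>j\<in>{..<i}. \<gamma> ((i - j) + (j - i))) + (\<Sum>j\<in>{i}. \<gamma> ((i - j) + (j - i)))
        + (\<Sum>j\<in>{i<..<n}. \<gamma> ((i - j) + (j - i)))"
    proof -
      have "{..<n} = {..<i} \<union> {i} \<union> {i<..<n}" using that by auto
      moreover have "sum f ({..<i} \<union> {i} \<union> {i<..<n}) = sum f {..<i} + sum f {i} + sum f {i<..<n}" for f :: "nat \<Rightarrow> real"
        by (subst sum.union_disjoint, auto)+
      ultimately show ?thesis by simp
    qed
    moreover have "(\<Sum>j\<in>{..<i}. \<gamma> ((i - j) + (j - i))) = (\<Sum>r\<in>(\<lambda>j. i - j) ` {..<i}. \<gamma> r)"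
      by (subst sum.reindex) (auto simp: inj_on_def)
    moreover have "\<dots> \<le> (\<Sum>r=1..n. \<gamma> r)"
      using that by (intro sum_mono2) (auto simp: pos)
    moreover have "(\<Sum>j\<in>{i<..<n}. \<gamma> ((i - j) + (j - i))) = (\<Sum>r\<in>(\<lambda>j. j - i) ` {i<..<n}. \<gamma> r)"
      by (subst sum.reindex) (auto simp: inj_on_def)
    moreover have "\<dots> \<le> (\<Sum>r=1..n. \<gamma> r)"
      using that by (intro sum_mono2) (auto simp: pos)
    ultimately show ?thesis by simp
  qed
  have "(\<Sum>i<n. \<Sum>j<n. \<gamma> ((i - j) + (j - i))) \<le> (\<Sum>i<n. \<gamma> 0 + 2 * (\<Sum>r=1..n. \<gamma> r))"
    by (intro sum_mono row) auto
  then show ?thesis by (simp add: algebra_simps)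
qed

text \<open>An abstract Gram matrix: \<open>K i j\<close> plays the inner product of U^i v and U^j v
  for an isometry U. Real coefficients in \<open>psd\<close> suffice because K is real and
  symmetric. All vectors used are finite combinations of the U^i v, so coefficient vectors stand for
  them.\<close>

locale stationary_kernel =
  fixes K :: "nat \<Rightarrow> nat \<Rightarrow> real" and B :: real
  assumes sym: "K i j = K j i"
    and stat: "K (Suc i) (Suc j) = K i j"
    and psd: "0 \<le> (\<Sum>i<n. \<Sum>j<n. c i * c j * K i j)"
    and bound: "\<bar>K i j\<bar> \<le> B"
begin

lemma stat_add: "K (i + s) (j + s) = K i j"
  by (induction s) (auto simp: stat)

lemma K_dist: "K i j = K 0 ((i - j) + (j - i))"
proof (cases "i \<le> j")
  case True then show ?thesis using stat_add[of 0 i "j - i"] by simp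
next
  case False then show ?thesis using stat_add[of 0 j "i - j"] sym[of i j] by simp
qed

definition form :: "nat \<Rightarrow> (nat \<Rightarrow> real) \<Rightarrow> (nat \<Rightarrow> real) \<Rightarrow> real" where
  "form n u v = (\<Sum>i<n. \<Sum>j<n. u i * v j * K i j)"

text \<open>Coefficients of the average of the vectors at times i, ..., i + N - 1. By
  \<open>form_win\<close> the numbers \<open>avg\<close> are the inner products of such averages,
  whatever the truncation n, once it covers both windows.\<close>

definition win :: "nat \<Rightarrow> nat \<Rightarrow> nat \<Rightarrow> real" where
  "win i N k = (if i \<le> k \<and> k < i + N then 1 / real N else 0)"

definition avg :: "nat \<Rightarrow> nat \<Rightarrow> nat \<Rightarrow> nat \<Rightarrow> real" where
  "avg i N j M = (\<Sum>k<N. \<Sum>l<M. K (i + k) (j + l)) / (real N * real M)"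

lemma form_add_left: "form n (\<lambda>x. u x + v x) w = form n u w + form n v w"
  by (simp add: form_def algebra_simps sum.distrib)

lemma form_add_right: "form n w (\<lambda>x. u x + v x) = form n w u + form n w v"
  by (simp add: form_def algebra_simps sum.distrib)

lemma form_scale_left: "form n (\<lambda>x. r * u x) w = r * form n u w"
  by (simp add: form_def algebra_simps sum_distrib_left)

lemma form_scale_right: "form n w (\<lambda>x. r * u x) = r * form n w u"
  by (simp add: form_def algebra_simps sum_distrib_left)

lemma form_sym: "form n u v = form n v u"
  unfolding form_def by (subst sum.swap) (simp add: sym mult.commute mult.left_commute)

lemma form_nonneg: "0 \<le> form n u u"
  unfolding form_def by (rule psd)

lemma form_cs: "(form n u v)\<^sup>2 \<le> form n u u * form n v v"
proof -
  have q: "0 \<le> form n u u + 2 * t * form n u v + t\<^sup>2 * form n v v" for t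
  proof -
    have "0 \<le> form n (\<lambda>x. u x + t * v x) (\<lambda>x. u x + t * v x)" by (rule form_nonneg)
    then show ?thesis
      unfolding form_add_left form_add_right form_scale_left form_scale_right form_sym[of n v u]
      by (simp add: algebra_simps power2_eq_square)
  qed
  show ?thesis
  proof (cases "form n v v = 0")
    case True
    have "form n u v = 0"
    proof (rule ccontr)
      assume b: "form n u v \<noteq> 0"
      \<comment> \<open>With a null vector v the polynomial is affine in t, and this t gives it the
        value -1.\<close>
      show False using q[of "- (form n u u + 1) / (2 * form n u v)"] b True by (simp add: field_simps)
    qed
    then show ?thesis using True by simp
  next
    case False
    then have p: "form n v v > 0" using form_nonneg[of n v] by linarith
    show ?thesis using q[of "- form n u v / form n v v"] p
      by (simp add: field_simps power2_eq_square)
  qed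
qed

lemma form_diff: "form n (\<lambda>x. u x + (-1) * v x) (\<lambda>x. u x + (-1) * v x) = form n u u + form n v v - 2 * form n u v"
  unfolding form_add_left form_add_right form_scale_left form_scale_right form_sym[of n v u] by simp

lemma win_sum: "i + N \<le> n \<Longrightarrow> (\<Sum>k<n. win i N k * f k) = (\<Sum>k<N. f (i + k)) / real N"
proof -
  assume le: "i + N \<le> n"
  have "(\<Sum>k<n. win i N k * f k) = (\<Sum>k\<in>{i..<i+N}. win i N k * f k)"
    using le by (intro sum.mono_neutral_right) (auto simp: win_def)
  also have "\<dots> = (\<Sum>k\<in>{i..<i+N}. f k / real N)"
    by (intro sum.cong) (auto simp: win_def)
  also have "\<dots> = (\<Sum>k<N. f (i + k) / real N)"
    using sum.shift_bounds_nat_ivl[of "\<lambda>k. f k / real N" 0 i N]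
    by (simp add: add.commute lessThan_atLeast0)
  finally show ?thesis by (simp add: sum_divide_distrib)
qed

lemma form_win:
  assumes "i + N \<le> n" "j + M \<le> n"
  shows "form n (win i N) (win j M) = avg i N j M"
proof -
  have "form n (win i N) (win j M) = (\<Sum>k<n. win i N k * (\<Sum>l<n. win j M l * K k l))"
    by (simp add: form_def sum_distrib_left mult.assoc)
  also have "\<dots> = (\<Sum>k<N. (\<Sum>l<M. K (i + k) (j + l)) / real M) / real N"
    by (simp add: win_sum assms del: times_divide_eq_right)
  finally show ?thesis by (simp add: avg_def sum_divide_distrib[symmetric] mult.commute)
qed

lemma avg_sym: "avg i N j M = avg j M i N"
  unfolding avg_def by (subst sum.swap) (simp add: sym mult.commute)

lemma avg_stat: "avg i N i M = avg 0 N 0 M"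
  unfolding avg_def using stat_add[of _ i] by (simp add: add.commute[of i])

abbreviation "a N \<equiv> avg 0 N 0 N"

lemma B_nonneg: "0 \<le> B"
  using bound[of 0 0] by linarith

text \<open>One index is shifted at a time; each of the R rows, then each of the R columns, changes
  by at most 2 C B through its ends.\<close>

lemma double_shift:
  assumes "k \<le> C" "l \<le> C"
  shows "\<bar>(\<Sum>i<R. \<Sum>j<R. K (i + k) (j + l)) - (\<Sum>i<R. \<Sum>j<R. K i j)\<bar> \<le> 4 * real R * real C * B"
proof -
  have 1: "\<bar>(\<Sum>j<R. K (i + k) (j + l)) - (\<Sum>j<R. K (i + k) j)\<bar> \<le> 2 * real C * B" for i
  proof -
    have "\<bar>(\<Sum>j<R. K (i + k) (j + l)) - (\<Sum>j<R. K (i + k) j)\<bar> \<le> 2 * real l * B"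
      by (rule shift_sum_diff_real[of "\<lambda>j. K (i + k) j", OF bound])
    also have "\<dots> \<le> 2 * real C * B" using assms B_nonneg by (intro mult_right_mono) auto
    finally show ?thesis .
  qed
  have 2: "\<bar>(\<Sum>i<R. K (i + k) j) - (\<Sum>i<R. K i j)\<bar> \<le> 2 * real C * B" for j
  proof -
    have "\<bar>(\<Sum>i<R. K (i + k) j) - (\<Sum>i<R. K i j)\<bar> \<le> 2 * real k * B"
      by (rule shift_sum_diff_real[of "\<lambda>i. K i j", OF bound])
    also have "\<dots> \<le> 2 * real C * B" using assms B_nonneg by (intro mult_right_mono) auto
    finally show ?thesis .
  qed
  have "\<bar>\<Sum>i<R. (\<Sum>j<R. K (i + k) (j + l)) - (\<Sum>j<R. K (i + k) j)\<bar> \<le> (\<Sum>i<R. 2 * real C * B)"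
    by (rule order_trans[OF sum_abs], rule sum_mono, rule 1)
  moreover have "\<bar>\<Sum>j<R. (\<Sum>i<R. K (i + k) j) - (\<Sum>i<R. K i j)\<bar> \<le> (\<Sum>j<R. 2 * real C * B)"
    by (rule order_trans[OF sum_abs], rule sum_mono, rule 2)
  moreover have "(\<Sum>j<R. \<Sum>i<R. K (i + k) j) = (\<Sum>i<R. \<Sum>j<R. K (i + k) j)"
    "(\<Sum>j<R. \<Sum>i<R. K i j) = (\<Sum>i<R. \<Sum>j<R. K i j)"
    by (rule sum.swap)+
  ultimately show ?thesis by (simp add: sum_subtractf abs_le_iff algebra_simps)
qed

text \<open>Exchanging the sums turns the left side into an average of translated R by R squares
  over the offsets k < N and l < M. By \<open>double_shift\<close> a translate differs from the
  square at the origin only by a boundary term.\<close>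

lemma avg_avg:
  assumes "N \<ge> 1" "M \<ge> 1" "R \<ge> 1" "N \<le> C" "M \<le> C"
  shows "(\<Sum>i<R. \<Sum>j<R. avg i N j M) \<ge> (real R)\<^sup>2 * a R - 4 * real R * real C * B"
proof -
  have "(\<Sum>i<R. \<Sum>j<R. avg i N j M)
      = (\<Sum>k<N. \<Sum>l<M. (\<Sum>i<R. \<Sum>j<R. K (i + k) (j + l)) / (real N * real M))"
  proof -
    have "(\<Sum>i<R. \<Sum>j<R. avg i N j M) = (\<Sum>i<R. \<Sum>j<R. \<Sum>k<N. \<Sum>l<M. K (i + k) (j + l) / (real N * real M))"
      by (simp add: avg_def sum_divide_distrib)
    also have "\<dots> = (\<Sum>i<R. \<Sum>k<N. \<Sum>l<M. \<Sum>j<R. K (i + k) (j + l) / (real N * real M))"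
      by (rule sum.cong[OF refl], subst sum.swap, rule sum.cong[OF refl], rule sum.swap)
    also have "\<dots> = (\<Sum>k<N. \<Sum>l<M. \<Sum>i<R. \<Sum>j<R. K (i + k) (j + l) / (real N * real M))"
      by (subst sum.swap, rule sum.cong[OF refl], rule sum.swap)
    finally show ?thesis by (simp add: sum_divide_distrib)
  qed
  also have "\<dots> \<ge> (\<Sum>k<N. \<Sum>l<M. ((\<Sum>i<R. \<Sum>j<R. K i j) - 4 * real R * real C * B) / (real N * real M))"
  proof (intro sum_mono divide_right_mono)
    fix k l assume "k \<in> {..<N}" "l \<in> {..<M}"
    then show "(\<Sum>i<R. \<Sum>j<R. K i j) - 4 * real R * real C * B \<le> (\<Sum>i<R. \<Sum>j<R. K (i + k) (j + l))"
      using double_shift[of k C l R] assms by auto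
  qed auto
  also have "(\<Sum>k<N. \<Sum>l<M. ((\<Sum>i<R. \<Sum>j<R. K i j) - 4 * real R * real C * B) / (real N * real M))
     = (\<Sum>i<R. \<Sum>j<R. K i j) - 4 * real R * real C * B"
    using assms by (simp add: field_simps)
  also have "\<dots> = (real R)\<^sup>2 * a R - 4 * real R * real C * B"
    using assms by (simp add: avg_def power2_eq_square)
  finally show ?thesis by simp
qed

text \<open>A convex combination of translates of \<open>c = (win 0 N + win 0 M) / 2\<close> has at most the norm
  of \<open>c\<close>; averaging over many translates of \<open>c\<close> gives nearly the long window average.\<close>

lemma mid_ge:
  assumes "N \<ge> 1" "M \<ge> 1" "R \<ge> 1" "N \<le> C" "M \<le> C"
  shows "a N + 2 * avg 0 N 0 M + a M \<ge> 4 * a R - 16 * real C * B / real R"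
proof -
  define X where "X i j = avg i N j N + avg i N j M + avg i M j N + avg i M j M" for i j
  have X_le: "X i j + X j i \<le> 2 * X 0 0" for i j
  proof -
    define n where "n = i + j + N + M"
    define c where "c i k = win i N k + win i M k" for i k
    have X: "X i' j' = form n (c i') (c j')" if "i' \<in> {i,j}" "j' \<in> {i,j}" for i' j'
      unfolding X_def c_def form_add_left form_add_right
      using that by (auto simp: form_win n_def)
    have "0 \<le> form n (c i) (c i) + form n (c j) (c j) - 2 * form n (c i) (c j)"
      unfolding form_diff[symmetric] by (rule form_nonneg)
    then have "0 \<le> X i i + X j j - (X i j + X j i)"
      using X form_sym[of n "c i" "c j"] by simp
    moreover have "X i i = X 0 0" "X j j = X 0 0"
      by (simp_all add: X_def avg_stat[of i] avg_stat[of j])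
    ultimately show ?thesis by simp
  qed
  have "2 * (\<Sum>i<R. \<Sum>j<R. X i j) = (\<Sum>i<R. \<Sum>j<R. X i j + X j i)"
    by (simp add: sum.distrib sum.swap[of "\<lambda>i j. X j i"])
  also have "\<dots> \<le> (\<Sum>i<R. \<Sum>j<R. 2 * X 0 0)"
    by (intro sum_mono X_le)
  finally have "(\<Sum>i<R. \<Sum>j<R. X i j) \<le> (real R)\<^sup>2 * X 0 0"
    by (simp add: power2_eq_square)
  moreover have "(\<Sum>i<R. \<Sum>j<R. X i j) \<ge> 4 * ((real R)\<^sup>2 * a R - 4 * real R * real C * B)"
    unfolding X_def sum.distrib
    using avg_avg[of N N R C] avg_avg[of N M R C] avg_avg[of M N R C] avg_avg[of M M R C] assms by simp
  ultimately have "4 * ((real R)\<^sup>2 * a R - 4 * real R * real C * B) \<le> (real R)\<^sup>2 * X 0 0" by linarith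
  then have "real R * (4 * real R * a R - 16 * real C * B) \<le> real R * (real R * X 0 0)"
    by (simp add: algebra_simps power2_eq_square)
  then have "4 * real R * a R - 16 * real C * B \<le> real R * X 0 0"
    using assms by (subst (asm) mult_le_cancel_left_pos) auto
  then have "4 * a R - 16 * real C * B / real R \<le> X 0 0"
    using assms by (simp add: field_simps)
  then show ?thesis using avg_sym[of 0 M 0 N] by (simp add: X_def)
qed

lemma a_nonneg: "0 \<le> a N"
  using form_nonneg[of N "win 0 N"] form_win[of 0 N N 0 N] by simp

text \<open>Von Neumann's argument: the squared norms \<open>a N\<close> of the window averages tend
  to their infimum, and the parallelogram law makes the averages Cauchy. The limit vector is
  invariant, so its inner product with the vector at time 0 equals its squared norm. That number is
  the infimum of the \<open>a N\<close>, hence the bound for every N.\<close>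

theorem mean_ergodic:
  obtains L where "(\<lambda>H. (1 / real H) * (\<Sum>h=1..H. K 0 h)) \<longlonglongrightarrow> L" "0 \<le> L"
    "\<And>N. N \<ge> 1 \<Longrightarrow> L \<le> (\<Sum>i<N. \<Sum>j<N. K i j) / (real N)\<^sup>2"
proof -
  define \<alpha> where "\<alpha> = (INF N\<in>{1..}. a N)"
  have bdd: "bdd_below (a ` {1..})" by (rule bdd_belowI[of _ 0]) (auto intro: a_nonneg)
  have \<alpha>_le: "\<alpha> \<le> a N" if "N \<ge> 1" for N
    unfolding \<alpha>_def using that bdd by (intro cINF_lower) auto
  have \<alpha>0: "0 \<le> \<alpha>" unfolding \<alpha>_def by (rule cINF_greatest) (auto intro: a_nonneg)
  have ev: "\<forall>\<^sub>F R in sequentially. a R < \<alpha> + e" if "e > 0" for e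
  proof -
    have "\<exists>N\<in>{1..}. a N < \<alpha> + e/2"
      unfolding \<alpha>_def using that bdd by (subst cINF_less_iff[symmetric]) auto
    then obtain N where N: "N \<ge> 1" "a N < \<alpha> + e/2" by auto
    have "(\<lambda>R. 4 * real N * B / real R) \<longlonglongrightarrow> 0" by (rule lim_const_over_n)
    then have "\<forall>\<^sub>F R in sequentially. 4 * real N * B / real R < e/2"
      using that by (intro order_tendstoD) auto
    then show ?thesis using eventually_ge_at_top[of 1]
    proof eventually_elim
      case (elim R)
      then show ?case using mid_ge[of N N R N] N by simp
    qed
  qed
  have a_lim: "a \<longlonglongrightarrow> \<alpha>"
  proof (rule order_tendstoI)
    fix y assume "y < \<alpha>"
    then show "\<forall>\<^sub>F R in sequentially. y < a R"
      by (intro eventually_mono[OF eventually_ge_at_top[of 1]]) (use \<alpha>_le in force)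
  next
    fix y assume "\<alpha> < y"
    then show "\<forall>\<^sub>F R in sequentially. a R < y" using ev[of "y - \<alpha>"] by simp
  qed
  have mid: "4 * \<alpha> \<le> a N + 2 * avg 0 N 0 M + a M" if "N \<ge> 1" "M \<ge> 1" for N M
  proof (rule tendsto_upperbound)
    show "(\<lambda>R. 4 * a R - 16 * real (N + M) * B / real R) \<longlonglongrightarrow> 4 * \<alpha>"
      by (rule tendsto_eq_intros a_lim lim_const_over_n refl)+ simp
    show "\<forall>\<^sub>F R in sequentially. 4 * a R - 16 * real (N + M) * B / real R \<le> a N + 2 * avg 0 N 0 M + a M"
      using eventually_ge_at_top[of 1] by eventually_elim (rule mid_ge, use that in auto)
  qed simp
  define m where "m N = avg 0 1 0 N" for N
  \<comment> \<open>Cauchy--Schwarz against the vector at time 0, whose squared norm is at most B.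
    The parallelogram law and \<open>mid\<close> then bound the squared norm of the difference of
    the two windows.\<close>
  have cs: "(m N - m M)\<^sup>2 \<le> B * (2 * a N + 2 * a M - 4 * \<alpha>)" if "N \<ge> 1" "M \<ge> 1" for N M
  proof -
    define n where "n = N + M"
    define v where "v x = win 0 N x + (-1) * win 0 M x" for x
    have "form n (win 0 1) v = m N - m M"
      unfolding v_def form_add_right form_scale_right using that by (simp add: form_win n_def m_def)
    moreover have "form n v v = a N + a M - 2 * avg 0 N 0 M"
      unfolding v_def form_diff by (simp add: form_win n_def)
    moreover have "form n (win 0 1) (win 0 1) \<le> B"
      using that bound[of 0 0] by (simp add: form_win n_def avg_def abs_le_iff)
    ultimately have "(m N - m M)\<^sup>2 \<le> B * (a N + a M - 2 * avg 0 N 0 M)"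
      using form_cs[of n "win 0 1" v] form_nonneg[of n v]
      by (smt (verit, best) mult_right_mono)
    also have "\<dots> \<le> B * (2 * a N + 2 * a M - 4 * \<alpha>)"
      using mid[OF that] B_nonneg by (intro mult_left_mono) auto
    finally show ?thesis .
  qed
  have "Cauchy m"
  proof (rule metric_CauchyI)
    fix e :: real assume e: "e > 0"
    define \<delta> where "\<delta> = e\<^sup>2 / (8 * (B + 1))"
    have \<delta>: "\<delta> > 0" using e B_nonneg by (simp add: \<delta>_def)
    from ev[OF \<delta>] obtain R0 where R0: "\<And>R. R \<ge> R0 \<Longrightarrow> a R < \<alpha> + \<delta>"
      by (auto simp: eventually_sequentially)
    show "\<exists>R0. \<forall>N\<ge>R0. \<forall>M\<ge>R0. dist (m N) (m M) < e"
    proof (intro exI allI impI)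
      fix N M assume NM: "max 1 R0 \<le> N" "max 1 R0 \<le> M"
      have "(m N - m M)\<^sup>2 \<le> B * (2 * a N + 2 * a M - 4 * \<alpha>)" using cs NM by simp
      also have "\<dots> \<le> B * (4 * \<delta>)"
        using R0[of N] R0[of M] NM B_nonneg by (intro mult_left_mono) auto
      also have "\<dots> < e\<^sup>2" using e B_nonneg by (simp add: \<delta>_def field_simps add_pos_nonneg)
      finally show "dist (m N) (m M) < e"
        using e power2_less_imp_less[of "\<bar>m N - m M\<bar>" e] by (simp add: dist_real_def)
    qed
  qed
  then obtain L where L: "m \<longlonglongrightarrow> L" using Cauchy_convergent_iff convergentD by blast
  \<comment> \<open>By stationarity row k is row 0 shifted by k, so all rows have the same averages
    up to boundary terms.\<close>
  have avg_lim: "(\<lambda>R. avg 0 N 0 R) \<longlonglongrightarrow> L" if N: "N \<ge> 1" for N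
  proof -
    have "\<bar>avg 0 N 0 R - m R\<bar> \<le> 2 * real N * B / real R" if R: "R \<ge> 1" for R
    proof -
      have eq: "avg 0 N 0 R - m R = (\<Sum>k<N. (\<Sum>l<R. K k l) - (\<Sum>l<R. K 0 l)) / (real N * real R)"
        using N R by (simp add: avg_def m_def sum_subtractf field_simps)
      have "\<bar>(\<Sum>l<R. K k l) - (\<Sum>l<R. K 0 l)\<bar> \<le> 2 * real N * B" if "k < N" for k
      proof -
        have "(\<Sum>l<R. K 0 l) = (\<Sum>l<R. K k (l + k))"
          using stat_add[of 0 k] by simp
        then have "\<bar>(\<Sum>l<R. K k l) - (\<Sum>l<R. K 0 l)\<bar> \<le> 2 * real k * B"
          using shift_sum_diff_real[of "\<lambda>l. K k l", OF bound, of k R] by (simp add: abs_minus_commute)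
        also have "\<dots> \<le> 2 * real N * B" using that B_nonneg by (intro mult_right_mono) auto
        finally show ?thesis .
      qed
      then have "\<bar>\<Sum>k<N. (\<Sum>l<R. K k l) - (\<Sum>l<R. K 0 l)\<bar> \<le> (\<Sum>k<N. 2 * real N * B)"
        by (intro order_trans[OF sum_abs] sum_mono) auto
      then show ?thesis unfolding eq using N R by (simp add: abs_mult field_simps)
    qed
    then have "\<forall>\<^sub>F R in sequentially. \<bar>avg 0 N 0 R - m R\<bar> \<le> 2 * real N * B / real R"
      by (intro eventually_mono[OF eventually_ge_at_top[of 1]])
    then have "(\<lambda>R. avg 0 N 0 R - m R) \<longlonglongrightarrow> 0"
      by (intro Lim_null_comparison[OF _ lim_const_over_n[of "2 * real N * B"]]) simp
    from tendsto_add[OF this L] show ?thesis by simp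
  qed
  \<comment> \<open>The lower bound is \<open>mid\<close> with both windows sent to infinity, one
    after the other; the upper bound is 2 <u, v> \<le> |u|^2 + |v|^2 for two windows.\<close>
  have "L = \<alpha>"
  proof (rule antisym)
    show "\<alpha> \<le> L"
    proof (rule tendsto_upperbound[OF tendsto_const])
    have "4 * \<alpha> \<le> a N + 2 * L + \<alpha>" if "N \<ge> 1" for N
    proof (rule tendsto_lowerbound)
      show "(\<lambda>R. a N + 2 * avg 0 N 0 R + a R) \<longlonglongrightarrow> a N + 2 * L + \<alpha>"
        by (intro tendsto_intros avg_lim a_lim that)
      show "\<forall>\<^sub>F R in sequentially. 4 * \<alpha> \<le> a N + 2 * avg 0 N 0 R + a R"
        using eventually_ge_at_top[of 1] by eventually_elim (rule mid[OF that])
    qed simp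
    then have "4 * \<alpha> \<le> \<alpha> + 2 * L + \<alpha>"
      by (intro tendsto_lowerbound[of "\<lambda>N. a N + 2 * L + \<alpha>" _ sequentially]
          tendsto_intros a_lim) (auto simp: eventually_sequentially)
    then show "\<forall>\<^sub>F x in sequentially. \<alpha> \<le> L" by simp
    qed simp
    have "2 * L \<le> a N + \<alpha>" if "N \<ge> 1" for N
    proof (rule tendsto_le[OF _ _ tendsto_mult[OF tendsto_const avg_lim[OF that]]])
      show "(\<lambda>R. a N + a R) \<longlonglongrightarrow> a N + \<alpha>" by (intro tendsto_intros a_lim)
      show "\<forall>\<^sub>F R in sequentially. 2 * avg 0 N 0 R \<le> a N + a R"
      proof (rule always_eventually, rule allI)
        fix R
        have "0 \<le> form (N + R) (win 0 N) (win 0 N) + form (N + R) (win 0 R) (win 0 R) - 2 * form (N + R) (win 0 N) (win 0 R)"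
          unfolding form_diff[symmetric] by (rule form_nonneg)
        then show "2 * avg 0 N 0 R \<le> a N + a R" by (simp add: form_win)
      qed
    qed simp
    then have "2 * L \<le> \<alpha> + \<alpha>"
      by (intro tendsto_lowerbound[of "\<lambda>N. a N + \<alpha>" _ sequentially]
          tendsto_intros a_lim) (auto simp: eventually_sequentially)
    then show "L \<le> \<alpha>" by simp
  qed
  moreover have "(\<lambda>H. (1 / real H) * (\<Sum>h=1..H. K 0 h)) \<longlonglongrightarrow> L"
  proof -
    have "\<bar>(1 / real H) * (\<Sum>h=1..H. K 0 h) - m H\<bar> \<le> 2 * B / real H" for H
    proof -
      have "(\<Sum>h=1..H. K 0 h) = (\<Sum>i<H. K 0 (i + 1))"
        by (rule sum.reindex_bij_witness[of _ "\<lambda>i. i + 1" "\<lambda>i. i - 1"]) auto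
      then have "\<bar>(\<Sum>h=1..H. K 0 h) - (\<Sum>h<H. K 0 h)\<bar> \<le> 2 * B"
        using shift_sum_diff_real[of "\<lambda>l. K 0 l", OF bound, of 1 H] by simp
      moreover have "(1 / real H) * (\<Sum>h=1..H. K 0 h) - m H = ((\<Sum>h=1..H. K 0 h) - (\<Sum>h<H. K 0 h)) / real H"
        by (simp add: m_def avg_def diff_divide_distrib)
      ultimately show ?thesis by (simp add: divide_right_mono)
    qed
    then have "(\<lambda>H. (1 / real H) * (\<Sum>h=1..H. K 0 h) - m H) \<longlonglongrightarrow> 0"
      by (intro Lim_null_comparison[OF _ lim_const_over_n[of "2 * B"]]) simp
    from tendsto_add[OF this L] show ?thesis by simp
  qed
  ultimately show ?thesis
    using that[of L] \<alpha>0 \<alpha>_le by (simp add: avg_def power2_eq_square)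
qed

end

section \<open>Differencing on cyclic groups\<close>

definition mean :: "'i set \<Rightarrow> ('i \<Rightarrow> 'b::real_vector) \<Rightarrow> 'b" where
  "mean A f = (1 / real (card A)) *\<^sub>R (\<Sum>x\<in>A. f x)"

lemma mean_cong: "A = B \<Longrightarrow> (\<And>x. x \<in> B \<Longrightarrow> f x = g x) \<Longrightarrow> mean A f = mean B g"
  by (simp add: mean_def cong: sum.cong)

lemma mean_real: "mean A f = (\<Sum>x\<in>A. f x) / real (card A)" for f :: "_ \<Rightarrow> real"
  by (simp add: mean_def)

lemma mean_add: "mean A (\<lambda>x. f x + g x) = mean A f + mean A g"
  by (simp add: mean_def sum.distrib scaleR_right_distrib)

lemma mean_diff: "mean A (\<lambda>x. f x - g x) = mean A f - mean A g"
  by (simp add: mean_def sum_subtractf scaleR_right_diff_distrib)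

lemma mean_mult_left: "mean A (\<lambda>x. c * f x) = c * mean A f" for c :: "'b::real_algebra"
  by (simp add: mean_def sum_distrib_left[symmetric])

lemma mean_mult_right: "mean A (\<lambda>x. f x * c) = mean A f * c" for c :: "'b::real_algebra"
  by (simp add: mean_def sum_distrib_right[symmetric])

lemma mean_cnj: "cnj (mean A f) = mean A (\<lambda>x. cnj (f x))"
  by (simp add: mean_def scaleR_conv_of_real)

lemma mean_of_real: "complex_of_real (mean A f) = mean A (\<lambda>x. complex_of_real (f x))"
  by (simp add: mean_def scaleR_conv_of_real)

lemma mean_swap: "mean A (\<lambda>x. mean B (\<lambda>y. f x y)) = mean B (\<lambda>y. mean A (\<lambda>x. f x y))"
proof -
  have "mean A (\<lambda>x. mean B (\<lambda>y. f x y)) = (1 / real (card A) * (1 / real (card B))) *\<^sub>R (\<Sum>x\<in>A. \<Sum>y\<in>B. f x y)"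
    by (simp add: mean_def scaleR_sum_right[symmetric])
  also have "(\<Sum>x\<in>A. \<Sum>y\<in>B. f x y) = (\<Sum>y\<in>B. \<Sum>x\<in>A. f x y)" by (rule sum.swap)
  finally show ?thesis by (simp add: mean_def scaleR_sum_right[symmetric] mult.commute)
qed

lemma mean_mono: "(\<And>x. x \<in> A \<Longrightarrow> f x \<le> g x) \<Longrightarrow> mean A f \<le> mean A g" for f :: "_ \<Rightarrow> real"
  by (simp add: mean_real sum_mono divide_right_mono)

lemma mean_nonneg: "(\<And>x. x \<in> A \<Longrightarrow> 0 \<le> f x) \<Longrightarrow> 0 \<le> mean A f" for f :: "_ \<Rightarrow> real"
  by (simp add: mean_real sum_nonneg)

lemma mean_const: "finite A \<Longrightarrow> A \<noteq> {} \<Longrightarrow> mean A (\<lambda>_. c) = c"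
  by (simp add: mean_def scaleR_sum_left[symmetric] sum_constant_scaleR)

lemma mean_singleton: "mean {x} f = f x"
  by (simp add: mean_def)

text \<open>The sign condition on c is there because \<open>mean\<close> over an empty or infinite
  set is 0.\<close>

lemma mean_le_const: "0 \<le> c \<Longrightarrow> (\<And>x. x \<in> A \<Longrightarrow> f x \<le> c) \<Longrightarrow> mean A f \<le> c" for f :: "_ \<Rightarrow> real"
proof -
  assume c: "0 \<le> c" and f: "\<And>x. x \<in> A \<Longrightarrow> f x \<le> c"
  have "(\<Sum>x\<in>A. f x) \<le> real (card A) * c" using f by (rule sum_bounded_above)
  then show ?thesis using c by (cases "card A = 0") (auto simp: mean_real field_simps)
qed

lemma mean_const_le: "0 \<le> c \<Longrightarrow> mean A (\<lambda>_. c) \<le> c" for c :: real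
  by (rule mean_le_const) auto

lemma norm_mean_le: "norm (mean A f) \<le> mean A (\<lambda>x. norm (f x))" for f :: "_ \<Rightarrow> 'b::real_normed_vector"
  by (simp add: mean_def divide_right_mono norm_sum)

lemma mean_power2_le: "(mean A f)\<^sup>2 \<le> mean A (\<lambda>x. (f x)\<^sup>2)" for f :: "_ \<Rightarrow> real"
proof (cases "card A = 0")
  case False
  have "(\<Sum>x\<in>A. f x)\<^sup>2 \<le> (\<Sum>x\<in>A. 1\<^sup>2) * (\<Sum>x\<in>A. (f x)\<^sup>2)"
    using Cauchy_Schwarz_ineq_sum[of "\<lambda>_. 1" f A] by simp
  then show ?thesis using False by (simp add: mean_real field_simps power2_eq_square)
qed (simp add: mean_real)

lemma norm_mean_power2_le: "(norm (mean A f))\<^sup>2 \<le> mean A (\<lambda>x. (norm (f x))\<^sup>2)" for f :: "_ \<Rightarrow> 'b::real_normed_vector"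
  by (rule order_trans[OF power_mono[OF norm_mean_le]]) (simp_all add: mean_power2_le)

lemma mean_power_pow2_le: "(\<And>x. x \<in> A \<Longrightarrow> 0 \<le> f x) \<Longrightarrow> (mean A f) ^ (2 ^ j) \<le> mean A (\<lambda>x. f x ^ (2 ^ j))" for f :: "_ \<Rightarrow> real"
proof (induction j)
  case (Suc j)
  have "(mean A f) ^ (2 ^ Suc j) = ((mean A f) ^ (2 ^ j))\<^sup>2" by (simp add: power_mult[symmetric] mult.commute)
  also have "\<dots> \<le> (mean A (\<lambda>x. f x ^ (2 ^ j)))\<^sup>2"
    using Suc by (intro power_mono) (auto intro!: zero_le_power mean_nonneg)
  also have "\<dots> \<le> mean A (\<lambda>x. (f x ^ (2 ^ j))\<^sup>2)" by (rule mean_power2_le)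
  finally show ?case by (simp add: power_mult[symmetric] mult.commute)
qed simp

lemma mean_norm_diff: "norm (mean A f - mean A g) \<le> mean A (\<lambda>x. norm (f x - g x))" for f :: "_ \<Rightarrow> 'b::real_normed_vector"
  unfolding mean_diff[symmetric] by (rule norm_mean_le)

lemma norm_power2_mean: "complex_of_real ((cmod (mean A f))\<^sup>2) = mean A (\<lambda>x. mean A (\<lambda>y. f x * cnj (f y)))"
  by (simp add: complex_norm_square mean_cnj mean_mult_left mean_mult_right flip: of_real_power)

lemma norm_power2_add_le: "(norm (a + b))\<^sup>2 \<le> 2 * (norm a)\<^sup>2 + 2 * (norm b)\<^sup>2" for a :: "'b::real_normed_vector"
proof -
  have "(norm (a + b))\<^sup>2 \<le> (norm a + norm b)\<^sup>2" by (intro power_mono norm_triangle_ineq) auto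
  also have "\<dots> \<le> 2 * (norm a)\<^sup>2 + 2 * (norm b)\<^sup>2"
    using zero_le_power2[of "norm a - norm b"] by (simp add: power2_eq_square algebra_simps)
  finally show ?thesis .
qed

section \<open>Periodic functions and inequalities of van der Corput type\<close>

definition periodic :: "nat \<Rightarrow> (int \<Rightarrow> 'b) \<Rightarrow> bool" where
  "periodic Q u \<longleftrightarrow> (\<forall>n. u (n + int Q) = u n)"

text \<open>A fundamental domain. Functions on the group of order Q are periodic functions on the
  integers, so that shifts are plain additions. For Q = 0 the domain is empty and every mean over it
  is 0.\<close>

abbreviation cyc :: "nat \<Rightarrow> int set" where
  "cyc Q \<equiv> {0..<int Q}"

lemma mean_cyc_nat: "mean (cyc Q) f = mean {..<Q} (\<lambda>n. f (int n))"
proof -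
  have "(\<Sum>n\<in>cyc Q. f n) = (\<Sum>n<Q. f (int n))"
    by (rule sum.reindex_bij_witness[of _ int nat]) auto
  then show ?thesis by (simp add: mean_def)
qed

lemma periodic_shift: "periodic Q u \<Longrightarrow> periodic Q (\<lambda>n. u (n + k))"
  unfolding periodic_def by (metis add.assoc add.commute)

lemma mean_cyc_shift:
  fixes u :: "int \<Rightarrow> 'b::real_vector"
  assumes "periodic Q u"
  shows "mean (cyc Q) (\<lambda>n. u (n + k)) = mean (cyc Q) u"
proof -
  have step: "mean (cyc Q) (\<lambda>n. v (n + 1)) = mean (cyc Q) v" if "periodic Q v" for v :: "int \<Rightarrow> 'b"
  proof (cases "Q = 0")
    case False
    have "(\<Sum>n\<in>cyc Q. v (n + 1)) = (\<Sum>n\<in>{1..<int Q + 1}. v n)"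
      by (rule sum.reindex_bij_witness[of _ "\<lambda>n. n - 1" "\<lambda>n. n + 1"]) auto
    also have "{1..<int Q + 1} = insert (int Q) {1..<int Q}" using False by auto
    also have "sum v \<dots> = v (0 + int Q) + sum v {1..<int Q}" by simp
    also have "v (0 + int Q) = v 0" using that unfolding periodic_def by blast
    also have "v 0 + sum v {1..<int Q} = sum v (insert 0 {1..<int Q})" by simp
    also have "insert 0 {1..<int Q} = cyc Q" using False by auto
    finally show ?thesis by (simp add: mean_def)
  qed (simp add: mean_def)
  show ?thesis
  proof (induction k rule: int_induct[of _ 0])
    case (step1 i)
    then show ?case using step[OF periodic_shift[OF assms, of i]] by (simp add: algebra_simps)
  next
    case (step2 i)
    then show ?case using step[OF periodic_shift[OF assms, of "i - 1"]] by (simp add: algebra_simps)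
  qed simp
qed

lemma window_corr:
  fixes u :: "'i \<Rightarrow> int \<Rightarrow> complex"
  shows "complex_of_real (mean J (\<lambda>j. mean (cyc Q) (\<lambda>n. (cmod (mean {..<H} (\<lambda>l. \<theta> l * u j (n + int l))))\<^sup>2)))
   = mean {..<H} (\<lambda>l. mean {..<H} (\<lambda>l'. \<theta> l * cnj (\<theta> l') *
       mean J (\<lambda>j. mean (cyc Q) (\<lambda>n. u j (n + int l) * cnj (u j (n + int l'))))))"
proof -
  have "complex_of_real (mean J (\<lambda>j. mean (cyc Q) (\<lambda>n. (cmod (mean {..<H} (\<lambda>l. \<theta> l * u j (n + int l))))\<^sup>2)))
    = mean J (\<lambda>j. mean (cyc Q) (\<lambda>n. mean {..<H} (\<lambda>l. mean {..<H} (\<lambda>l'.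
        \<theta> l * cnj (\<theta> l') * (u j (n + int l) * cnj (u j (n + int l')))))))"
    unfolding mean_of_real norm_power2_mean by (simp add: mult_ac)
  also have "\<dots> = mean {..<H} (\<lambda>l. mean {..<H} (\<lambda>l'. mean J (\<lambda>j. mean (cyc Q) (\<lambda>n.
        \<theta> l * cnj (\<theta> l') * (u j (n + int l) * cnj (u j (n + int l')))))))"
    by (simp only: mean_swap[of "cyc Q" "{..<H}"] mean_swap[of J "{..<H}"])
  finally show ?thesis by (simp only: mean_mult_left)
qed

text \<open>Van der Corput's inequality for a whole family: the modulus stays outside the average
  over J, so the signed average over a box survives into the next step. The weights \<theta>
  disappear because only moduli of the correlations are kept, and these depend on the distance of l
  and l' alone.\<close>

lemma window_le:
  fixes u :: "'i \<Rightarrow> int \<Rightarrow> complex"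
  assumes per: "\<And>j. periodic Q (u j)" and b: "\<And>j n. cmod (u j n) \<le> 1" and \<theta>: "\<And>l. cmod (\<theta> l) \<le> 1"
    and H: "H \<ge> 1"
  shows "mean J (\<lambda>j. mean (cyc Q) (\<lambda>n. (cmod (mean {..<H} (\<lambda>l. \<theta> l * u j (n + int l))))\<^sup>2))
    \<le> 1 / real H + 2 * mean {1..H} (\<lambda>r. cmod (mean J (\<lambda>j. mean (cyc Q) (\<lambda>n. u j n * cnj (u j (n + int r))))))"
proof -
  define \<Gamma> where "\<Gamma> l l' = mean J (\<lambda>j. mean (cyc Q) (\<lambda>n. u j (n + int l) * cnj (u j (n + int l'))))" for l l'
  define \<gamma> where "\<gamma> r = cmod (\<Gamma> 0 r)" for r
  have perp: "periodic Q (\<lambda>n. u j n * cnj (u j (n + k)))" for j k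
    using per[of j] periodic_shift[OF per, of j k] by (simp add: periodic_def)
  have le: "\<Gamma> l (l + r) = \<Gamma> 0 r" for l r
    unfolding \<Gamma>_def
    by (rule mean_cong[OF refl]) (use mean_cyc_shift[OF perp[of _ "int r"], where k = "int l"] in \<open>simp add: add_ac\<close>)
  have cn: "\<Gamma> l l' = cnj (\<Gamma> l' l)" for l l'
    unfolding \<Gamma>_def by (simp add: mean_cnj mult.commute)
  have \<Gamma>: "cmod (\<Gamma> l l') = \<gamma> ((l - l') + (l' - l))" for l l'
  proof (cases "l \<le> l'")
    case True
    then show ?thesis using le[of l "l' - l"] by (simp add: \<gamma>_def)
  next
    case False
    then show ?thesis using le[of l' "l - l'"] cn[of l l'] by (simp add: \<gamma>_def)
  qed
  have \<gamma>0: "\<gamma> 0 \<le> 1"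
    unfolding \<gamma>_def \<Gamma>_def
    by (intro order_trans[OF norm_mean_le] mean_le_const) (auto simp: norm_mult b mult_le_one)
  define X where "X = mean J (\<lambda>j. mean (cyc Q) (\<lambda>n. (cmod (mean {..<H} (\<lambda>l. \<theta> l * u j (n + int l))))\<^sup>2))"
  have "X \<le> cmod (complex_of_real X)" by simp
  also have "\<dots> = cmod (mean {..<H} (\<lambda>l. mean {..<H} (\<lambda>l'. \<theta> l * cnj (\<theta> l') * \<Gamma> l l')))"
    unfolding X_def window_corr \<Gamma>_def ..
  also have "\<dots> \<le> mean {..<H} (\<lambda>l. mean {..<H} (\<lambda>l'. \<gamma> ((l - l') + (l' - l))))"
  proof (intro order_trans[OF norm_mean_le] mean_mono)
    fix l l'
    have "cmod (\<theta> l * cnj (\<theta> l')) \<le> 1" using \<theta> by (simp add: norm_mult mult_le_one)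
    then have "cmod (\<theta> l * cnj (\<theta> l')) * cmod (\<Gamma> l l') \<le> 1 * cmod (\<Gamma> l l')" by (intro mult_right_mono) auto
    then show "cmod (\<theta> l * cnj (\<theta> l') * \<Gamma> l l') \<le> \<gamma> ((l - l') + (l' - l))" by (simp add: norm_mult \<Gamma>)
  qed
  also have "\<dots> = (\<Sum>l<H. \<Sum>l'<H. \<gamma> ((l - l') + (l' - l))) / (real H)\<^sup>2"
    by (simp add: mean_real power2_eq_square sum_divide_distrib[symmetric])
  also have "\<dots> \<le> (real H * \<gamma> 0 + 2 * real H * (\<Sum>r=1..H. \<gamma> r)) / (real H)\<^sup>2"
    by (intro divide_right_mono sum_dist_le) (auto simp: \<gamma>_def)
  also have "\<dots> = \<gamma> 0 / real H + 2 * mean {1..H} \<gamma>"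
    using H by (simp add: mean_real power2_eq_square field_simps)
  also have "\<dots> \<le> 1 / real H + 2 * mean {1..H} \<gamma>" using \<gamma>0 by (simp add: divide_right_mono)
  finally show ?thesis by (simp add: X_def \<gamma>_def[abs_def] \<Gamma>_def)
qed

lemma mean_window_diff:
  fixes w :: "nat \<Rightarrow> 'b::real_normed_vector"
  assumes b: "\<And>i. norm (w i) \<le> 1" and H: "H \<ge> 1"
  shows "norm (mean {..<H} (\<lambda>l. mean {..<M} (\<lambda>i. w (i + l))) - mean {..<M} w) \<le> 2 * real H / real M"
proof (cases "M = 0")
  case False
  have "mean {..<H} (\<lambda>l. mean {..<M} (\<lambda>i. w (i + l))) - mean {..<M} w
      = mean {..<H} (\<lambda>l. mean {..<M} (\<lambda>i. w (i + l)) - mean {..<M} w)"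
    using H by (simp add: mean_diff mean_const lessThan_empty_iff)
  also have "norm \<dots> \<le> 2 * real H / real M"
  proof (intro order_trans[OF norm_mean_le] mean_le_const)
    fix l assume "l \<in> {..<H}"
    have "norm (mean {..<M} (\<lambda>i. w (i + l)) - mean {..<M} w) = norm ((\<Sum>i<M. w (i + l)) - (\<Sum>i<M. w i)) / real M"
      by (simp add: mean_def scaleR_right_diff_distrib[symmetric])
    also have "\<dots> \<le> 2 * real l * 1 / real M" by (intro divide_right_mono shift_sum_diff b) auto
    also have "\<dots> \<le> 2 * real H / real M" using \<open>l \<in> {..<H}\<close> by (intro divide_right_mono) auto
    finally show "norm (mean {..<M} (\<lambda>i. w (i + l)) - mean {..<M} w) \<le> 2 * real H / real M" .
  qed auto
  finally show ?thesis .
qed (auto simp: mean_def)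

text \<open>A window of length M is within 2 H / M of the average of the short windows that start
  inside it. Squaring a sum of two terms costs a factor 2, whence 2 and 8, and translation
  invariance removes the starting point.\<close>

lemma short_window:
  fixes u :: "int \<Rightarrow> complex"
  assumes per: "periodic Q u" and b: "\<And>n. cmod (u n) \<le> 1" and H: "H \<ge> 1"
  shows "mean (cyc Q) (\<lambda>n. (cmod (mean {..<M} (\<lambda>i. u (n + int i))))\<^sup>2)
    \<le> 2 * mean (cyc Q) (\<lambda>n. (cmod (mean {..<H} (\<lambda>l. u (n + int l))))\<^sup>2) + 8 * (real H / real M)\<^sup>2"
proof -
  define W where "W n = (cmod (mean {..<H} (\<lambda>l. u (n + int l))))\<^sup>2" for n
  have W: "periodic Q W"
    unfolding periodic_def W_def
  proof
    fix n
    have "u (n + int Q + int l) = u (n + int l)" for l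
      using periodic_shift[OF per, of "int l"] by (simp add: periodic_def)
    then show "(cmod (mean {..<H} (\<lambda>l. u (n + int Q + int l))))\<^sup>2 = (cmod (mean {..<H} (\<lambda>l. u (n + int l))))\<^sup>2"
      by simp
  qed
  have "(cmod (mean {..<M} (\<lambda>i. u (n + int i))))\<^sup>2 \<le> 2 * mean {..<M} (\<lambda>i. W (n + int i)) + 8 * (real H / real M)\<^sup>2" for n
  proof -
    define w where "w i = u (n + int i)" for i
    define D where "D = mean {..<M} w - mean {..<H} (\<lambda>l. mean {..<M} (\<lambda>i. w (i + l)))"
    have D: "cmod D \<le> 2 * real H / real M"
      unfolding D_def norm_minus_commute[of "mean {..<M} w"] by (rule mean_window_diff) (use H in \<open>simp_all add: w_def b\<close>)
    have "(cmod (mean {..<M} w))\<^sup>2 \<le> 2 * (cmod (mean {..<H} (\<lambda>l. mean {..<M} (\<lambda>i. w (i + l)))))\<^sup>2 + 2 * (cmod D)\<^sup>2"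
      using norm_power2_add_le[of "mean {..<H} (\<lambda>l. mean {..<M} (\<lambda>i. w (i + l)))" D] by (simp add: D_def)
    moreover have "(cmod D)\<^sup>2 \<le> (2 * real H / real M)\<^sup>2" by (rule power_mono[OF D]) simp
    moreover have "(cmod (mean {..<H} (\<lambda>l. mean {..<M} (\<lambda>i. w (i + l)))))\<^sup>2 \<le> mean {..<M} (\<lambda>i. W (n + int i))"
      unfolding mean_swap[of "{..<H}"] W_def w_def by (rule order_trans[OF norm_mean_power2_le]) (simp add: add_ac)
    ultimately show ?thesis by (simp add: w_def[abs_def] power_divide power_mult_distrib)
  qed
  then have "mean (cyc Q) (\<lambda>n. (cmod (mean {..<M} (\<lambda>i. u (n + int i))))\<^sup>2)
     \<le> mean (cyc Q) (\<lambda>n. 2 * mean {..<M} (\<lambda>i. W (n + int i)) + 8 * (real H / real M)\<^sup>2)"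
    by (intro mean_mono)
  also have "\<dots> = 2 * mean {..<M} (\<lambda>i. mean (cyc Q) (\<lambda>n. W (n + int i))) + mean (cyc Q) (\<lambda>n. 8 * (real H / real M)\<^sup>2)"
    by (simp only: mean_add mean_mult_left mean_swap[of "cyc Q"])
  also have "\<dots> = 2 * mean {..<M} (\<lambda>i. mean (cyc Q) W) + mean (cyc Q) (\<lambda>n. 8 * (real H / real M)\<^sup>2)"
    by (simp add: mean_cyc_shift[OF W])
  also have "\<dots> \<le> 2 * mean (cyc Q) W + 8 * (real H / real M)\<^sup>2"
    by (intro add_mono mult_left_mono mean_const_le) (auto intro!: mean_nonneg simp: W_def)
  finally show ?thesis unfolding W_def[abs_def] .
qed

abbreviation phase :: "real \<Rightarrow> int \<Rightarrow> complex" where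
  "phase t n \<equiv> exp (2 * of_real pi * \<i> * of_int n * of_real t)"

text \<open>For general t the phase does not have period Q, so translating by l < H is done on an
  interval, at the cost of a boundary term 2 H / Q. Multiplicativity of the phase then moves it into
  the weights of \<open>window_le\<close>, which makes the bound independent of t.\<close>

lemma phase_window:
  fixes b :: "int \<Rightarrow> complex" and t :: real
  assumes per: "periodic Q b" and bd: "\<And>n. cmod (b n) \<le> 1" and H: "H \<ge> 1"
  defines "\<phi> \<equiv> \<lambda>n. exp (2 * of_real pi * \<i> * of_int n * of_real t)"
  shows "(cmod (mean (cyc Q) (\<lambda>n. \<phi> n * b n)))\<^sup>2
    \<le> 2 / real H + 4 * mean {1..H} (\<lambda>r. cmod (mean (cyc Q) (\<lambda>n. b n * cnj (b (n + int r))))) + 8 * (real H / real Q)\<^sup>2"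
proof -
  have n\<phi>: "cmod (\<phi> n) = 1" for n by (simp add: \<phi>_def)
  have \<phi>_add: "\<phi> (n + m) = \<phi> n * \<phi> m" for n m by (simp add: \<phi>_def exp_add[symmetric] algebra_simps)
  define w where "w n = \<phi> (int n) * b (int n)" for n
  define D where "D = mean {..<Q} w - mean {..<H} (\<lambda>l. mean {..<Q} (\<lambda>n. w (n + l)))"
  have D: "cmod D \<le> 2 * real H / real Q"
    unfolding D_def norm_minus_commute[of "mean {..<Q} w"]
    by (rule mean_window_diff) (use H in \<open>simp_all add: w_def norm_mult n\<phi> bd\<close>)
  have "(cmod (mean {..<Q} w))\<^sup>2 \<le> 2 * (cmod (mean {..<H} (\<lambda>l. mean {..<Q} (\<lambda>n. w (n + l)))))\<^sup>2 + 2 * (cmod D)\<^sup>2"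
    using norm_power2_add_le[of "mean {..<H} (\<lambda>l. mean {..<Q} (\<lambda>n. w (n + l)))" D] by (simp add: D_def)
  moreover have "(cmod D)\<^sup>2 \<le> (2 * real H / real Q)\<^sup>2" by (rule power_mono[OF D]) simp
  moreover have "mean {..<H} (\<lambda>l. mean {..<Q} (\<lambda>n. w (n + l)))
      = mean (cyc Q) (\<lambda>n. \<phi> n * mean {..<H} (\<lambda>l. \<phi> (int l) * b (n + int l)))"
    unfolding mean_cyc_nat mean_swap[of "{..<H}"] mean_mult_left[symmetric] w_def by (simp add: \<phi>_add mult_ac)
  moreover have "(cmod (mean (cyc Q) (\<lambda>n. \<phi> n * mean {..<H} (\<lambda>l. \<phi> (int l) * b (n + int l)))))\<^sup>2
      \<le> mean (cyc Q) (\<lambda>n. (cmod (mean {..<H} (\<lambda>l. \<phi> (int l) * b (n + int l))))\<^sup>2)"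
    by (rule order_trans[OF norm_mean_power2_le]) (simp add: norm_mult n\<phi>)
  moreover have "\<dots> \<le> 1 / real H + 2 * mean {1..H} (\<lambda>r. cmod (mean (cyc Q) (\<lambda>n. b n * cnj (b (n + int r)))))"
    using window_le[of Q "\<lambda>_::unit. b" "\<lambda>l. \<phi> (int l)" H "{()}"] assms n\<phi> by (simp add: mean_singleton)
  moreover have "mean {..<Q} w = mean (cyc Q) (\<lambda>n. \<phi> n * b n)" by (simp add: mean_cyc_nat w_def[abs_def])
  ultimately show ?thesis by (simp add: power_divide power_mult_distrib)
qed

section \<open>Recursion over boxes and cubes\<close>

lemma sum_hbox_Suc: "(\<Sum>h\<in>hbox (Suc d) N. F h) = (\<Sum>r=1..N. \<Sum>h\<in>hbox d N. F (h(Suc d := r)))"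
proof -
  have eq: "{1..Suc d} = insert (Suc d) {1..d}" by auto
  have "hbox (Suc d) N = (\<lambda>(y, g). g(Suc d := y)) ` ({1..N} \<times> hbox d N)"
    unfolding hbox_def eq PiE_insert_eq ..
  moreover have "inj_on (\<lambda>(y, g). g(Suc d := y)) ({1..N} \<times> hbox d N)"
    unfolding hbox_def by (rule inj_combinator) simp
  ultimately have "(\<Sum>h\<in>hbox (Suc d) N. F h) = (\<Sum>(r, h)\<in>{1..N} \<times> hbox d N. F (h(Suc d := r)))"
    by (simp add: sum.reindex comp_def case_prod_unfold)
  then show ?thesis by (simp add: sum.cartesian_product)
qed

lemma prod_cube_Suc: "(\<Prod>\<eta>\<in>cube (Suc d). F \<eta>) = (\<Prod>\<eta>\<in>cube d. F (\<eta>(Suc d := 0))) * (\<Prod>\<eta>\<in>cube d. F (\<eta>(Suc d := 1)))"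
  for F :: "_ \<Rightarrow> 'b::comm_monoid_mult"
proof -
  have eq: "{1..Suc d} = insert (Suc d) {1..d}" by auto
  have "cube (Suc d) = (\<lambda>(y, g). g(Suc d := y)) ` ({0, 1} \<times> cube d)"
    unfolding cube_def eq PiE_insert_eq ..
  moreover have "inj_on (\<lambda>(y, g). g(Suc d := y)) ({0, 1} \<times> cube d)"
    unfolding cube_def by (rule inj_combinator) simp
  ultimately have "(\<Prod>\<eta>\<in>cube (Suc d). F \<eta>) = (\<Prod>(r, h)\<in>{0, 1} \<times> cube d. F (h(Suc d := r)))"
    by (simp add: prod.reindex comp_def case_prod_unfold)
  also have "\<dots> = (\<Prod>r\<in>{0, 1}. \<Prod>h\<in>cube d. F (h(Suc d := r)))"
    by (simp add: prod.cartesian_product)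
  finally show ?thesis by simp
qed

lemma cube_0: "cube 0 = {\<lambda>_. undefined}" and hbox_0: "hbox 0 N = {\<lambda>_. undefined}"
  by (simp_all add: cube_def hbox_def)

lemma cube_SucE:
  assumes "\<eta> \<in> cube (Suc d)"
  obtains \<eta>' e where "\<eta>' \<in> cube d" "e \<in> {0, 1::nat}" "\<eta> = \<eta>'(Suc d := e)"
proof -
  have eq: "{1..Suc d} = insert (Suc d) {1..d}" by auto
  have "\<eta> \<in> (\<lambda>(y, g). g(Suc d := y)) ` ({0, 1} \<times> cube d)"
    using assms unfolding cube_def eq PiE_insert_eq .
  then show ?thesis using that by auto
qed

lemma finite_cube: "finite (cube d)" and finite_hbox: "finite (hbox d N)"
  by (simp_all add: cube_def hbox_def finite_PiE)

lemma card_hbox: "card (hbox d N) = N ^ d"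
  by (simp add: hbox_def card_PiE)

lemma card_cube: "card (cube d) = 2 ^ d"
  by (simp add: cube_def card_PiE numeral_2_eq_2)

lemma mean_hbox_Suc: "mean (hbox (Suc d) N) F = mean (hbox d N) (\<lambda>h. mean {1..N} (\<lambda>r. F (h(Suc d := r))))"
  by (subst mean_swap) (simp add: mean_def card_hbox sum_hbox_Suc scaleR_sum_right)

lemma cnj_pow_mult: "(cnj ^^ m) (a * b) = (cnj ^^ m) a * (cnj ^^ m) b"
  by (induction m) auto

lemma cnj_pow_cnj: "(cnj ^^ m) (cnj a) = cnj ((cnj ^^ m) a)"
  by (induction m) auto

lemma norm_cnj_pow: "cmod ((cnj ^^ m) a) = cmod a"
  by (induction m) auto

text \<open>Splits the cube along its last coordinate: on the face with value 1 every exponent gains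
  r and every factor one more conjugation.\<close>

lemma cube_prod_Suc:
  "cube_prod T (Suc d) g (h(Suc d := r)) x = cube_prod T d (\<lambda>\<eta>. g (\<eta>(Suc d := 0))) h x *
     cnj (cube_prod T d (\<lambda>\<eta>. g (\<eta>(Suc d := 1))) h ((T ^^ r) x))"
proof -
  have s: "(\<Sum>j = 1..d. if j = Suc d then a j else b j) = (\<Sum>j = 1..d. b j)" for a b :: "nat \<Rightarrow> nat"
    by (intro sum.cong) auto
  have 1: "(\<Sum>j=1..Suc d. (\<eta>(Suc d := e)) j) = (\<Sum>j=1..d. \<eta> j) + e" for \<eta> and e :: nat
    by (simp add: s fun_upd_def)
  have 2: "(\<Sum>j=1..Suc d. (h(Suc d := r)) j * (\<eta>(Suc d := e)) j) = (\<Sum>j=1..d. h j * \<eta> j) + r * e" for \<eta> and e :: nat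
  proof -
    have "(\<Sum>j=1..d. (h(Suc d := r)) j * (\<eta>(Suc d := e)) j) = (\<Sum>j=1..d. h j * \<eta> j)"
      by (intro sum.cong) auto
    then show ?thesis by simp
  qed
  show ?thesis
    unfolding cube_prod_def prod_cube_Suc 1 2
    by (simp add: funpow_add)
qed

lemma cube_prod_mult_cnj:
  "cube_prod T d (\<lambda>\<eta> x. a \<eta> x * cnj (b \<eta> x)) h x = cube_prod T d a h x * cnj (cube_prod T d b h x)"
  by (simp add: cube_prod_def cnj_pow_mult cnj_pow_cnj prod.distrib)

lemma norm_cube_prod_le:
  assumes "\<And>\<eta> n. \<eta> \<in> cube d \<Longrightarrow> cmod (g \<eta> ((T ^^ n) x)) \<le> 1"
  shows "cmod (cube_prod T d g h x) \<le> 1"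
  unfolding cube_prod_def prod_norm[symmetric] norm_cnj_pow
  by (rule prod_le_1) (use assms in auto)

text \<open>The cube product for the successor map on the integers, so that the algebra of
  \<open>cube_prod\<close> serves both the system and its cyclic model.\<close>

abbreviation zprod :: "nat \<Rightarrow> ((nat \<Rightarrow> nat) \<Rightarrow> int \<Rightarrow> complex) \<Rightarrow> (nat \<Rightarrow> nat) \<Rightarrow> int \<Rightarrow> complex" where
  "zprod \<equiv> cube_prod (\<lambda>n. n + 1)"

lemma succ_pow: "((\<lambda>n::int. n + 1) ^^ k) n = n + int k"
  by (induction k) auto

lemma zprod_shift: "zprod d A h (n + k) = zprod d (\<lambda>\<eta> n. A \<eta> (n + k)) h n"
  by (simp add: cube_prod_def succ_pow add_ac)

lemma zprod_periodic: "(\<And>\<eta>. periodic Q (A \<eta>)) \<Longrightarrow> periodic Q (zprod d A h)"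
  by (simp add: periodic_def zprod_shift)

section \<open>Cauchy--Schwarz over the faces of the cube\<close>

definition cube_mean :: "nat \<Rightarrow> nat \<Rightarrow> nat \<Rightarrow> ((nat \<Rightarrow> nat) \<Rightarrow> int \<Rightarrow> complex) \<Rightarrow> complex" where
  "cube_mean Q M d A = mean (hbox d M) (\<lambda>h. mean (cyc Q) (zprod d A h))"

definition zdelta :: "nat \<Rightarrow> (int \<Rightarrow> complex) \<Rightarrow> int \<Rightarrow> complex" where
  "zdelta r u n = u n * cnj (u (n + int r))"

lemma zprod_zdelta: "zprod d A h n * cnj (zprod d A h (n + int r)) = zprod d (\<lambda>\<eta>. zdelta r (A \<eta>)) h n"
  unfolding zprod_shift zdelta_def cube_prod_mult_cnj ..

lemma periodic_zdelta: "periodic Q u \<Longrightarrow> periodic Q (zdelta r u)"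
  using periodic_shift[of Q u "int r"] by (simp add: periodic_def zdelta_def)

lemma norm_zdelta_le: "(\<And>n. cmod (u n) \<le> 1) \<Longrightarrow> cmod (zdelta r u n) \<le> 1"
  by (simp add: zdelta_def norm_mult mult_le_one)

text \<open>Cauchy--Schwarz removes the half of the cube that does not contain the chosen face
  \<open>\<eta> (Suc d) = e\<close>.\<close>

lemma cube_mean_Suc_window:
  assumes per: "\<And>\<eta>. periodic Q (A \<eta>)" and b: "\<And>\<eta> n. cmod (A \<eta> n) \<le> 1"
    and e: "e \<in> {0, 1}" and H: "H \<ge> 1"
  shows "(cmod (cube_mean Q M (Suc d) A))\<^sup>2 \<le>
    2 * mean (hbox d M) (\<lambda>h. mean (cyc Q) (\<lambda>n. (cmod (mean {..<H} (\<lambda>l. zprod d (\<lambda>\<eta>. A (\<eta>(Suc d := e))) h (n + int l))))\<^sup>2))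
     + 8 * (real H / real M)\<^sup>2"
proof -
  define B where "B e = zprod d (\<lambda>\<eta>. A (\<eta>(Suc d := e)))" for e
  have Bp: "periodic Q (B e h)" for e h unfolding B_def using per by (rule zprod_periodic)
  have Bb: "cmod (B e h n) \<le> 1" for e h n unfolding B_def by (rule norm_cube_prod_le) (rule b)
  have R: "cube_mean Q M (Suc d) A = mean (hbox d M) (\<lambda>h. mean {1..M} (\<lambda>r. mean (cyc Q) (\<lambda>n. B 0 h n * cnj (B 1 h (n + int r)))))"
    unfolding cube_mean_def mean_hbox_Suc cube_prod_Suc succ_pow B_def ..
  have box: "mean {1..M} f = mean {..<M} (\<lambda>i. f (Suc i))" for f :: "nat \<Rightarrow> complex"
    unfolding mean_def by (simp add: sum.atLeast1_atMost_eq)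
  have box': "mean {1..M} f = mean {..<M} (\<lambda>i. f (M - i))" for f :: "nat \<Rightarrow> complex"
  proof -
    have "(\<Sum>r=1..M. f r) = (\<Sum>i<M. f (M - i))"
      by (rule sum.reindex_bij_witness[of _ "\<lambda>i. M - i" "\<lambda>i. M - i"]) auto
    then show ?thesis by (simp add: mean_def)
  qed
  have "(cmod (cube_mean Q M (Suc d) A))\<^sup>2 \<le> mean (hbox d M) (\<lambda>h. mean (cyc Q) (\<lambda>n. (cmod (mean {..<M} (\<lambda>i. B e h (n + int i))))\<^sup>2))"
  proof (cases "e = 1")
    case True
    \<comment> \<open>The factor on the face 0 does not contain r; it leaves the average over r and
      is then bounded by 1.\<close>
    have "cube_mean Q M (Suc d) A = mean (hbox d M) (\<lambda>h. mean (cyc Q) (\<lambda>n. B 0 h n * mean {1..M} (\<lambda>r. cnj (B 1 h (n + int r)))))"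
      unfolding R mean_swap[of "{1..M}"] mean_mult_left ..
    also have "(cmod \<dots>)\<^sup>2 \<le> mean (hbox d M) (\<lambda>h. mean (cyc Q) (\<lambda>n. (cmod (B 0 h n * mean {1..M} (\<lambda>r. cnj (B 1 h (n + int r)))))\<^sup>2))"
      by (rule order_trans[OF norm_mean_power2_le], rule mean_mono, rule norm_mean_power2_le)
    also have "\<dots> \<le> mean (hbox d M) (\<lambda>h. mean (cyc Q) (\<lambda>n. (cmod (mean {1..M} (\<lambda>r. B 1 h (n + int r))))\<^sup>2))"
    proof (intro mean_mono power_mono)
      fix h n
      have "cmod (B 0 h n) * cmod (mean {1..M} (\<lambda>r. B 1 h (n + int r))) \<le> 1 * cmod (mean {1..M} (\<lambda>r. B 1 h (n + int r)))"
        by (intro mult_right_mono Bb) auto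
      then show "cmod (B 0 h n * mean {1..M} (\<lambda>r. cnj (B 1 h (n + int r)))) \<le> cmod (mean {1..M} (\<lambda>r. B 1 h (n + int r)))"
        unfolding norm_mult mean_cnj[symmetric] complex_mod_cnj by simp
    qed auto
    also have "\<dots> = mean (hbox d M) (\<lambda>h. mean (cyc Q) (\<lambda>n. (cmod (mean {..<M} (\<lambda>i. B 1 h (n + int i))))\<^sup>2))"
    proof (rule mean_cong[OF refl])
      fix h
      have "periodic Q (\<lambda>n. (cmod (mean {..<M} (\<lambda>i. B 1 h (n + int i))))\<^sup>2)"
        using Bp[of 1 h, THEN periodic_shift] by (simp add: periodic_def)
      from mean_cyc_shift[OF this, of 1]
      show "mean (cyc Q) (\<lambda>n. (cmod (mean {1..M} (\<lambda>r. B 1 h (n + int r))))\<^sup>2)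
         = mean (cyc Q) (\<lambda>n. (cmod (mean {..<M} (\<lambda>i. B 1 h (n + int i))))\<^sup>2)"
        unfolding box by (simp add: add_ac)
    qed
    finally show ?thesis using True by simp
  next
    case False
    then have e0: "e = 0" using e by simp
    \<comment> \<open>Substituting n - r for n moves r into the face 0. The window then runs
      backwards, and \<open>box'\<close> turns it round.\<close>
    have sh: "mean (cyc Q) (\<lambda>n. B 0 h n * cnj (B 1 h (n + int r))) = mean (cyc Q) (\<lambda>n. cnj (B 1 h n) * B 0 h (n - int r))" for h r
    proof -
      have "periodic Q (\<lambda>n. cnj (B 1 h n) * B 0 h (n - int r))"
        using Bp[of 1 h] Bp[of 0 h, THEN periodic_shift, of "- int r"] by (simp add: periodic_def)
      from mean_cyc_shift[OF this, of "int r"] show ?thesis by (simp add: mult.commute)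
    qed
    have "cube_mean Q M (Suc d) A = mean (hbox d M) (\<lambda>h. mean (cyc Q) (\<lambda>n. cnj (B 1 h n) * mean {1..M} (\<lambda>r. B 0 h (n - int r))))"
      unfolding R sh mean_swap[of "{1..M}"] mean_mult_left ..
    also have "(cmod \<dots>)\<^sup>2 \<le> mean (hbox d M) (\<lambda>h. mean (cyc Q) (\<lambda>n. (cmod (cnj (B 1 h n) * mean {1..M} (\<lambda>r. B 0 h (n - int r))))\<^sup>2))"
      by (rule order_trans[OF norm_mean_power2_le], rule mean_mono, rule norm_mean_power2_le)
    also have "\<dots> \<le> mean (hbox d M) (\<lambda>h. mean (cyc Q) (\<lambda>n. (cmod (mean {1..M} (\<lambda>r. B 0 h (n - int r))))\<^sup>2))"
    proof (intro mean_mono power_mono)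
      fix h n
      have "cmod (B 1 h n) * cmod (mean {1..M} (\<lambda>r. B 0 h (n - int r))) \<le> 1 * cmod (mean {1..M} (\<lambda>r. B 0 h (n - int r)))"
        by (intro mult_right_mono Bb) auto
      then show "cmod (cnj (B 1 h n) * mean {1..M} (\<lambda>r. B 0 h (n - int r))) \<le> cmod (mean {1..M} (\<lambda>r. B 0 h (n - int r)))"
        unfolding norm_mult complex_mod_cnj by simp
    qed auto
    also have "\<dots> = mean (hbox d M) (\<lambda>h. mean (cyc Q) (\<lambda>n. (cmod (mean {..<M} (\<lambda>i. B 0 h (n + int i))))\<^sup>2))"
    proof (rule mean_cong[OF refl])
      fix h
      have per0: "periodic Q (\<lambda>n. (cmod (mean {..<M} (\<lambda>i. B 0 h (n + int i))))\<^sup>2)"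
        using Bp[of 0 h, THEN periodic_shift] by (simp add: periodic_def)
      have "mean {1..M} (\<lambda>r. B 0 h (n - int r)) = mean {..<M} (\<lambda>i. B 0 h (n + - int M + int i))" for n
        unfolding box' by (intro mean_cong) (auto simp: of_nat_diff algebra_simps)
      then show "mean (cyc Q) (\<lambda>n. (cmod (mean {1..M} (\<lambda>r. B 0 h (n - int r))))\<^sup>2)
         = mean (cyc Q) (\<lambda>n. (cmod (mean {..<M} (\<lambda>i. B 0 h (n + int i))))\<^sup>2)"
        using mean_cyc_shift[OF per0, of "- int M"] by simp
    qed
    finally show ?thesis using e0 by simp
  qed
  also have "\<dots> \<le> mean (hbox d M) (\<lambda>h. 2 * mean (cyc Q) (\<lambda>n. (cmod (mean {..<H} (\<lambda>l. B e h (n + int l))))\<^sup>2) + 8 * (real H / real M)\<^sup>2)"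
    by (intro mean_mono short_window Bp Bb H)
  also have "\<dots> \<le> 2 * mean (hbox d M) (\<lambda>h. mean (cyc Q) (\<lambda>n. (cmod (mean {..<H} (\<lambda>l. B e h (n + int l))))\<^sup>2)) + 8 * (real H / real M)\<^sup>2"
    unfolding mean_add mean_mult_left[where c = 2] by (intro add_mono mean_const_le order_refl) auto
  finally show ?thesis by (simp add: B_def)
qed

text \<open>Van der Corput with the box of dimension d as the family. The correlations are again of
  the form \<open>cube_mean\<close>, one dimension lower and with differenced functions, so the
  estimate can be iterated.\<close>

lemma cube_mean_Suc_le:
  assumes per: "\<And>\<eta>. periodic Q (A \<eta>)" and b: "\<And>\<eta> n. cmod (A \<eta> n) \<le> 1"
    and e: "e \<in> {0, 1}" and H: "H \<ge> 1"
  shows "(cmod (cube_mean Q M (Suc d) A))\<^sup>2 \<le>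
    2 / real H + 4 * mean {1..H} (\<lambda>r. cmod (cube_mean Q M d (\<lambda>\<eta>. zdelta r (A (\<eta>(Suc d := e))))))
     + 8 * (real H / real M)\<^sup>2"
proof -
  let ?B = "zprod d (\<lambda>\<eta>. A (\<eta>(Suc d := e)))"
  have "mean (hbox d M) (\<lambda>h. mean (cyc Q) (\<lambda>n. (cmod (mean {..<H} (\<lambda>l. 1 * ?B h (n + int l))))\<^sup>2))
    \<le> 1 / real H + 2 * mean {1..H} (\<lambda>r. cmod (mean (hbox d M) (\<lambda>h. mean (cyc Q) (\<lambda>n. ?B h n * cnj (?B h (n + int r))))))"
    using H by (intro window_le zprod_periodic per norm_cube_prod_le b) auto
  then show ?thesis
    using cube_mean_Suc_window[where A = A and Q = Q, OF per b e H, where M = M and d = d]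
    unfolding zprod_zdelta cube_mean_def by simp
qed

text \<open>The power mean inequality replaces the moduli by their squares, and expanding the
  squares yields signed correlations averaged over the box: the modulus moves from inside the box
  average to outside.\<close>

lemma mean_cmod_zprod_le:
  assumes per: "\<And>\<eta>. periodic Q (A \<eta>)" and b: "\<And>\<eta> n. cmod (A \<eta> n) \<le> 1" and H: "H \<ge> 1"
  shows "(mean (hbox d M) (\<lambda>h. cmod (mean (cyc Q) (zprod d A h))))\<^sup>2 \<le>
    1 / real H + 2 * mean {1..H} (\<lambda>r. cmod (cube_mean Q M d (\<lambda>\<eta>. zdelta r (A \<eta>))))"
proof -
  let ?B = "zprod d A"
  have "(mean (hbox d M) (\<lambda>h. cmod (mean (cyc Q) (?B h))))\<^sup>2 \<le> mean (hbox d M) (\<lambda>h. (cmod (mean (cyc Q) (?B h)))\<^sup>2)"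
    by (rule mean_power2_le)
  \<comment> \<open>The window is inserted by exact cyclic invariance, hence no boundary term in
    this bound.\<close>
  also have "\<dots> = mean (hbox d M) (\<lambda>h. (cmod (mean (cyc Q) (\<lambda>n. mean {..<H} (\<lambda>l. ?B h (n + int l)))))\<^sup>2)"
  proof -
    have "mean (cyc Q) (\<lambda>n. mean {..<H} (\<lambda>l. ?B h (n + int l))) = mean (cyc Q) (?B h)" for h
      unfolding mean_swap[of "cyc Q"] mean_cyc_shift[OF zprod_periodic[OF per]]
      using H by (intro mean_const) (auto simp: lessThan_empty_iff)
    then show ?thesis by simp
  qed
  also have "\<dots> \<le> mean (hbox d M) (\<lambda>h. mean (cyc Q) (\<lambda>n. (cmod (mean {..<H} (\<lambda>l. 1 * ?B h (n + int l))))\<^sup>2))"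
    by (rule mean_mono, rule order_trans[OF norm_mean_power2_le]) simp
  also have "\<dots> \<le> 1 / real H + 2 * mean {1..H} (\<lambda>r. cmod (mean (hbox d M) (\<lambda>h. mean (cyc Q) (\<lambda>n. ?B h n * cnj (?B h (n + int r))))))"
    using H by (intro window_le zprod_periodic per norm_cube_prod_le b) auto
  finally show ?thesis unfolding zprod_zdelta cube_mean_def by simp
qed

text \<open>\<open>S h\<close> stands for a squared supremum over t, and e for the loss in choosing
  a near-maximizer t, which may depend on h. As \<open>phase_window\<close> is uniform in t, that
  dependence is harmless.\<close>

lemma mean_phase_le:
  assumes per: "\<And>\<eta>. periodic Q (A \<eta>)" and b: "\<And>\<eta> n. cmod (A \<eta> n) \<le> 1" and H: "H \<ge> 1"
    and t: "\<And>h. h \<in> hbox d M \<Longrightarrow> \<exists>t::real. S h \<le> (cmod (mean (cyc Q) (\<lambda>n. phase t n * zprod d A h n)))\<^sup>2 + e"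
    and e: "e \<ge> 0"
  shows "mean (hbox d M) S \<le> 2 / real H
    + 4 * mean {1..H} (\<lambda>r. mean (hbox d M) (\<lambda>h. cmod (mean (cyc Q) (zprod d (\<lambda>\<eta>. zdelta r (A \<eta>)) h)))) + 8 * (real H / real Q)\<^sup>2 + e"
proof -
  let ?G = "\<lambda>h. mean {1..H} (\<lambda>r. cmod (mean (cyc Q) (zprod d (\<lambda>\<eta>. zdelta r (A \<eta>)) h)))"
  have "S h \<le> 2 / real H + 4 * ?G h + 8 * (real H / real Q)\<^sup>2 + e" if "h \<in> hbox d M" for h
  proof -
    obtain t :: real where t: "S h \<le> (cmod (mean (cyc Q) (\<lambda>n. phase t n * zprod d A h n)))\<^sup>2 + e"
      using t[OF \<open>h \<in> hbox d M\<close>] by blast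
    have "cmod (zprod d A h n) \<le> 1" for n by (rule norm_cube_prod_le) (rule b)
    then show ?thesis
      using t phase_window[where b = "zprod d A h" and Q = Q, OF zprod_periodic[OF per] _ H, where t = t] unfolding zprod_zdelta by simp
  qed
  then have "mean (hbox d M) S \<le> mean (hbox d M) (\<lambda>h. 4 * ?G h + (2 / real H + 8 * (real H / real Q)\<^sup>2 + e))"
    by (intro mean_mono) (simp add: add_ac)
  also have "\<dots> \<le> 4 * mean (hbox d M) ?G + (2 / real H + 8 * (real H / real Q)\<^sup>2 + e)"
    unfolding mean_add mean_mult_left[where c = 4] using e by (intro add_mono mean_const_le order_refl) auto
  finally show ?thesis unfolding mean_swap[of "hbox d M"] by simp
qed

section \<open>Birkhoff's ergodic theorem\<close>

locale ergodic_system =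
  fixes M :: "'a measure" and T :: "'a \<Rightarrow> 'a"
  assumes sys: "invertible_ergodic_system M T"
begin

sublocale prob_space M
  using sys by (simp add: invertible_ergodic_system_def)

lemma T_measurable [measurable]: "T \<in> measurable M M"
  using sys by (simp add: invertible_ergodic_system_def)

lemma distr_T: "distr M M T = M"
  using sys by (simp add: invertible_ergodic_system_def)

lemma invariant_measure: "A \<in> sets M \<Longrightarrow> T -` A \<inter> space M = A \<Longrightarrow> measure M A = 0 \<or> measure M A = 1"
  using sys by (simp add: invertible_ergodic_system_def)

lemma iter_measurable [measurable]: "T ^^ n \<in> measurable M M"
  by (induction n) auto

lemma distr_iter: "distr M M (T ^^ n) = M"
proof (induction n)
  case 0 then show ?case by (simp add: id_def distr_id)
next
  case (Suc n)
  have "distr M M (T ^^ Suc n) = distr (distr M M (T ^^ n)) M T"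
    by (subst distr_distr) (auto simp: comp_def)
  then show ?case using Suc distr_T by (simp only:)
qed

lemma integral_iter:
  fixes \<phi> :: "'a \<Rightarrow> 'b::{banach, second_countable_topology}"
  assumes [measurable]: "\<phi> \<in> borel_measurable M"
  shows "(\<integral>x. \<phi> ((T ^^ n) x) \<partial>M) = (\<integral>x. \<phi> x \<partial>M)"
  using integral_distr[of "T ^^ n" M M \<phi>] distr_iter by simp

lemma AE_iter: "AE x in M. P x \<Longrightarrow> AE x in M. P ((T ^^ n) x)"
  by (rule AE_distrD[OF iter_measurable]) (simp only: distr_iter)

lemma AE_orbit: "AE x in M. P x \<Longrightarrow> AE x in M. \<forall>n. P ((T ^^ n) x)"
  unfolding AE_all_countable using AE_iter by blast

text \<open>The maximum of the partial sums of 1 up to n + 1 terms along the orbit. The recursive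
  form displays the comparison of x with \<open>T x\<close> on which the maximal argument
  rests.\<close>

primrec maxsum :: "('a \<Rightarrow> real) \<Rightarrow> nat \<Rightarrow> 'a \<Rightarrow> real" where
  "maxsum \<psi> 0 x = \<psi> x"
| "maxsum \<psi> (Suc n) x = \<psi> x + max 0 (maxsum \<psi> n (T x))"

lemma maxsum_measurable [measurable]:
  assumes [measurable]: "\<psi> \<in> borel_measurable M"
  shows "maxsum \<psi> n \<in> borel_measurable M"
proof (induction n)
  case (Suc n)
  have [measurable]: "maxsum \<psi> n \<in> borel_measurable M" by fact
  show ?case by simp
qed (simp add: assms)

lemma maxsum_mono: "maxsum \<psi> n x \<le> maxsum \<psi> (Suc n) x"
proof (induction n arbitrary: x)
  case (Suc n)
  show ?case using Suc[of "T x"] by simp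
qed simp

lemma maxsum_ge: "(\<Sum>i<Suc n. \<psi> ((T ^^ i) x)) \<le> maxsum \<psi> n x"
proof (induction n arbitrary: x)
  case (Suc n)
  have "(\<Sum>i<Suc (Suc n). \<psi> ((T ^^ i) x)) = \<psi> x + (\<Sum>i<Suc n. \<psi> ((T ^^ i) (T x)))"
    by (subst sum.lessThan_Suc_shift) (simp add: funpow_swap1)
  also have "\<dots> \<le> maxsum \<psi> (Suc n) x" using Suc[of "T x"] by simp
  finally show ?case .
qed simp

lemma maxsum_bound:
  assumes "\<And>x. \<bar>\<psi> x\<bar> \<le> C"
  shows "\<bar>maxsum \<psi> n x\<bar> \<le> real (Suc n) * C"
proof (induction n arbitrary: x)
  case (Suc n)
  have "0 \<le> C" using assms[of x] by linarith
  then show ?case using Suc[of "T x"] assms[of x] by (simp add: algebra_simps max_def abs_le_iff)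
qed (simp add: assms)

text \<open>On the invariant set where the partial sums are unbounded,
  \<open>maxsum \<psi> (Suc n) - maxsum \<psi> n \<circ> T\<close> converges boundedly to \<open>\<psi>\<close>,
  while its integral is nonnegative by monotonicity.\<close>

lemma negative_mean_bounded_sums:
  fixes \<psi> :: "'a \<Rightarrow> real"
  assumes [measurable]: "\<psi> \<in> borel_measurable M" and C: "\<And>x. \<bar>\<psi> x\<bar> \<le> C"
    and neg: "(\<integral>x. \<psi> x \<partial>M) < 0"
  shows "AE x in M. \<exists>B. \<forall>n. (\<Sum>i<n. \<psi> ((T ^^ i) x)) \<le> B"
proof -
  have C0: "0 \<le> C" using C[of undefined] by linarith
  define E where "E = {x \<in> space M. \<forall>B::nat. \<exists>n. maxsum \<psi> n x > real B}"
  have [measurable]: "E \<in> sets M" unfolding E_def by measurable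
  have mono: "maxsum \<psi> m x \<le> maxsum \<psi> n x" if "m \<le> n" for m n x
    using that lift_Suc_mono_le[of "\<lambda>n. maxsum \<psi> n x"] maxsum_mono by blast
  \<comment> \<open>Passing between x and \<open>T x\<close> changes a partial sum by one term, at
    most C in modulus; this is the reason for the offset by the ceiling of C.\<close>
  have inv: "T x \<in> E \<longleftrightarrow> x \<in> E" if x: "x \<in> space M" for x
  proof
    assume Tx: "T x \<in> E"
    have "\<exists>n. maxsum \<psi> n x > real B" for B
    proof -
      obtain n where "maxsum \<psi> n (T x) > real (B + nat \<lceil>C\<rceil>)" using Tx unfolding E_def mem_Collect_eq by blast
      then have "maxsum \<psi> (Suc n) x > real B"
        using C[of x] C0 by (simp add: max_def) linarith
      then show ?thesis by blast
    qed
    then show "x \<in> E" using x by (simp add: E_def)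
  next
    assume xE: "x \<in> E"
    have "\<exists>n. maxsum \<psi> n (T x) > real B" for B
    proof -
      obtain n where n: "maxsum \<psi> n x > real (B + nat \<lceil>C\<rceil>)" using xE unfolding E_def mem_Collect_eq by blast
      then have "maxsum \<psi> (Suc n) x > real (B + nat \<lceil>C\<rceil>)" using maxsum_mono[of \<psi> n x] by linarith
      then have "max 0 (maxsum \<psi> n (T x)) > real B"
        using C[of x] by simp linarith
      then show ?thesis by (metis max_def of_nat_0_le_iff not_less)
    qed
    then show "T x \<in> E" using measurable_space[OF T_measurable x] by (simp add: E_def)
  qed
  have "T -` E \<inter> space M = E"
    using inv by (auto simp: E_def)
  then consider "measure M E = 0" | "measure M E = 1" using invariant_measure[of E] by auto
  then have "AE x in M. x \<notin> E"
  proof cases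
    case 1
    then show ?thesis by (intro AE_not_in) (simp add: null_sets_def emeasure_eq_measure)
  next
    case 2
    then have AE_E: "AE x in M. x \<in> E" by (simp add: prob_eq_1)
    have int: "integrable M (maxsum \<psi> n)" for n
      using maxsum_bound[OF C] by (intro integrable_const_bound[of _ "real (Suc n) * C"]) auto
    have intT: "integrable M (\<lambda>x. maxsum \<psi> n (T x))" for n
      using maxsum_bound[OF C] by (intro integrable_const_bound[of _ "real (Suc n) * C"]) auto
    have "(\<lambda>n. \<integral>x. (maxsum \<psi> (Suc n) x - maxsum \<psi> n (T x)) \<partial>M) \<longlonglongrightarrow> (\<integral>x. \<psi> x \<partial>M)"
    proof (rule integral_dominated_convergence[where w = "\<lambda>_. 2 * C"])
      show "AE x in M. (\<lambda>n. maxsum \<psi> (Suc n) x - maxsum \<psi> n (T x)) \<longlonglongrightarrow> \<psi> x"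
        using AE_E AE_space
      proof eventually_elim
        case (elim x)
        then have "T x \<in> E" using inv by simp
        \<comment> \<open>From n0 on the maximum with 0 is inactive, and the difference equals
          \<open>\<psi> x\<close> exactly.\<close>
        then obtain n0 where n0: "maxsum \<psi> n0 (T x) > real 0" unfolding E_def by blast
        have "\<forall>\<^sub>F n in sequentially. maxsum \<psi> (Suc n) x - maxsum \<psi> n (T x) = \<psi> x"
          using eventually_ge_at_top[of n0]
          by eventually_elim (use n0 mono[of n0 _ "T x"] in force)
        then show ?case by (rule tendsto_eventually)
      qed
      show "AE x in M. norm (maxsum \<psi> (Suc n) x - maxsum \<psi> n (T x)) \<le> 2 * C" for n
      proof (rule AE_I2)
        fix x
        have "maxsum \<psi> n (T x) \<ge> \<psi> (T x)" using mono[of 0 n "T x"] by simp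
        then show "norm (maxsum \<psi> (Suc n) x - maxsum \<psi> n (T x)) \<le> 2 * C"
          using C[of x] C[of "T x"] by (auto simp: max_def)
      qed
    qed auto
    moreover have "0 \<le> (\<integral>x. (maxsum \<psi> (Suc n) x - maxsum \<psi> n (T x)) \<partial>M)" for n
    proof -
      have "(\<integral>x. maxsum \<psi> n (T x) \<partial>M) = (\<integral>x. maxsum \<psi> n x \<partial>M)"
        using integral_iter[of "maxsum \<psi> n" 1] by simp
      also have "\<dots> \<le> (\<integral>x. maxsum \<psi> (Suc n) x \<partial>M)"
        by (intro integral_mono int maxsum_mono)
      finally show ?thesis
        unfolding Bochner_Integration.integral_diff[OF int intT] by (rule diff_ge_0_iff_ge[THEN iffD2])
    qed
    ultimately have "0 \<le> (\<integral>x. \<psi> x \<partial>M)" by (auto intro: tendsto_lowerbound)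
    then show ?thesis using neg by simp
  qed
  then show ?thesis using AE_space
  proof eventually_elim
    case (elim x)
    then obtain B where B: "\<And>n. maxsum \<psi> n x \<le> real B" by (auto simp: E_def not_less)
    have "(\<Sum>i<n. \<psi> ((T ^^ i) x)) \<le> real B" for n
    proof (cases n)
      case (Suc m)
      then show ?thesis using maxsum_ge[of \<psi> x m] B[of m] by simp
    qed simp
    then show ?case by blast
  qed
qed

text \<open>Subtracting a constant slightly above the mean leaves a function of negative mean, whose
  sums are bounded above. Half of the margin 2 / (k + 1) makes the mean negative, the other half
  absorbs B / N. Countably many margins keep the exceptional set null.\<close>

lemma birkhoff_upper:
  fixes \<phi> :: "'a \<Rightarrow> real"
  assumes [measurable]: "\<phi> \<in> borel_measurable M" and C: "\<And>x. \<bar>\<phi> x\<bar> \<le> C"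
  shows "AE x in M. \<forall>k::nat. \<forall>\<^sub>F N in sequentially.
    (1 / real N) * (\<Sum>i<N. \<phi> ((T ^^ i) x)) < (\<integral>x. \<phi> x \<partial>M) + 2 / real (Suc k)"
  unfolding AE_all_countable
proof
  fix k :: nat
  define c where "c = (\<integral>x. \<phi> x \<partial>M) + 1 / real (Suc k)"
  have int: "integrable M \<phi>" using C by (intro integrable_const_bound[of _ C]) auto
  have "AE x in M. \<exists>B. \<forall>n. (\<Sum>i<n. \<phi> ((T ^^ i) x) - c) \<le> B"
  proof (rule negative_mean_bounded_sums)
    show "\<bar>\<phi> x - c\<bar> \<le> C + \<bar>c\<bar>" for x using C[of x] by linarith
    show "(\<integral>x. \<phi> x - c \<partial>M) < 0"
      using int by (simp add: prob_space c_def)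
  qed auto
  then show "AE x in M. \<forall>\<^sub>F N in sequentially.
    (1 / real N) * (\<Sum>i<N. \<phi> ((T ^^ i) x)) < (\<integral>x. \<phi> x \<partial>M) + 2 / real (Suc k)"
  proof eventually_elim
    case (elim x)
    then obtain B where B: "\<And>n. (\<Sum>i<n. \<phi> ((T ^^ i) x) - c) \<le> B" by blast
    have "\<forall>\<^sub>F N in sequentially. B / real N < 1 / real (Suc k)"
      by (rule order_tendstoD(2)[OF lim_const_over_n]) simp
    then show ?case using eventually_ge_at_top[of 1]
    proof eventually_elim
      case (elim N)
      have "(1 / real N) * (\<Sum>i<N. \<phi> ((T ^^ i) x)) \<le> c + B / real N"
        using B[of N] elim(2) by (simp add: sum_subtractf field_simps)
      then show ?case using elim(1) by (simp add: c_def)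
    qed
  qed
qed

lemma birkhoff_real:
  fixes \<phi> :: "'a \<Rightarrow> real"
  assumes [measurable]: "\<phi> \<in> borel_measurable M" and C: "\<And>x. \<bar>\<phi> x\<bar> \<le> C"
  shows "AE x in M. (\<lambda>N. (1 / real N) * (\<Sum>i<N. \<phi> ((T ^^ i) x))) \<longlonglongrightarrow> (\<integral>x. \<phi> x \<partial>M)"
proof -
  have "AE x in M. \<forall>k::nat. \<forall>\<^sub>F N in sequentially.
    (1 / real N) * (\<Sum>i<N. - \<phi> ((T ^^ i) x)) < (\<integral>x. - \<phi> x \<partial>M) + 2 / real (Suc k)"
    using C by (intro birkhoff_upper[of "\<lambda>x. - \<phi> x" C]) auto
  then show ?thesis using birkhoff_upper[OF assms]
  proof eventually_elim
    case (elim x)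
    have arch: "\<exists>k. 2 / real (Suc k) < e" if "e > 0" for e
      using reals_Archimedean[of "e/2"] that by (auto simp: field_simps)
    show ?case
    proof (rule order_tendstoI)
      fix y assume y: "y < (\<integral>x. \<phi> x \<partial>M)"
      then obtain k where k: "2 / real (Suc k) < (\<integral>x. \<phi> x \<partial>M) - y" using arch[of "(\<integral>x. \<phi> x \<partial>M) - y"] by auto
      show "\<forall>\<^sub>F N in sequentially. y < (1 / real N) * (\<Sum>i<N. \<phi> ((T ^^ i) x))"
        using elim(1)[rule_format, of k] by eventually_elim (use k in \<open>simp add: sum_negf\<close>)
    next
      fix y assume y: "(\<integral>x. \<phi> x \<partial>M) < y"
      then obtain k where k: "2 / real (Suc k) < y - (\<integral>x. \<phi> x \<partial>M)" using arch[of "y - (\<integral>x. \<phi> x \<partial>M)"] by auto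
      show "\<forall>\<^sub>F N in sequentially. (1 / real N) * (\<Sum>i<N. \<phi> ((T ^^ i) x)) < y"
        using elim(2)[rule_format, of k] by eventually_elim (use k in simp)
    qed
  qed
qed

theorem birkhoff:
  fixes \<phi> :: "'a \<Rightarrow> complex"
  assumes [measurable]: "\<phi> \<in> borel_measurable M" and C: "AE x in M. cmod (\<phi> x) \<le> C"
  shows "AE x in M. (\<lambda>N. (1 / of_nat N) * (\<Sum>i<N. \<phi> ((T ^^ Suc i) x))) \<longlonglongrightarrow> (\<integral>x. \<phi> x \<partial>M)"
proof -
  \<comment> \<open>A version bounded everywhere; it agrees with \<phi> along almost every
    orbit.\<close>
  define \<psi> where "\<psi> x = (if cmod (\<phi> x) \<le> C then \<phi> x else 0)" for x
  have [measurable]: "\<psi> \<in> borel_measurable M" unfolding \<psi>_def by measurable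
  have b: "cmod (\<psi> x) \<le> \<bar>C\<bar>" for x by (auto simp: \<psi>_def)
  have eq: "AE x in M. \<phi> x = \<psi> x" using C by eventually_elim (simp add: \<psi>_def)
  have int: "integrable M \<psi>" using b by (intro integrable_const_bound[of _ "\<bar>C\<bar>"]) auto
  have "AE x in M. (\<lambda>N. (1 / real N) * (\<Sum>i<N. Re (\<psi> ((T ^^ i) x)))) \<longlonglongrightarrow> (\<integral>x. Re (\<psi> x) \<partial>M)"
    using b abs_Re_le_cmod order_trans by (intro birkhoff_real[of _ "\<bar>C\<bar>"]) (auto, blast)
  moreover have "AE x in M. (\<lambda>N. (1 / real N) * (\<Sum>i<N. Im (\<psi> ((T ^^ i) x)))) \<longlonglongrightarrow> (\<integral>x. Im (\<psi> x) \<partial>M)"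
    using b abs_Im_le_cmod order_trans by (intro birkhoff_real[of _ "\<bar>C\<bar>"]) (auto, blast)
  ultimately have "AE x in M. (\<lambda>N. (1 / of_nat N) * (\<Sum>i<N. \<psi> ((T ^^ i) x))) \<longlonglongrightarrow> (\<integral>x. \<psi> x \<partial>M)"
  proof eventually_elim
    case (elim x)
    have "(\<lambda>N. complex_of_real ((1 / real N) * (\<Sum>i<N. Re (\<psi> ((T ^^ i) x))))
        + \<i> * complex_of_real ((1 / real N) * (\<Sum>i<N. Im (\<psi> ((T ^^ i) x)))))
      \<longlonglongrightarrow> complex_of_real (\<integral>x. Re (\<psi> x) \<partial>M) + \<i> * complex_of_real (\<integral>x. Im (\<psi> x) \<partial>M)"
      by (intro tendsto_intros elim)
    moreover have "complex_of_real (\<integral>x. Re (\<psi> x) \<partial>M) + \<i> * complex_of_real (\<integral>x. Im (\<psi> x) \<partial>M) = (\<integral>x. \<psi> x \<partial>M)"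
      using int by (simp add: complex_eq_iff)
    moreover have "complex_of_real ((1 / real N) * (\<Sum>i<N. Re (\<psi> ((T ^^ i) x))))
        + \<i> * complex_of_real ((1 / real N) * (\<Sum>i<N. Im (\<psi> ((T ^^ i) x))))
        = (1 / of_nat N) * (\<Sum>i<N. \<psi> ((T ^^ i) x))" for N
      by (simp add: complex_eq_iff Re_divide_of_nat Im_divide_of_nat)
    ultimately show ?case by simp
  qed
  then have "AE x in M. (\<lambda>N. (1 / of_nat N) * (\<Sum>i<N. \<psi> ((T ^^ i) ((T ^^ 1) x)))) \<longlonglongrightarrow> (\<integral>x. \<psi> x \<partial>M)"
    by (rule AE_iter)
  then show ?thesis using AE_orbit[OF eq]
  proof eventually_elim
    case (elim x)
    have "(\<integral>x. \<psi> x \<partial>M) = (\<integral>x. \<phi> x \<partial>M)"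
      by (intro integral_cong_AE) (use eq in auto)
    moreover have "\<psi> ((T ^^ i) ((T ^^ 1) x)) = \<phi> ((T ^^ Suc i) x)" for i
      using elim(2)[rule_format, of "Suc i"] by (simp add: funpow_swap1)
    ultimately show ?case using elim(1) by simp
  qed
qed

end

section \<open>Existence and monotonicity of the seminorms\<close>

definition delta :: "('a \<Rightarrow> 'a) \<Rightarrow> nat \<Rightarrow> ('a \<Rightarrow> complex) \<Rightarrow> 'a \<Rightarrow> complex" where
  "delta T r f x = f x * cnj (f ((T ^^ r) x))"

text \<open>\<open>hkp m f\<close> is the power \<open>2\<^sup>k\<close> of \<open>|||f|||\<^sub>k\<close> for \<open>k = m + 1\<close>; starting
  at \<open>k = 1\<close> makes the recursion uniform.\<close>

primrec hkp :: "'a measure \<Rightarrow> ('a \<Rightarrow> 'a) \<Rightarrow> nat \<Rightarrow> ('a \<Rightarrow> complex) \<Rightarrow> real" where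
  "hkp M T 0 f = (cmod (\<integral>x. f x \<partial>M))\<^sup>2"
| "hkp M T (Suc m) f = lim (\<lambda>H. (1 / real H) * (\<Sum>h=1..H. hkp M T m (delta T h f)))"

lemma HK_power_eq_hkp: "HK_power M T m f = hkp M T (Suc m) f"
  by (induction m arbitrary: f) (simp_all add: delta_def[abs_def])

text \<open>Lets the recursion of the seminorms, which differences the function first, be read as
  adding a last coordinate r to the box.\<close>

lemma cube_prod_delta:
  "cube_prod T d (\<lambda>\<eta>. delta T r f) h = cube_prod T (Suc d) (\<lambda>\<eta>. f) (h(Suc d := r))"
proof
  fix x
  have "cube_prod T d (\<lambda>\<eta> x. f ((T ^^ r) x)) h x = cube_prod T d (\<lambda>\<eta>. f) h ((T ^^ r) x)"
    unfolding cube_prod_def by (simp add: funpow_add[symmetric, THEN fun_cong, unfolded comp_def] add.commute)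
  then show "cube_prod T d (\<lambda>\<eta>. delta T r f) h x = cube_prod T (Suc d) (\<lambda>\<eta>. f) (h(Suc d := r)) x"
    unfolding cube_prod_Suc delta_def[abs_def] by (simp add: cube_prod_mult_cnj)
qed

lemma cnj_measurable [measurable]: "cnj \<in> borel_measurable borel"
  by (intro borel_measurable_continuous_onI continuous_intros)

context ergodic_system
begin

text \<open>The normalization used for all estimates: the class is closed under products,
  conjugation and T, so every function derived from f keeps the same bound.\<close>

definition unit_fun :: "('a \<Rightarrow> complex) set" where
  "unit_fun = {f \<in> borel_measurable M. AE x in M. cmod (f x) \<le> 1}"

lemma unit_funD: "f \<in> unit_fun \<Longrightarrow> f \<in> borel_measurable M"
  by (simp add: unit_fun_def)

lemma unit_fun_AE: "f \<in> unit_fun \<Longrightarrow> AE x in M. cmod (f x) \<le> 1"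
  by (simp add: unit_fun_def)

lemma unit_fun_integrable: "f \<in> unit_fun \<Longrightarrow> integrable M f"
  by (rule integrable_const_bound[OF unit_fun_AE unit_funD])

lemma unit_fun_iter: "f \<in> unit_fun \<Longrightarrow> (\<lambda>x. f ((T ^^ n) x)) \<in> unit_fun"
  using AE_iter[OF unit_fun_AE, of f n] unfolding unit_fun_def by auto

lemma unit_fun_cnj: "f \<in> unit_fun \<Longrightarrow> (\<lambda>x. cnj (f x)) \<in> unit_fun"
  unfolding unit_fun_def by auto

lemma unit_fun_mult:
  assumes "f \<in> unit_fun" "g \<in> unit_fun"
  shows "(\<lambda>x. f x * g x) \<in> unit_fun"
proof -
  have "AE x in M. cmod (f x * g x) \<le> 1"
    using unit_fun_AE[OF assms(1)] unit_fun_AE[OF assms(2)]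
    by eventually_elim (simp add: norm_mult mult_le_one)
  then show ?thesis using assms unfolding unit_fun_def by auto
qed

lemma unit_fun_prod: "(\<And>i. i \<in> I \<Longrightarrow> F i \<in> unit_fun) \<Longrightarrow> (\<lambda>x. \<Prod>i\<in>I. F i x) \<in> unit_fun"
proof (induction I rule: infinite_finite_induct)
  case (insert i I)
  then show ?case using unit_fun_mult[of "F i" "\<lambda>x. \<Prod>i\<in>I. F i x"] by simp
qed (simp_all add: unit_fun_def)

lemma unit_fun_cube_prod:
  assumes "\<And>\<eta>. \<eta> \<in> cube d \<Longrightarrow> g \<eta> \<in> unit_fun"
  shows "cube_prod T d g h \<in> unit_fun"
proof -
  have *: "(\<lambda>x. (cnj ^^ m) (f x)) \<in> unit_fun" if "f \<in> unit_fun" for m f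
    using that by (induction m) (auto intro: unit_fun_cnj)
  show ?thesis
    unfolding cube_prod_def[abs_def]
    by (intro unit_fun_prod * unit_fun_iter assms)
qed

lemma unit_fun_delta: "f \<in> unit_fun \<Longrightarrow> delta T r f \<in> unit_fun"
  unfolding delta_def[abs_def] by (intro unit_fun_mult unit_fun_cnj unit_fun_iter)

section \<open>Invariance of the seminorms and their kernels\<close>

lemma hkp_comp:
  assumes [measurable]: "f \<in> borel_measurable M"
  shows "hkp M T m (\<lambda>x. f (T x)) = hkp M T m f"
  using assms
proof (induction m arbitrary: f)
  case 0
  then show ?case using integral_iter[of f 1] by simp
next
  case (Suc m)
  have [measurable]: "f \<in> borel_measurable M" by fact
  have "delta T h (\<lambda>x. f (T x)) = (\<lambda>x. delta T h f (T x))" for h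
    by (simp add: delta_def fun_eq_iff funpow_swap1)
  moreover have "delta T h f \<in> borel_measurable M" for h
    unfolding delta_def[abs_def] by measurable
  ultimately show ?case by (simp add: Suc.IH)
qed

lemma hkp_cnj: "hkp M T m (\<lambda>x. cnj (f x)) = hkp M T m f"
proof (induction m arbitrary: f)
  case (Suc m)
  have "delta T h (\<lambda>x. cnj (f x)) = (\<lambda>x. cnj (delta T h f x))" for h
    by (simp add: delta_def fun_eq_iff)
  then show ?case by (simp add: Suc.IH)
qed simp

text \<open>A Gram matrix attached to the translates of f: \<open>hkp_comp\<close> gives
  stationarity, \<open>hkp_cnj\<close> gives symmetry, and row 0 contains the numbers whose averages
  define the next seminorm.\<close>

definition kernel :: "nat \<Rightarrow> ('a \<Rightarrow> complex) \<Rightarrow> nat \<Rightarrow> nat \<Rightarrow> real" where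
  "kernel m f i j = hkp M T m (\<lambda>x. f ((T ^^ i) x) * cnj (f ((T ^^ j) x)))"

lemma kernel_0: "kernel m f 0 h = hkp M T m (delta T h f)"
  by (simp add: kernel_def delta_def[abs_def])

lemma unit_fun_pair:
  "f \<in> unit_fun \<Longrightarrow> (\<lambda>x. f ((T ^^ i) x) * cnj (f ((T ^^ j) x))) \<in> unit_fun"
  by (intro unit_fun_mult unit_fun_cnj unit_fun_iter)

text \<open>Makes the kernel of the next level an average of kernels of the differences of f, which
  is how positivity passes from level to level.\<close>

lemma delta_pair:
  "delta T h (\<lambda>x. f ((T ^^ i) x) * cnj (f ((T ^^ j) x)))
    = (\<lambda>x. delta T h f ((T ^^ i) x) * cnj (delta T h f ((T ^^ j) x)))"
proof -
  have "(T ^^ h) ((T ^^ i) x) = (T ^^ i) ((T ^^ h) x)" for i x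
    by (metis add.commute comp_apply funpow_add)
  then show ?thesis by (simp add: delta_def fun_eq_iff)
qed

text \<open>The base case is the Schur square of a Gram matrix, written as
  the integral of \<open>|\<Sum>\<^sub>i c\<^sub>i f\<^sub>i(x) cnj (f\<^sub>i(y))|\<^sup>2\<close> over \<open>x\<close> and \<open>y\<close>.\<close>

lemma kernel_0_psd:
  assumes f: "f \<in> unit_fun"
  shows "0 \<le> (\<Sum>i<n. \<Sum>j<n. c i * c j * kernel 0 f i j)"
proof -
  define F where "F i x = f ((T ^^ i) x)" for i x
  define A where "A i j = (\<integral>x. F i x * cnj (F j x) \<partial>M)" for i j
  define P where "P x y = (\<Sum>i<n. of_real (c i) * F i x * cnj (F i y))" for x y
  have int: "integrable M (\<lambda>x. F i x * cnj (F j x))" for i j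
    unfolding F_def by (rule unit_fun_integrable[OF unit_fun_pair[OF f]])
  have P2: "complex_of_real ((cmod (P x y))\<^sup>2)
      = (\<Sum>i<n. \<Sum>j<n. (of_real (c i * c j) * (F j y * cnj (F i y))) * (F i x * cnj (F j x)))" for x y
    by (simp add: P_def complex_norm_square sum_product mult_ac flip: of_real_power)
  have inner: "complex_of_real (\<integral>x. (cmod (P x y))\<^sup>2 \<partial>M)
      = (\<Sum>i<n. \<Sum>j<n. (of_real (c i * c j) * A i j) * (F j y * cnj (F i y)))" for y
  proof -
    have "complex_of_real (\<integral>x. (cmod (P x y))\<^sup>2 \<partial>M) = (\<integral>x. complex_of_real ((cmod (P x y))\<^sup>2) \<partial>M)"
      by (rule integral_complex_of_real[symmetric])
    also have "\<dots> = (\<Sum>i<n. \<Sum>j<n. (of_real (c i * c j) * (F j y * cnj (F i y))) * A i j)"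
      unfolding P2 A_def using int by (simp add: Bochner_Integration.integral_sum)
    finally show ?thesis by (simp add: mult_ac)
  qed
  have "complex_of_real (\<integral>y. (\<integral>x. (cmod (P x y))\<^sup>2 \<partial>M) \<partial>M) = (\<integral>y. complex_of_real (\<integral>x. (cmod (P x y))\<^sup>2 \<partial>M) \<partial>M)"
    by (rule integral_complex_of_real[symmetric])
  also have "\<dots> = (\<Sum>i<n. \<Sum>j<n. (of_real (c i * c j) * A i j) * A j i)"
    unfolding inner A_def using int by (simp add: Bochner_Integration.integral_sum)
  also have "\<dots> = (\<Sum>i<n. \<Sum>j<n. complex_of_real (c i * c j * kernel 0 f i j))"
  proof (intro sum.cong refl)
    fix i j
    have "A j i = (\<integral>x. cnj (F i x * cnj (F j x)) \<partial>M)" by (simp add: A_def mult.commute)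
    also have "\<dots> = cnj (A i j)" unfolding A_def by (rule Bochner_Integration.integral_cnj)
    finally have A: "A j i = cnj (A i j)" .
    have k: "kernel 0 f i j = (cmod (A i j))\<^sup>2" by (simp add: kernel_def A_def F_def)
    show "(of_real (c i * c j) * A i j) * A j i = complex_of_real (c i * c j * kernel 0 f i j)"
      unfolding k A of_real_mult[of "c i * c j"] complex_norm_square by (rule mult.assoc)
  qed
  finally have "(\<integral>y. (\<integral>x. (cmod (P x y))\<^sup>2 \<partial>M) \<partial>M) = (\<Sum>i<n. \<Sum>j<n. c i * c j * kernel 0 f i j)"
    unfolding of_real_sum[symmetric] of_real_eq_iff .
  moreover have "0 \<le> (\<integral>y. (\<integral>x. (cmod (P x y))\<^sup>2 \<partial>M) \<partial>M)" by simp
  ultimately show ?thesis by simp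
qed

text \<open>A joint induction: the kernel at level m makes the limit defining level m + 1 converge,
  and only a genuine limit inherits positive semidefiniteness for the kernel at level m + 1. The
  upper bound 1 is the window bound of the mean ergodic theorem for N = 1.\<close>

lemma hkp_kernel:
  assumes "f \<in> unit_fun"
  shows "0 \<le> hkp M T m f \<and> hkp M T m f \<le> 1 \<and> stationary_kernel (kernel m f) 1"
  using assms
proof (induction m arbitrary: f)
  case 0
  have b: "0 \<le> hkp M T 0 g \<and> hkp M T 0 g \<le> 1" if g: "g \<in> unit_fun" for g
  proof -
    have "cmod (\<integral>x. g x \<partial>M) \<le> (\<integral>x. cmod (g x) \<partial>M)" by (rule integral_norm_bound)
    also have "\<dots> \<le> (\<integral>x. 1 \<partial>M)"
      using unit_fun_AE[OF g] unit_fun_integrable[OF g] by (intro integral_mono_AE) auto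
    finally show ?thesis by (simp add: prob_space power_le_one)
  qed
  have "stationary_kernel (kernel 0 f) 1"
  proof
    show "kernel 0 f i j = kernel 0 f j i" for i j
      unfolding kernel_def using hkp_cnj[of 0 "\<lambda>x. f ((T ^^ j) x) * cnj (f ((T ^^ i) x))"] by (simp add: mult.commute)
    show "kernel 0 f (Suc i) (Suc j) = kernel 0 f i j" for i j
      unfolding kernel_def using hkp_comp[OF unit_funD[OF unit_fun_pair[OF 0]], of 0 i j] by (simp add: funpow_swap1)
    show "\<bar>kernel 0 f i j\<bar> \<le> 1" for i j
      using b[OF unit_fun_pair[OF 0, of i j]] by (simp add: kernel_def)
  qed (rule kernel_0_psd[OF 0])
  then show ?case using b[OF 0] by simp
next
  case (Suc m)
  have conv: "(\<lambda>H. (1 / real H) * (\<Sum>h=1..H. hkp M T m (delta T h g))) \<longlonglongrightarrow> hkp M T (Suc m) g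
      \<and> 0 \<le> hkp M T (Suc m) g \<and> hkp M T (Suc m) g \<le> 1" if g: "g \<in> unit_fun" for g
  proof -
    interpret stationary_kernel "kernel m g" 1 using Suc.IH[OF g] by blast
    obtain L where L: "(\<lambda>H. (1 / real H) * (\<Sum>h=1..H. kernel m g 0 h)) \<longlonglongrightarrow> L" "0 \<le> L"
      "\<And>N. N \<ge> 1 \<Longrightarrow> L \<le> (\<Sum>i<N. \<Sum>j<N. kernel m g i j) / (real N)\<^sup>2"
      using mean_ergodic by blast
    have "hkp M T (Suc m) g = L"
      using limI[OF L(1)] by (simp add: kernel_0)
    moreover have "L \<le> 1" using L(3)[of 1] bound[of 0 0] by simp
    ultimately show ?thesis using L by (simp add: kernel_0)
  qed
  have "stationary_kernel (kernel (Suc m) f) 1"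
  proof
    show "kernel (Suc m) f i j = kernel (Suc m) f j i" for i j
      unfolding kernel_def using hkp_cnj[of "Suc m" "\<lambda>x. f ((T ^^ j) x) * cnj (f ((T ^^ i) x))"] by (simp add: mult.commute)
    show "kernel (Suc m) f (Suc i) (Suc j) = kernel (Suc m) f i j" for i j
      unfolding kernel_def using hkp_comp[OF unit_funD[OF unit_fun_pair[OF Suc.prems]], of "Suc m" i j] by (simp add: funpow_swap1)
    show "\<bar>kernel (Suc m) f i j\<bar> \<le> 1" for i j
      using conv[OF unit_fun_pair[OF Suc.prems, of i j]] by (simp add: kernel_def del: hkp.simps)
    show "0 \<le> (\<Sum>i<n. \<Sum>j<n. c i * c j * kernel (Suc m) f i j)" for n c
    proof (rule tendsto_lowerbound)
      have "(\<lambda>H. (1 / real H) * (\<Sum>h=1..H. kernel m (delta T h f) i j)) \<longlonglongrightarrow> kernel (Suc m) f i j" for i j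
        using conv[OF unit_fun_pair[OF Suc.prems, of i j]] unfolding kernel_def delta_pair by blast
      then show "(\<lambda>H. \<Sum>i<n. \<Sum>j<n. c i * c j * ((1 / real H) * (\<Sum>h=1..H. kernel m (delta T h f) i j)))
        \<longlonglongrightarrow> (\<Sum>i<n. \<Sum>j<n. c i * c j * kernel (Suc m) f i j)"
        by (intro tendsto_intros)
      have "0 \<le> (\<Sum>i<n. \<Sum>j<n. c i * c j * ((1 / real H) * (\<Sum>h=1..H. kernel m (delta T h f) i j)))" for H
      proof -
        have "0 \<le> (1 / real H) * (\<Sum>h=1..H. \<Sum>i<n. \<Sum>j<n. c i * c j * kernel m (delta T h f) i j)"
        proof (rule mult_nonneg_nonneg, simp, rule sum_nonneg)
          fix h assume "h \<in> {1..H}"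
          interpret stationary_kernel "kernel m (delta T h f)" 1
            using Suc.IH[OF unit_fun_delta[OF Suc.prems]] by blast
          show "0 \<le> (\<Sum>i<n. \<Sum>j<n. c i * c j * kernel m (delta T h f) i j)" by (rule psd)
        qed
        also have "\<dots> = (\<Sum>i<n. \<Sum>j<n. c i * c j * ((1 / real H) * (\<Sum>h=1..H. kernel m (delta T h f) i j)))"
        proof -
          have "(\<Sum>i<n. \<Sum>j<n. c i * c j * ((1 / real H) * (\<Sum>h=1..H. kernel m (delta T h f) i j)))
            = (\<Sum>i<n. \<Sum>j<n. \<Sum>h=1..H. (1 / real H) * (c i * c j * kernel m (delta T h f) i j))"
            unfolding sum_distrib_left by (rule sum.cong[OF refl])+ simp
          also have "\<dots> = (\<Sum>i<n. \<Sum>h=1..H. \<Sum>j<n. (1 / real H) * (c i * c j * kernel m (delta T h f) i j))"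
            by (rule sum.cong[OF refl], rule sum.swap)
          also have "\<dots> = (\<Sum>h=1..H. \<Sum>i<n. \<Sum>j<n. (1 / real H) * (c i * c j * kernel m (delta T h f) i j))"
            by (rule sum.swap)
          finally show ?thesis by (simp only: sum_distrib_left)
        qed
        finally show ?thesis .
      qed
      then show "\<forall>\<^sub>F H in sequentially. 0 \<le> (\<Sum>i<n. \<Sum>j<n. c i * c j * ((1 / real H) * (\<Sum>h=1..H. kernel m (delta T h f) i j)))"
        by simp
    qed simp
  qed
  then show ?case using conv[OF Suc.prems] by simp
qed

lemma hkp_nonneg: "f \<in> unit_fun \<Longrightarrow> 0 \<le> hkp M T m f"
  using hkp_kernel by blast

text \<open>For the inequality the N by N sum is grouped by the distance of i and j: the diagonal
  contributes at most 1 / N, and every other distance occurs at most 2 N times. Nonnegativity of the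
  kernel allows the rough count.\<close>

lemma
  assumes f: "f \<in> unit_fun"
  shows hkp_tendsto: "(\<lambda>H. mean {1..H} (\<lambda>h. hkp M T m (delta T h f))) \<longlonglongrightarrow> hkp M T (Suc m) f"
    and hkp_Suc_le: "N \<ge> 1 \<Longrightarrow> hkp M T (Suc m) f \<le> 1 / real N + 2 * mean {1..N} (\<lambda>r. hkp M T m (delta T r f))"
proof -
  interpret stationary_kernel "kernel m f" 1 using hkp_kernel[OF f] by blast
  obtain L where L: "(\<lambda>H. (1 / real H) * (\<Sum>h=1..H. kernel m f 0 h)) \<longlonglongrightarrow> L" "0 \<le> L"
    "\<And>N. N \<ge> 1 \<Longrightarrow> L \<le> (\<Sum>i<N. \<Sum>j<N. kernel m f i j) / (real N)\<^sup>2"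
    using mean_ergodic by blast
  have eq: "hkp M T (Suc m) f = L"
    using limI[OF L(1)] by (simp add: kernel_0)
  show "(\<lambda>H. mean {1..H} (\<lambda>h. hkp M T m (delta T h f))) \<longlonglongrightarrow> hkp M T (Suc m) f"
    using L(1) unfolding eq by (simp add: kernel_0 mean_def)
  show "hkp M T (Suc m) f \<le> 1 / real N + 2 * mean {1..N} (\<lambda>r. hkp M T m (delta T r f))" if N: "N \<ge> 1"
  proof -
    have pos: "0 \<le> kernel m f 0 r" for r
      unfolding kernel_0 by (intro hkp_nonneg unit_fun_delta f)
    have "L \<le> (\<Sum>i<N. \<Sum>j<N. kernel m f 0 ((i - j) + (j - i))) / (real N)\<^sup>2"
      using L(3)[OF N] K_dist by simp
    also have "\<dots> \<le> (real N * kernel m f 0 0 + 2 * real N * (\<Sum>r=1..N. kernel m f 0 r)) / (real N)\<^sup>2"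
      by (intro divide_right_mono sum_dist_le pos) simp
    also have "\<dots> = kernel m f 0 0 / real N + 2 * mean {1..N} (\<lambda>r. kernel m f 0 r)"
      using N by (simp add: mean_real power2_eq_square field_simps)
    also have "\<dots> \<le> 1 / real N + 2 * mean {1..N} (\<lambda>r. kernel m f 0 r)"
      using bound[of 0 0] by (simp add: divide_right_mono)
    finally show ?thesis by (simp add: eq kernel_0 del: hkp.simps)
  qed
qed

text \<open>Iterates \<open>hkp_Suc_le\<close> with the same N in every coordinate. The numerator of
  the error obeys e' = 2 e + 1, hence 2^m - 1. The remaining k levels are left for a separate
  estimate.\<close>

lemma hkp_le_box:
  assumes "f \<in> unit_fun" and N: "N \<ge> 1"
  shows "hkp M T (m + k) f \<le> (2 ^ m - 1) / real N + 2 ^ m * mean (hbox m N) (\<lambda>h. hkp M T k (cube_prod T m (\<lambda>\<eta>. f) h))"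
  using assms(1)
proof (induction m arbitrary: f)
  case 0
  then show ?case by (simp add: hbox_0 mean_singleton cube_prod_def[abs_def] cube_0)
next
  case (Suc m)
  define X where "X = mean (hbox (Suc m) N) (\<lambda>h. hkp M T k (cube_prod T (Suc m) (\<lambda>\<eta>. f) h))"
  have "mean {1..N} (\<lambda>r. hkp M T (m + k) (delta T r f)) \<le>
    mean {1..N} (\<lambda>r. 2 ^ m * mean (hbox m N) (\<lambda>h. hkp M T k (cube_prod T m (\<lambda>\<eta>. delta T r f) h)) + (2 ^ m - 1) / real N)"
    by (rule mean_mono) (use Suc.IH[OF unit_fun_delta[OF Suc.prems]] in \<open>simp add: add.commute\<close>)
  also have "\<dots> \<le> 2 ^ m * X + (2 ^ m - 1) / real N"
    unfolding X_def mean_add mean_mult_left mean_hbox_Suc mean_swap[of "hbox m N"] cube_prod_delta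
    by (intro add_mono mean_const_le order_refl) auto
  finally have "1 / real N + 2 * mean {1..N} (\<lambda>r. hkp M T (m + k) (delta T r f))
      \<le> 1 / real N + 2 * (2 ^ m * X + (2 ^ m - 1) / real N)" by (rule add_left_mono[OF mult_left_mono]) simp
  also have "\<dots> = (2 ^ Suc m - 1) / real N + 2 ^ Suc m * X"
    by (simp add: diff_divide_distrib algebra_simps)
  finally show ?case
    using hkp_Suc_le[OF Suc.prems N, of "m + k"] unfolding X_def add_Suc by (rule order_trans[rotated])
qed

end

section \<open>Wiener--Wintner suprema and the second seminorm\<close>

definition ww :: "('a \<Rightarrow> 'a) \<Rightarrow> nat \<Rightarrow> ('a \<Rightarrow> complex) \<Rightarrow> 'a \<Rightarrow> real \<Rightarrow> real" where
  "ww T N F x t = cmod ((1 / of_nat N) *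
     (\<Sum>n=1..N. exp (2 * of_real pi * \<i> * of_nat n * of_real t) * F ((T ^^ n) x)))"

lemma WW_sup_eq: "WW_sup T N F x = (SUP t. ww T N F x t)"
  by (simp add: WW_sup_def ww_def)

lemma ww_le:
  assumes "\<And>n. n \<in> {1..N} \<Longrightarrow> cmod (F ((T ^^ n) x)) \<le> C" "0 \<le> C"
  shows "ww T N F x t \<le> C"
proof -
  have "cmod (\<Sum>n=1..N. exp (2 * of_real pi * \<i> * of_nat n * of_real t) * F ((T ^^ n) x)) \<le> (\<Sum>n=1..N. C)"
    by (rule order_trans[OF norm_sum sum_mono]) (simp add: norm_mult assms)
  then show ?thesis using assms(2) by (cases "N = 0") (auto simp: ww_def norm_divide norm_mult field_simps)
qed

lemma bdd_above_ww: "bdd_above (range (ww T N F x))"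
proof -
  have "ww T N F x t \<le> (\<Sum>n=1..N. cmod (F ((T ^^ n) x)))" for t
    by (rule ww_le) (auto intro!: member_le_sum sum_nonneg)
  then show ?thesis by (intro bdd_aboveI2)
qed

lemma ww_le_WW_sup: "ww T N F x t \<le> WW_sup T N F x"
  unfolding WW_sup_eq by (rule cSUP_upper[OF UNIV_I bdd_above_ww])

lemma WW_sup_nonneg: "0 \<le> WW_sup T N F x"
  by (rule order_trans[OF _ ww_le_WW_sup[of T N F x 0]]) (simp add: ww_def)

lemma WW_sup_le:
  assumes "\<And>n. n \<in> {1..N} \<Longrightarrow> cmod (F ((T ^^ n) x)) \<le> C" "0 \<le> C"
  shows "WW_sup T N F x \<le> C"
  unfolding WW_sup_eq by (rule cSUP_least) (auto intro!: ww_le assms)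

lemma cis_exp: "exp (2 * of_real pi * \<i> * of_nat n * of_real t) = cis (2 * pi * (real n * t))"
  by (simp add: cis_conv_exp mult_ac)

text \<open>Dropping one unimodular factor moves the range 1..N to 0..N-1, the form suited to a
  Fourier transform.\<close>

lemma ww_Suc:
  "ww T N F x t = cmod ((1 / of_nat N) * (\<Sum>n<N. F ((T ^^ Suc n) x) * cis (2 * pi * (real n * t))))"
proof -
  have "(\<Sum>n=1..N. exp (2 * of_real pi * \<i> * of_nat n * of_real t) * F ((T ^^ n) x))
     = (\<Sum>n<N. cis (2 * pi * t) * (F ((T ^^ Suc n) x) * cis (2 * pi * (real n * t))))"
    unfolding cis_exp One_nat_def sum.atLeast1_atMost_eq
  proof (rule sum.cong[OF refl])
    fix n
    have "cis (2 * pi * (real (Suc n) * t)) = cis (2 * pi * t) * cis (2 * pi * (real n * t))"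
      by (simp add: cis_mult algebra_simps)
    then show "cis (2 * pi * (real (Suc n) * t)) * F ((T ^^ Suc n) x)
        = cis (2 * pi * t) * (F ((T ^^ Suc n) x) * cis (2 * pi * (real n * t)))"
      by (simp only: mult_ac)
  qed
  then show ?thesis unfolding ww_def sum_distrib_left[symmetric] by (simp add: norm_mult norm_divide)
qed

section \<open>Finite Fourier transform\<close>

lemma cis_orthogonal:
  assumes "j < Q" "k < Q"
  shows "(\<Sum>r<Q. cis (2 * pi * (real r * (real j / real Q))) * cnj (cis (2 * pi * (real r * (real k / real Q)))))
    = (if j = k then of_nat Q else 0)"
proof -
  define z where "z = cis (2 * pi * ((real j - real k) / real Q))"
  have term_eq: "cis (2 * pi * (real r * (real j / real Q))) * cnj (cis (2 * pi * (real r * (real k / real Q)))) = z ^ r" for r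
    by (simp add: z_def Complex.DeMoivre cis_cnj cis_mult algebra_simps diff_divide_distrib)
  show ?thesis
  proof (cases "j = k")
    case True
    then have "z = 1" by (simp add: z_def)
    then show ?thesis unfolding term_eq using True by simp
  next
    case False
    have "z ^ Q = cis (2 * pi * real_of_int (int j - int k))"
      using assms by (simp add: z_def Complex.DeMoivre)
    then have zQ: "z ^ Q = 1" by (simp only: cis_multiple_2pi Ints_of_int)
    have "z \<noteq> 1"
    proof
      assume "z = 1"
      then have "cos (2 * pi * ((real j - real k) / real Q)) = 1" by (simp add: z_def complex_eq_iff)
      then obtain n :: int where n: "2 * pi * ((real j - real k) / real Q) = real_of_int n * 2 * pi"
        using cos_one_2pi_int by blast
      then have "2 * pi * ((real j - real k) / real Q) = 2 * pi * real_of_int n" by (simp only: mult_ac)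
      then have "(real j - real k) / real Q = real_of_int n" unfolding mult_cancel_left by simp
      then have "real j - real k = real_of_int n * real Q" using assms by (simp add: field_simps)
      then have "int j - int k = n * int Q" by (metis of_int_diff of_int_eq_iff of_int_mult of_int_of_nat_eq)
      then have "int Q dvd int j - int k" by simp
      then have "\<bar>int Q\<bar> \<le> \<bar>int j - int k\<bar>" using False by (intro dvd_imp_le_int) auto
      then show False using assms by linarith
    qed
    then show ?thesis unfolding term_eq using zQ False by (simp add: geometric_sum)
  qed
qed

lemma parseval:
  "(\<Sum>r<Q. (cmod (\<Sum>j<Q. z j * cis (2 * pi * (real r * (real j / real Q)))))\<^sup>2) = real Q * (\<Sum>j<Q. (cmod (z j))\<^sup>2)"
proof -
  let ?c = "\<lambda>r j. cis (2 * pi * (real r * (real j / real Q)))"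
  have "complex_of_real (\<Sum>r<Q. (cmod (\<Sum>j<Q. z j * ?c r j))\<^sup>2)
     = (\<Sum>r<Q. \<Sum>j<Q. \<Sum>k<Q. (z j * cnj (z k)) * (?c r j * cnj (?c r k)))"
    unfolding of_real_sum complex_norm_square by (simp add: sum_product mult_ac)
  also have "\<dots> = (\<Sum>j<Q. \<Sum>r<Q. \<Sum>k<Q. (z j * cnj (z k)) * (?c r j * cnj (?c r k)))"
    by (rule sum.swap)
  also have "\<dots> = (\<Sum>j<Q. \<Sum>k<Q. \<Sum>r<Q. (z j * cnj (z k)) * (?c r j * cnj (?c r k)))"
    by (rule sum.cong[OF refl], rule sum.swap)
  also have "\<dots> = (\<Sum>j<Q. \<Sum>k<Q. (z j * cnj (z k)) * (if j = k then of_nat Q else 0))"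
    unfolding sum_distrib_left[symmetric] by (intro sum.cong refl arg_cong2[where f = "(*)"] cis_orthogonal) auto
  also have "\<dots> = (\<Sum>j<Q. (z j * cnj (z j)) * of_nat Q)"
    by (intro sum.cong refl) (simp add: if_distrib sum.delta' cong: if_cong)
  also have "\<dots> = complex_of_real (real Q * (\<Sum>j<Q. (cmod (z j))\<^sup>2))"
    unfolding of_real_mult of_real_sum complex_norm_square by (simp add: sum_distrib_left mult_ac)
  finally show ?thesis unfolding of_real_eq_iff .
qed

lemma fourier_inversion:
  assumes "k < Q"
  shows "of_nat Q * c k = (\<Sum>j<Q. (\<Sum>m<Q. c m * cnj (cis (2 * pi * (real j * (real m / real Q)))))
     * cis (2 * pi * (real j * (real k / real Q))))"
proof -
  let ?c = "\<lambda>r j. cis (2 * pi * (real r * (real j / real Q)))"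
  have "(\<Sum>j<Q. (\<Sum>m<Q. c m * cnj (?c j m)) * ?c j k) = (\<Sum>j<Q. \<Sum>m<Q. c m * (?c j k * cnj (?c j m)))"
    unfolding sum_distrib_right by (rule sum.cong[OF refl])+ (simp only: mult_ac)
  also have "\<dots> = (\<Sum>m<Q. c m * (\<Sum>j<Q. ?c j k * cnj (?c j m)))"
    unfolding sum_distrib_left by (rule sum.swap)
  also have "\<dots> = (\<Sum>m<Q. c m * (if k = m then of_nat Q else 0))"
    using assms by (intro sum.cong refl arg_cong2[where f = "(*)"] cis_orthogonal) auto
  also have "\<dots> = of_nat Q * c k" using assms by (simp add: if_distrib sum.delta cong: if_cong)
  finally show ?thesis by simp
qed

text \<open>On the cyclic group of order \<open>2 N\<close> the Fourier transform of a correlation is a product of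
  two transforms: one is summed with Parseval, so only the other needs a uniform bound.\<close>

lemma correlation_le:
  assumes N: "N \<ge> 1" and c: "\<And>m. m < 2 * N \<Longrightarrow> cmod (c m) \<le> 1"
    and W: "\<And>t. cmod ((1 / of_nat N) * (\<Sum>n<N. b n * cis (2 * pi * (real n * t)))) \<le> W"
  shows "(\<Sum>r=1..N. (cmod ((1 / of_nat N) * (\<Sum>n<N. b n * cnj (c (n + r)))))\<^sup>2) \<le> 2 * real N * W\<^sup>2"
proof -
  \<comment> \<open>For n < N and r \<le> N the index n + r stays below 2 N, so correlations on the
    cyclic group do not wrap around.\<close>
  define Q where "Q = 2 * N"
  let ?c = "\<lambda>r j. cis (2 * pi * (real r * (real j / real Q)))"
  define C where "C j = (\<Sum>m<Q. c m * cnj (?c j m))" for j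
  define \<beta> where "\<beta> j = (1 / of_nat N) * (\<Sum>n<N. b n * cnj (?c j n))" for j
  have \<beta>: "cmod (\<beta> j) \<le> W" for j
    using W[of "- (real j / real Q)"] by (simp add: \<beta>_def cis_cnj mult_ac)
  have W0: "0 \<le> W" using \<beta>[of 0] norm_ge_zero order_trans by blast
  define y where "y r = (1 / of_nat N) * (\<Sum>n<N. b n * cnj (c (n + r)))" for r
  have cQ: "of_nat Q * c k = (\<Sum>j<Q. C j * ?c j k)" if "k < Q" for k
    unfolding C_def by (rule fourier_inversion[OF that])
  have y: "of_nat Q * cnj (y r) = (\<Sum>j<Q. (C j * cnj (\<beta> j)) * ?c r j)" if r: "r \<in> {1..N}" for r
  proof -
    have "of_nat Q * cnj (y r) = (1 / of_nat N) * (\<Sum>n<N. cnj (b n) * (of_nat Q * c (n + r)))"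
      by (simp add: y_def sum_distrib_left mult_ac)
    also have "\<dots> = (1 / of_nat N) * (\<Sum>n<N. cnj (b n) * (\<Sum>j<Q. C j * ?c j (n + r)))"
      by (intro arg_cong2[where f = "(*)"] sum.cong refl cQ) (use r in \<open>auto simp: Q_def\<close>)
    also have "\<dots> = (1 / of_nat N) * (\<Sum>n<N. \<Sum>j<Q. (C j * ?c r j) * (cnj (b n) * ?c j n))"
      unfolding sum_distrib_left
      by (rule sum.cong[OF refl])+ (simp add: cis_mult add_divide_distrib algebra_simps)
    also have "\<dots> = (1 / of_nat N) * (\<Sum>j<Q. \<Sum>n<N. (C j * ?c r j) * (cnj (b n) * ?c j n))"
      by (subst sum.swap) (rule refl)
    also have "\<dots> = (\<Sum>j<Q. (C j * cnj (\<beta> j)) * ?c r j)"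
    proof -
      have c\<beta>: "cnj (\<beta> j) = (1 / of_nat N) * (\<Sum>n<N. cnj (b n) * ?c j n)" for j by (simp add: \<beta>_def)
      show ?thesis
        unfolding c\<beta> sum_distrib_left sum_distrib_right by (rule sum.cong[OF refl])+ (simp only: mult_ac)
    qed
    finally show ?thesis .
  qed
  have Q0: "real Q > 0" using N by (simp add: Q_def)
  have "(real Q)\<^sup>2 * (\<Sum>r=1..N. (cmod (y r))\<^sup>2) = (\<Sum>r=1..N. (cmod (of_nat Q * cnj (y r)))\<^sup>2)"
    by (simp add: norm_mult power_mult_distrib sum_distrib_left)
  also have "\<dots> = (\<Sum>r=1..N. (cmod (\<Sum>j<Q. (C j * cnj (\<beta> j)) * ?c r j))\<^sup>2)"
    by (intro sum.cong refl) (use y in simp)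
  \<comment> \<open>Extending the sum to all residues r completes the transform of the products
    \<open>C j * cnj (\<beta> j)\<close>, to which Parseval applies.\<close>
  also have "\<dots> \<le> (\<Sum>r<Q. (cmod (\<Sum>j<Q. (C j * cnj (\<beta> j)) * ?c r j))\<^sup>2)"
    using N by (intro sum_mono2) (auto simp: Q_def)
  also have "\<dots> = real Q * (\<Sum>j<Q. (cmod (C j * cnj (\<beta> j)))\<^sup>2)" by (rule parseval)
  also have "\<dots> \<le> real Q * (\<Sum>j<Q. W\<^sup>2 * (cmod (cnj (C j)))\<^sup>2)"
  proof (intro mult_left_mono sum_mono)
    fix j
    have "(cmod (\<beta> j))\<^sup>2 \<le> W\<^sup>2" by (intro power_mono \<beta>) auto
    then have "(cmod (\<beta> j))\<^sup>2 * (cmod (C j))\<^sup>2 \<le> W\<^sup>2 * (cmod (C j))\<^sup>2" by (rule mult_right_mono) simp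
    then show "(cmod (C j * cnj (\<beta> j)))\<^sup>2 \<le> W\<^sup>2 * (cmod (cnj (C j)))\<^sup>2"
      by (simp add: norm_mult power_mult_distrib mult.commute)
  qed simp
  also have "(\<Sum>j<Q. W\<^sup>2 * (cmod (cnj (C j)))\<^sup>2) = W\<^sup>2 * (real Q * (\<Sum>m<Q. (cmod (cnj (c m)))\<^sup>2))"
    unfolding parseval[symmetric] by (simp add: C_def sum_distrib_left)
  also have "\<dots> \<le> W\<^sup>2 * (real Q * (\<Sum>m<Q. 1))"
    by (intro mult_left_mono sum_mono) (auto intro!: power_le_one c simp: Q_def)
  finally have "(real Q)\<^sup>2 * (\<Sum>r=1..N. (cmod (y r))\<^sup>2) \<le> (real Q)\<^sup>2 * (real Q * W\<^sup>2)"
    using Q0 by (simp add: power2_eq_square mult_ac)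
  then have "(\<Sum>r=1..N. (cmod (y r))\<^sup>2) \<le> real Q * W\<^sup>2"
    using Q0 by (simp add: mult_le_cancel_left)
  then show ?thesis by (simp add: y_def Q_def)
qed

context ergodic_system
begin

text \<open>Continuity in t reduces the supremum to rational t, hence to countably many measurable
  functions.\<close>

lemma WW_sup_measurable:
  assumes [measurable]: "F \<in> borel_measurable M"
  shows "WW_sup T N F \<in> borel_measurable M"
proof (rule borel_measurableI_greater)
  fix a :: real
  have "a < WW_sup T N F x \<longleftrightarrow> (\<exists>q::rat. a < ww T N F x (of_rat q))" for x
  proof
    assume "a < WW_sup T N F x"
    then obtain t where t: "a < ww T N F x t"
      unfolding WW_sup_eq by (subst (asm) less_cSUP_iff[OF _ bdd_above_ww]) auto
    have "continuous_on UNIV (ww T N F x)"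
      unfolding ww_def[abs_def] by (intro continuous_intros)
    then have "open {t. a < ww T N F x t}"
      by (intro open_Collect_less continuous_on_const)
    then obtain e where e: "e > 0" "\<And>s. dist s t < e \<Longrightarrow> a < ww T N F x s"
      using t unfolding open_dist by blast
    obtain q where "t < of_rat q" "of_rat q < t + e"
      using of_rat_dense[of t "t + e"] e(1) by auto
    then have "dist (of_rat q) t < e" by (simp add: dist_real_def)
    then show "\<exists>q::rat. a < ww T N F x (of_rat q)" using e(2) by blast
  next
    assume "\<exists>q::rat. a < ww T N F x (of_rat q)"
    then show "a < WW_sup T N F x" by (auto intro: less_le_trans[OF _ ww_le_WW_sup])
  qed
  then have "{x \<in> space M. a < WW_sup T N F x} = {x \<in> space M. \<exists>q::rat. a < ww T N F x (of_rat q)}" by simp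
  also have "\<dots> \<in> sets M" unfolding ww_def by measurable
  finally show "{x \<in> space M. a < WW_sup T N F x} \<in> sets M" .
qed

lemma WW_sup_le_1:
  assumes "F \<in> unit_fun"
  shows "AE x in M. WW_sup T N F x \<le> 1"
  using AE_orbit[OF unit_fun_AE[OF assms]] by eventually_elim (rule WW_sup_le, auto)

lemma L2norm_power2: "(L2norm M F)\<^sup>2 = (\<integral>x. (F x)\<^sup>2 \<partial>M)"
  by (simp add: L2norm_def)

lemma integrable_WW_sup_power2:
  assumes "F \<in> unit_fun"
  shows "integrable M (\<lambda>x. (WW_sup T N F x)\<^sup>2)"
proof (rule integrable_const_bound[of _ 1])
  show "AE x in M. norm ((WW_sup T N F x)\<^sup>2) \<le> 1"
    using WW_sup_le_1[OF assms, of N] by eventually_elim (simp add: power_le_one WW_sup_nonneg)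
qed (intro borel_measurable_power WW_sup_measurable unit_funD assms)

lemma norm_integral_power2_le:
  assumes g: "g \<in> unit_fun"
  shows "(cmod (\<integral>x. g x \<partial>M))\<^sup>2 \<le> (\<integral>x. (cmod (g x))\<^sup>2 \<partial>M)"
proof -
  have [measurable]: "g \<in> borel_measurable M" using g by (rule unit_funD)
  have int: "integrable M (\<lambda>x. cmod (g x))" using unit_fun_integrable[OF g] by simp
  have int2: "integrable M (\<lambda>x. (cmod (g x))\<^sup>2)"
  proof (rule integrable_const_bound[of _ 1])
    show "AE x in M. norm ((cmod (g x))\<^sup>2) \<le> 1"
      using unit_fun_AE[OF g] by eventually_elim (simp add: power_le_one)
  qed measurable
  have "(cmod (\<integral>x. g x \<partial>M))\<^sup>2 \<le> (\<integral>x. cmod (g x) \<partial>M)\<^sup>2"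
    by (intro power_mono integral_norm_bound) simp
  also have "\<dots> \<le> (\<integral>x. (cmod (g x))\<^sup>2 \<partial>M)"
    using variance_positive[of "\<lambda>x. cmod (g x)"] variance_eq[OF int int2] by simp
  finally show ?thesis .
qed

lemma unit_fun_average:
  assumes "\<And>i. g i \<in> unit_fun"
  shows "(\<lambda>x. (1 / of_nat N) * (\<Sum>n<N. g n x)) \<in> unit_fun"
proof -
  have m: "g i \<in> borel_measurable M" for i using assms by (rule unit_funD)
  have "AE x in M. \<forall>i. cmod (g i x) \<le> 1" unfolding AE_all_countable using assms unit_fun_AE by blast
  then have "AE x in M. cmod ((1 / of_nat N) * (\<Sum>n<N. g n x)) \<le> 1"
  proof eventually_elim
    case (elim x)
    have "cmod (\<Sum>n<N. g n x) \<le> (\<Sum>n<N. 1)" by (rule order_trans[OF norm_sum sum_mono]) (use elim in simp)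
    then show ?case by (cases "N = 0") (auto simp: norm_divide field_simps)
  qed
  then show ?thesis unfolding unit_fun_def using m by auto
qed

text \<open>By invariance the integral of \<open>delta T r F\<close> equals that of its orbit
  average \<open>y r\<close>, so its square is at most the integral of |y r|^2. Pointwise,
  \<open>correlation_le\<close> bounds the sum of these squares over r \<le> N by the supremum;
  \<open>hkp_Suc_le\<close> doubles its constant 2.\<close>

lemma hkp_1_le:
  assumes F: "F \<in> unit_fun" and N: "N \<ge> 1"
  shows "hkp M T 1 F \<le> 1 / real N + 4 * (L2norm M (WW_sup T N F))\<^sup>2"
proof -
  define y where "y r x = (1 / of_nat N) * (\<Sum>n<N. delta T r F ((T ^^ Suc n) x))" for r x
  have y_unit: "y r \<in> unit_fun" for r
    unfolding y_def[abs_def] by (intro unit_fun_average unit_fun_iter unit_fun_delta F)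
  have [measurable]: "y r \<in> borel_measurable M" for r using y_unit by (rule unit_funD)
  have int2: "integrable M (\<lambda>x. (cmod (y r x))\<^sup>2)" for r
  proof (rule integrable_const_bound[of _ 1])
    show "AE x in M. norm ((cmod (y r x))\<^sup>2) \<le> 1"
      using unit_fun_AE[OF y_unit[of r]] by eventually_elim (simp add: power_le_one)
  qed measurable
  have "hkp M T 0 (delta T r F) \<le> (\<integral>x. (cmod (y r x))\<^sup>2 \<partial>M)" for r
  proof -
    have d: "delta T r F \<in> unit_fun" by (rule unit_fun_delta[OF F])
    have "(\<integral>x. y r x \<partial>M) = (1 / of_nat N) * (\<Sum>n<N. \<integral>x. delta T r F ((T ^^ Suc n) x) \<partial>M)"
      unfolding y_def
      by (subst integral_mult_right_zero, subst Bochner_Integration.integral_sum)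
        (intro unit_fun_integrable unit_fun_iter d, rule refl)
    also have "\<dots> = (\<integral>x. delta T r F x \<partial>M)"
      unfolding integral_iter[OF unit_funD[OF d]] using N by simp
    finally show ?thesis using norm_integral_power2_le[OF y_unit, of r] by simp
  qed
  then have "(\<Sum>r=1..N. hkp M T 0 (delta T r F)) \<le> (\<Sum>r=1..N. \<integral>x. (cmod (y r x))\<^sup>2 \<partial>M)"
    by (intro sum_mono)
  also have "\<dots> = (\<integral>x. (\<Sum>r=1..N. (cmod (y r x))\<^sup>2) \<partial>M)"
    using int2 by (simp add: Bochner_Integration.integral_sum)
  also have "\<dots> \<le> (\<integral>x. 2 * real N * (WW_sup T N F x)\<^sup>2 \<partial>M)"
  proof (rule integral_mono_AE)
    show "integrable M (\<lambda>x. \<Sum>r=1..N. (cmod (y r x))\<^sup>2)" using int2 by simp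
    show "integrable M (\<lambda>x. 2 * real N * (WW_sup T N F x)\<^sup>2)" using integrable_WW_sup_power2[OF F] by simp
    show "AE x in M. (\<Sum>r=1..N. (cmod (y r x))\<^sup>2) \<le> 2 * real N * (WW_sup T N F x)\<^sup>2"
      using AE_orbit[OF unit_fun_AE[OF F]]
    proof eventually_elim
      case (elim x)
      have "(T ^^ r) ((T ^^ Suc n) x) = (T ^^ Suc (n + r)) x" for n r
        by (metis add.commute add_Suc comp_apply funpow_add)
      then have y: "y r x = (1 / of_nat N) * (\<Sum>n<N. F ((T ^^ Suc n) x) * cnj (F ((T ^^ Suc (n + r)) x)))" for r
        unfolding y_def delta_def by simp
      show ?case unfolding y
        by (rule correlation_le[OF N, where b = "\<lambda>n. F ((T ^^ Suc n) x)" and c = "\<lambda>n. F ((T ^^ Suc n) x)"])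
          (use elim in blast, unfold ww_Suc[symmetric], rule ww_le_WW_sup)
    qed
  qed
  also have "\<dots> = 2 * real N * (L2norm M (WW_sup T N F))\<^sup>2" by (simp add: L2norm_power2)
  finally have "mean {1..N} (\<lambda>r. hkp M T 0 (delta T r F)) \<le> 2 * (L2norm M (WW_sup T N F))\<^sup>2"
    using N by (simp add: mean_real field_simps del: hkp.simps)
  then show ?thesis using hkp_Suc_le[OF F N, of 0] by (simp del: hkp.simps)
qed

text \<open>The side K of the box and the length N of the averages are independent, so that one
  bound covers boxes of side N and of side \<lfloor>sqrt N\<rfloor>.\<close>

lemma hkp_le_norm_average:
  assumes f: "f \<in> unit_fun" and MN: "K \<ge> 1" "N \<ge> 1"
  shows "hkp M T (Suc d) f \<le> 2 ^ d / real K + 2 ^ d / real N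
    + 4 * 2 ^ d * mean (hbox d K) (\<lambda>h. (L2norm M (WW_sup T N (cube_prod T d (\<lambda>\<eta>. f) h)))\<^sup>2)"
proof -
  have "hkp M T (d + 1) f \<le> (2 ^ d - 1) / real K + 2 ^ d * mean (hbox d K) (\<lambda>h. hkp M T 1 (cube_prod T d (\<lambda>\<eta>. f) h))"
    by (rule hkp_le_box[OF f MN(1)])
  also have "\<dots> \<le> 2 ^ d / real K + 2 ^ d * (1 / real N + 4 * mean (hbox d K) (\<lambda>h. (L2norm M (WW_sup T N (cube_prod T d (\<lambda>\<eta>. f) h)))\<^sup>2))"
  proof (intro add_mono mult_left_mono)
    have "mean (hbox d K) (\<lambda>h. hkp M T 1 (cube_prod T d (\<lambda>\<eta>. f) h))
      \<le> mean (hbox d K) (\<lambda>h. 1 / real N + 4 * (L2norm M (WW_sup T N (cube_prod T d (\<lambda>\<eta>. f) h)))\<^sup>2)"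
      by (intro mean_mono hkp_1_le unit_fun_cube_prod f MN)
    also have "\<dots> \<le> 1 / real N + 4 * mean (hbox d K) (\<lambda>h. (L2norm M (WW_sup T N (cube_prod T d (\<lambda>\<eta>. f) h)))\<^sup>2)"
      unfolding mean_add mean_mult_left[where c = 4] by (intro add_mono mean_const_le order_refl) auto
    finally show "mean (hbox d K) (\<lambda>h. hkp M T 1 (cube_prod T d (\<lambda>\<eta>. f) h))
      \<le> 1 / real N + 4 * mean (hbox d K) (\<lambda>h. (L2norm M (WW_sup T N (cube_prod T d (\<lambda>\<eta>. f) h)))\<^sup>2)" .
  qed (auto intro: divide_right_mono)
  finally show ?thesis by (simp add: algebra_simps del: hkp.simps)
qed

end

section \<open>Limits along generic orbits\<close>

lemma add_power_le:
  fixes x y z :: real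
  assumes "0 \<le> x" "0 \<le> y" "0 \<le> z"
  shows "(x + y + z) ^ p \<le> 3 ^ p * (x ^ p + y ^ p + z ^ p)"
proof -
  define m where "m = max x (max y z)"
  have "(x + y + z) ^ p \<le> (3 * m) ^ p" using assms by (intro power_mono) (auto simp: m_def)
  also have "\<dots> = 3 ^ p * m ^ p" by (simp add: power_mult_distrib)
  also have "m ^ p \<le> x ^ p + y ^ p + z ^ p"
    using zero_le_power[OF assms(1), of p] zero_le_power[OF assms(2), of p] zero_le_power[OF assms(3), of p]
    by (auto simp: m_def max_def)
  finally show ?thesis by simp
qed

lemma cube_prod_0: "cube_prod T 0 g h x = g (\<lambda>_. undefined) x"
  by (simp add: cube_prod_def cube_0)

lemma cnj_pow_0: "(cnj ^^ m) 0 = 0"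
  by (induction m) auto

lemma null_squeeze:
  fixes X Y :: "nat \<Rightarrow> real"
  assumes "\<And>N. 0 \<le> X N" "\<And>N. X N \<le> Y N" "Y \<longlonglongrightarrow> 0"
  shows "X \<longlonglongrightarrow> 0"
  by (rule tendsto_sandwich[OF _ _ tendsto_const assms(3)]) (simp_all add: assms)

text \<open>One differencing step in the limit; the exponent \<open>2\<^sup>j\<close> lets the bound for each
  difference be averaged with the power mean inequality.\<close>

lemma differencing_step:
  fixes X :: "nat \<Rightarrow> real" and Y c :: "nat \<Rightarrow> nat \<Rightarrow> real"
  assumes X0: "\<And>N. 0 \<le> X N" and Y0: "\<And>r N. 0 \<le> Y r N" and c0: "\<And>H N. 0 \<le> c H N"
    and ab: "0 \<le> a" "0 \<le> b"
    and bnd: "\<And>H. H \<ge> 1 \<Longrightarrow> \<forall>\<^sub>F N in sequentially. X N \<le> a / real H + b * mean {1..H} (\<lambda>r. Y r N) + c H N"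
    and c: "\<And>H. c H \<longlonglongrightarrow> 0"
    and Y: "\<And>r e. 0 < e \<Longrightarrow> \<forall>\<^sub>F N in sequentially. Y r N ^ (2 ^ j) \<le> C * \<pi> r + e"
    and \<pi>: "(\<lambda>H. mean {1..H} \<pi>) \<longlonglongrightarrow> P"
    and e: "0 < e"
  shows "\<forall>\<^sub>F N in sequentially. X N ^ (2 ^ j) \<le> ((3 * b) ^ (2 ^ j) * C) * P + e"
proof -
  define p :: nat where "p = 2 ^ j"
  have p: "p > 0" by (simp add: p_def)
  define D where "D = (3 * b) ^ p"
  have D: "0 \<le> D" using ab by (simp add: D_def)
  have "(\<lambda>H. 3 ^ p * (a / real H) ^ p) \<longlonglongrightarrow> 3 ^ p * 0 ^ p"
    by (intro tendsto_intros lim_const_over_n)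
  then have "\<forall>\<^sub>F H in sequentially. 3 ^ p * (a / real H) ^ p < e / 4"
    by (rule order_tendstoD) (use e p in \<open>simp add: power_0_left\<close>)
  moreover have "(\<lambda>H. D * C * mean {1..H} \<pi>) \<longlonglongrightarrow> D * C * P" by (intro tendsto_intros \<pi>)
  then have "\<forall>\<^sub>F H in sequentially. D * C * mean {1..H} \<pi> < D * C * P + e / 4"
    using e by (intro order_tendstoD) auto
  ultimately have "\<forall>\<^sub>F H in sequentially. H \<ge> 1 \<and> 3 ^ p * (a / real H) ^ p < e / 4 \<and> D * C * mean {1..H} \<pi> < D * C * P + e / 4"
    using eventually_ge_at_top[of 1] by eventually_elim simp
  \<comment> \<open>H is fixed before N. The four sources of error, namely a / H, the average of
    \<pi>, the slack \<delta> in the bounds for Y, and c, get e / 4 each.\<close>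
  then obtain H where H: "H \<ge> 1" "3 ^ p * (a / real H) ^ p < e / 4" "D * C * mean {1..H} \<pi> < D * C * P + e / 4"
    by (auto simp: eventually_sequentially)
  define \<delta> where "\<delta> = e / (4 * (D + 1))"
  have \<delta>: "\<delta> > 0" "D * \<delta> \<le> e / 4" using e D by (auto simp: \<delta>_def field_simps)
  have "\<forall>\<^sub>F N in sequentially. \<forall>r\<in>{1..H}. Y r N ^ p \<le> C * \<pi> r + \<delta>"
    using Y[OF \<delta>(1)] by (intro eventually_ball_finite) (auto simp: p_def)
  moreover have "(\<lambda>N. 3 ^ p * c H N ^ p) \<longlonglongrightarrow> 3 ^ p * 0 ^ p" by (intro tendsto_intros c)
  then have "\<forall>\<^sub>F N in sequentially. 3 ^ p * c H N ^ p < e / 4"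
    by (rule order_tendstoD) (use e p in \<open>simp add: power_0_left\<close>)
  ultimately have "\<forall>\<^sub>F N in sequentially. X N ^ p \<le> D * C * P + e"
    using bnd[OF H(1)]
  proof eventually_elim
    case (elim N)
    have mY: "0 \<le> mean {1..H} (\<lambda>r. Y r N)" by (intro mean_nonneg Y0)
    have "X N ^ p \<le> (a / real H + b * mean {1..H} (\<lambda>r. Y r N) + c H N) ^ p"
      by (intro power_mono elim X0)
    also have "\<dots> \<le> 3 ^ p * ((a / real H) ^ p + (b * mean {1..H} (\<lambda>r. Y r N)) ^ p + c H N ^ p)"
      using ab c0 mY by (intro add_power_le) auto
    also have "\<dots> = 3 ^ p * (a / real H) ^ p + D * mean {1..H} (\<lambda>r. Y r N) ^ p + 3 ^ p * c H N ^ p"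
      by (simp add: D_def power_mult_distrib algebra_simps)
    also have "mean {1..H} (\<lambda>r. Y r N) ^ p \<le> mean {1..H} (\<lambda>r. Y r N ^ p)"
      unfolding p_def by (intro mean_power_pow2_le Y0)
    also have "\<dots> \<le> mean {1..H} (\<lambda>r. C * \<pi> r + \<delta>)"
      using elim(1) by (intro mean_mono) auto
    also have "\<dots> = C * mean {1..H} \<pi> + \<delta>"
      unfolding mean_add mean_mult_left using H by (simp add: mean_const)
    finally have "X N ^ p \<le> 3 ^ p * (a / real H) ^ p + D * (C * mean {1..H} \<pi> + \<delta>) + 3 ^ p * c H N ^ p"
      using D by (simp add: mult_left_mono)
    then show ?case using H \<delta> elim(2) by (simp add: algebra_simps)
  qed
  then show ?thesis by (simp add: p_def D_def)
qed

section \<open>Orbit segments on cyclic groups, and generic points\<close>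

definition wrap :: "nat \<Rightarrow> nat \<Rightarrow> (nat \<Rightarrow> complex) \<Rightarrow> int \<Rightarrow> complex" where
  "wrap Q L a n = (if nat (n mod int Q) < L then a (nat (n mod int Q)) else 0)"

lemma periodic_wrap: "periodic Q (wrap Q L a)"
  by (simp add: periodic_def wrap_def)

lemma norm_wrap_le: "(\<And>m. cmod (a m) \<le> 1) \<Longrightarrow> cmod (wrap Q L a n) \<le> 1"
  by (simp add: wrap_def)

lemma wrap_small: "m < Q \<Longrightarrow> wrap Q L a (int m) = (if m < L then a m else 0)"
  by (simp add: wrap_def flip: of_nat_mod)

lemma norm_mult_cnj_diff:
  fixes a b c d :: complex
  assumes "cmod b \<le> 1" "cmod c \<le> 1"
  shows "cmod (a * cnj b - c * cnj d) \<le> cmod (a - c) + cmod (b - d)"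
proof -
  have "a * cnj b - c * cnj d = (a - c) * cnj b + c * cnj (b - d)" by (simp add: algebra_simps)
  also have "cmod \<dots> \<le> cmod ((a - c) * cnj b) + cmod (c * cnj (b - d))" by (rule norm_triangle_ineq)
  also have "\<dots> \<le> cmod (a - c) + cmod (b - d)"
    unfolding norm_mult complex_mod_cnj
    by (intro add_mono mult_right_le_one_le mult_left_le_one_le assms) auto
  finally show ?thesis .
qed

text \<open>Differencing and wrapping commute except at the last r positions of the segment, where
  the two differ by at most 2.\<close>

lemma zdelta_wrap_diff:
  assumes a: "\<And>m. cmod (a m) \<le> 1" and LQ: "L \<le> Q"
  shows "mean (cyc Q) (\<lambda>n. cmod (zdelta r (wrap Q L a) n - wrap Q L (\<lambda>m. a m * cnj (a (m + r))) n)) \<le> 2 * real r / real Q"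
proof -
  let ?D = "\<lambda>n. cmod (zdelta r (wrap Q L a) n - wrap Q L (\<lambda>m. a m * cnj (a (m + r))) n)"
  have zero: "?D (int m) = 0" if "m < Q" "m \<notin> {L - r..<L}" for m
  proof (cases "m < L")
    case True
    then have "m + r < L" using that by auto
    then have "wrap Q L a (int m + int r) = a (m + r)"
      using wrap_small[of "m + r" Q L a] LQ by simp
    then show ?thesis using True that by (simp add: zdelta_def wrap_small)
  next
    case False
    then show ?thesis using that by (simp add: zdelta_def wrap_small)
  qed
  have two: "?D n \<le> 2" for n
  proof -
    have "cmod (zdelta r (wrap Q L a) n) \<le> 1" by (intro norm_zdelta_le norm_wrap_le a)
    moreover have "cmod (wrap Q L (\<lambda>m. a m * cnj (a (m + r))) n) \<le> 1"
      by (intro norm_wrap_le) (simp add: norm_mult a mult_le_one)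
    ultimately show ?thesis using norm_triangle_ineq4[of "zdelta r (wrap Q L a) n" "wrap Q L (\<lambda>m. a m * cnj (a (m + r))) n"]
      by linarith
  qed
  have "(\<Sum>m<Q. ?D (int m)) = (\<Sum>m\<in>{L - r..<L}. ?D (int m))"
    using zero LQ by (intro sum.mono_neutral_right) auto
  also have "\<dots> \<le> real (card {L - r..<L}) * 2" by (intro sum_bounded_above two)
  also have "\<dots> \<le> 2 * real r" by simp
  finally show ?thesis unfolding mean_cyc_nat by (simp add: mean_real divide_right_mono)
qed

context ergodic_system
begin

text \<open>Lists of shifts are countable, so almost every point is generic for a given function.
  Quantifying over all lists makes the notion stable under \<open>delta\<close>, which the induction
  on the dimension needs.\<close>

definition generic :: "'a \<Rightarrow> ('a \<Rightarrow> complex) \<Rightarrow> bool" where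
  "generic x \<phi> \<longleftrightarrow> (\<forall>n. cmod (\<phi> ((T ^^ n) x)) \<le> 1) \<and>
     (\<forall>rs. (\<lambda>N. (1 / of_nat N) * (\<Sum>i<N. fold (delta T) rs \<phi> ((T ^^ Suc i) x))) \<longlonglongrightarrow> (\<integral>y. fold (delta T) rs \<phi> y \<partial>M))"

lemma generic_bound: "generic x \<phi> \<Longrightarrow> cmod (\<phi> ((T ^^ n) x)) \<le> 1"
  by (simp add: generic_def)

lemma generic_delta:
  assumes "generic x \<phi>"
  shows "generic x (delta T r \<phi>)"
  unfolding generic_def
proof (intro conjI allI)
  show "cmod (delta T r \<phi> ((T ^^ n) x)) \<le> 1" for n
    using generic_bound[OF assms, of n] generic_bound[OF assms, of "r + n"]
    by (simp add: delta_def norm_mult mult_le_one funpow_add)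
  show "(\<lambda>N. (1 / of_nat N) * (\<Sum>i<N. fold (delta T) rs (delta T r \<phi>) ((T ^^ Suc i) x)))
      \<longlonglongrightarrow> (\<integral>y. fold (delta T) rs (delta T r \<phi>) y \<partial>M)" for rs
    using assms unfolding generic_def by (auto dest: spec[of _ "r # rs"])
qed

lemma unit_fun_fold_delta: "\<phi> \<in> unit_fun \<Longrightarrow> fold (delta T) rs \<phi> \<in> unit_fun"
  by (induction rs arbitrary: \<phi>) (auto intro: unit_fun_delta)

lemma AE_generic:
  assumes \<phi>: "\<phi> \<in> unit_fun"
  shows "AE x in M. generic x \<phi>"
proof -
  have "AE x in M. \<forall>rs. (\<lambda>N. (1 / of_nat N) * (\<Sum>i<N. fold (delta T) rs \<phi> ((T ^^ Suc i) x)))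
      \<longlonglongrightarrow> (\<integral>y. fold (delta T) rs \<phi> y \<partial>M)"
    unfolding AE_all_countable
    by (intro allI birkhoff[where C = 1] unit_funD unit_fun_AE unit_fun_fold_delta \<phi>)
  then show ?thesis
    using AE_orbit[OF unit_fun_AE[OF \<phi>]] by eventually_elim (simp add: generic_def)
qed

end

text \<open>A single point and its scales: period Q, length L of the orbit segment, side K of the
  box. Genericity is assumed function by function, so the estimates along the orbit are
  deterministic and null sets enter only at the end.\<close>

locale orbit_model = ergodic_system +
  fixes x :: 'a and Q L K :: "nat \<Rightarrow> nat"
  assumes LQ: "L N \<le> Q N"
    and Q_lim: "filterlim Q at_top sequentially"
    and L_lim: "filterlim L at_top sequentially"
    and K_lim: "filterlim K at_top sequentially"
begin

definition orb :: "('a \<Rightarrow> complex) \<Rightarrow> nat \<Rightarrow> complex" where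
  "orb \<phi> m = \<phi> ((T ^^ Suc m) x)"

text \<open>Closeness in mean rather than equality, because each differencing disturbs a wrapped
  segment at a bounded number of places per period. Closeness survives any fixed number of
  differencings.\<close>

definition model :: "(nat \<Rightarrow> int \<Rightarrow> complex) \<Rightarrow> ('a \<Rightarrow> complex) \<Rightarrow> bool" where
  "model u \<phi> \<longleftrightarrow> (\<lambda>N. mean (cyc (Q N)) (\<lambda>n. cmod (u N n - wrap (Q N) (L N) (orb \<phi>) n))) \<longlonglongrightarrow> 0"

lemma over_Q: "(\<lambda>N. c / real (Q N)) \<longlonglongrightarrow> 0"
  by (intro real_tendsto_divide_at_top[OF tendsto_const] filterlim_compose[OF filterlim_real_sequentially Q_lim])

lemma over_K: "(\<lambda>N. c / real (K N)) \<longlonglongrightarrow> 0"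
  by (intro real_tendsto_divide_at_top[OF tendsto_const] filterlim_compose[OF filterlim_real_sequentially K_lim])

lemma orb_delta: "orb (delta T r \<phi>) = (\<lambda>m. orb \<phi> m * cnj (orb \<phi> (m + r)))"
proof
  fix m
  have "(T ^^ r) ((T ^^ Suc m) x) = (T ^^ Suc (m + r)) x"
    by (metis add.commute add_Suc comp_apply funpow_add)
  then show "orb (delta T r \<phi>) m = orb \<phi> m * cnj (orb \<phi> (m + r))"
    by (simp add: orb_def delta_def)
qed

lemma norm_orb_le: "generic x \<phi> \<Longrightarrow> cmod (orb \<phi> m) \<le> 1"
  unfolding orb_def by (rule generic_bound)

lemma model_zdelta:
  assumes m: "model u \<phi>" and g: "generic x \<phi>"
    and per: "\<And>N. periodic (Q N) (u N)" and b: "\<And>N n. cmod (u N n) \<le> 1"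
  shows "model (\<lambda>N. zdelta r (u N)) (delta T r \<phi>)"
proof -
  define w where "w N = wrap (Q N) (L N) (orb \<phi>)" for N
  define E where "E N = mean (cyc (Q N)) (\<lambda>n. cmod (u N n - w N n))" for N
  have "mean (cyc (Q N)) (\<lambda>n. cmod (zdelta r (u N) n - wrap (Q N) (L N) (orb (delta T r \<phi>)) n))
      \<le> 2 * E N + 2 * real r / real (Q N)" for N
  proof -
    have perd: "periodic (Q N) (\<lambda>n. cmod (u N n - w N n))"
      using per[of N] periodic_wrap[of "Q N" "L N" "orb \<phi>"] by (simp add: periodic_def w_def)
    have "cmod (zdelta r (u N) n - wrap (Q N) (L N) (orb (delta T r \<phi>)) n)
        \<le> (cmod (u N n - w N n) + cmod (u N (n + int r) - w N (n + int r)))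
          + cmod (zdelta r (w N) n - wrap (Q N) (L N) (orb (delta T r \<phi>)) n)" for n
    proof -
      have "cmod (zdelta r (u N) n - zdelta r (w N) n) \<le> cmod (u N n - w N n) + cmod (u N (n + int r) - w N (n + int r))"
        unfolding zdelta_def by (intro norm_mult_cnj_diff b) (simp add: w_def norm_wrap_le norm_orb_le[OF g])
      then show ?thesis
        using norm_triangle_ineq[of "zdelta r (u N) n - zdelta r (w N) n" "zdelta r (w N) n - wrap (Q N) (L N) (orb (delta T r \<phi>)) n"]
        by simp
    qed
    then have "mean (cyc (Q N)) (\<lambda>n. cmod (zdelta r (u N) n - wrap (Q N) (L N) (orb (delta T r \<phi>)) n))
      \<le> mean (cyc (Q N)) (\<lambda>n. (cmod (u N n - w N n) + cmod (u N (n + int r) - w N (n + int r)))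
          + cmod (zdelta r (w N) n - wrap (Q N) (L N) (orb (delta T r \<phi>)) n))"
      by (intro mean_mono)
    also have "\<dots> = E N + E N + mean (cyc (Q N)) (\<lambda>n. cmod (zdelta r (w N) n - wrap (Q N) (L N) (orb (delta T r \<phi>)) n))"
      unfolding mean_add E_def mean_cyc_shift[OF perd] ..
    also have "\<dots> \<le> E N + E N + 2 * real r / real (Q N)"
      unfolding w_def orb_delta by (intro add_left_mono zdelta_wrap_diff norm_orb_le[OF g] LQ)
    finally show ?thesis by simp
  qed
  moreover have "(\<lambda>N. 2 * E N + 2 * real r / real (Q N)) \<longlonglongrightarrow> 2 * 0 + 0"
    using m unfolding model_def E_def w_def by (intro tendsto_add tendsto_mult tendsto_const over_Q)
  then have "(\<lambda>N. 2 * E N + 2 * real r / real (Q N)) \<longlonglongrightarrow> 0" by simp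
  ultimately show ?thesis
    unfolding model_def by (rule null_squeeze[rotated]) (simp add: mean_nonneg)
qed

text \<open>The mean of the wrapped segment over a period is L / Q times a Birkhoff average of
  length L.\<close>

lemma model_mean:
  assumes m: "model u \<phi>" and g: "generic x \<phi>"
  shows "(\<lambda>N. mean (cyc (Q N)) (u N) - of_real (real (L N) / real (Q N)) * (\<integral>y. \<phi> y \<partial>M)) \<longlonglongrightarrow> 0"
proof -
  define A where "A N = (1 / of_nat N) * (\<Sum>i<N. \<phi> ((T ^^ Suc i) x))" for N
  have A: "A \<longlonglongrightarrow> (\<integral>y. \<phi> y \<partial>M)"
    using g unfolding generic_def A_def[abs_def] by (auto dest: spec[of _ "[]"])
  have mw: "mean (cyc (Q N)) (wrap (Q N) (L N) (orb \<phi>)) = of_real (real (L N) / real (Q N)) * A (L N)" for N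
  proof -
    have "(\<Sum>n<Q N. wrap (Q N) (L N) (orb \<phi>) (int n)) = (\<Sum>n<Q N. if n < L N then orb \<phi> n else 0)"
      by (intro sum.cong refl) (simp add: wrap_small)
    also have "\<dots> = (\<Sum>n<L N. orb \<phi> n)"
      using LQ[of N] by (intro sum.mono_neutral_cong_right) auto
    finally show ?thesis
      unfolding mean_cyc_nat by (simp add: mean_def A_def orb_def scaleR_conv_of_real)
  qed
  have "cmod (mean (cyc (Q N)) (u N) - of_real (real (L N) / real (Q N)) * (\<integral>y. \<phi> y \<partial>M))
      \<le> mean (cyc (Q N)) (\<lambda>n. cmod (u N n - wrap (Q N) (L N) (orb \<phi>) n)) + cmod (A (L N) - (\<integral>y. \<phi> y \<partial>M))" for N
  proof -
    have "cmod (mean (cyc (Q N)) (u N) - mean (cyc (Q N)) (wrap (Q N) (L N) (orb \<phi>)))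
      \<le> mean (cyc (Q N)) (\<lambda>n. cmod (u N n - wrap (Q N) (L N) (orb \<phi>) n))" by (rule mean_norm_diff)
    moreover have "cmod (of_real (real (L N) / real (Q N)) * A (L N) - of_real (real (L N) / real (Q N)) * (\<integral>y. \<phi> y \<partial>M))
        \<le> cmod (A (L N) - (\<integral>y. \<phi> y \<partial>M))"
      unfolding right_diff_distrib[symmetric] norm_mult
      by (rule mult_left_le_one_le) (use LQ[of N] in \<open>auto simp: divide_le_eq_1 norm_divide\<close>)
    ultimately show ?thesis
      unfolding mw
      using norm_triangle_ineq[of "mean (cyc (Q N)) (u N) - of_real (real (L N) / real (Q N)) * A (L N)"
          "of_real (real (L N) / real (Q N)) * A (L N) - of_real (real (L N) / real (Q N)) * (\<integral>y. \<phi> y \<partial>M)"] by simp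
  qed
  moreover have "(\<lambda>N. mean (cyc (Q N)) (\<lambda>n. cmod (u N n - wrap (Q N) (L N) (orb \<phi>) n)) + cmod (A (L N) - (\<integral>y. \<phi> y \<partial>M))) \<longlonglongrightarrow> 0"
  proof (rule tendsto_add_zero)
    show "(\<lambda>N. cmod (A (L N) - (\<integral>y. \<phi> y \<partial>M))) \<longlonglongrightarrow> 0"
      by (rule tendsto_norm_zero[OF LIM_zero[OF filterlim_compose[OF A L_lim]]])
  qed (use m in \<open>simp add: model_def\<close>)
  ultimately have "(\<lambda>N. cmod (mean (cyc (Q N)) (u N) - of_real (real (L N) / real (Q N)) * (\<integral>y. \<phi> y \<partial>M))) \<longlonglongrightarrow> 0"
    by (rule null_squeeze[OF norm_ge_zero])
  then show ?thesis by (rule tendsto_norm_zero_cancel)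
qed

text \<open>Birkhoff's theorem inside the square, with dominated convergence; ergodicity makes the
  limit function constant.\<close>

lemma window_tendsto:
  assumes \<phi>: "\<phi> \<in> unit_fun"
  shows "(\<lambda>H. \<integral>y. (cmod (mean {..<H} (\<lambda>l. \<phi> ((T ^^ Suc l) y))))\<^sup>2 \<partial>M) \<longlonglongrightarrow> (cmod (\<integral>y. \<phi> y \<partial>M))\<^sup>2"
proof -
  have w: "(\<lambda>y. mean {..<H} (\<lambda>l. \<phi> ((T ^^ Suc l) y))) \<in> unit_fun" for H
  proof -
    have "(\<lambda>y. (1 / of_nat H) * (\<Sum>l<H. \<phi> ((T ^^ Suc l) y))) \<in> unit_fun"
      by (intro unit_fun_average unit_fun_iter \<phi>)
    then show ?thesis by (simp add: mean_def scaleR_conv_of_real)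
  qed
  have wm: "(\<lambda>y. (cmod (mean {..<H} (\<lambda>l. \<phi> ((T ^^ Suc l) y))))\<^sup>2) \<in> borel_measurable M" for H
    using unit_funD[OF w[of H]] by measurable
  have "(\<lambda>H. \<integral>y. (cmod (mean {..<H} (\<lambda>l. \<phi> ((T ^^ Suc l) y))))\<^sup>2 \<partial>M) \<longlonglongrightarrow> (\<integral>y. (cmod (\<integral>y. \<phi> y \<partial>M))\<^sup>2 \<partial>M)"
  proof (rule integral_dominated_convergence[where w = "\<lambda>_. 1"])
    show "AE y in M. (\<lambda>H. (cmod (mean {..<H} (\<lambda>l. \<phi> ((T ^^ Suc l) y))))\<^sup>2) \<longlonglongrightarrow> (cmod (\<integral>y. \<phi> y \<partial>M))\<^sup>2"
      using birkhoff[OF unit_funD[OF \<phi>] unit_fun_AE[OF \<phi>]]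
    proof eventually_elim
      case (elim y)
      then show ?case by (intro tendsto_intros) (simp add: mean_def scaleR_conv_of_real)
    qed
    show "AE y in M. norm ((cmod (mean {..<H} (\<lambda>l. \<phi> ((T ^^ Suc l) y))))\<^sup>2) \<le> 1" for H
      using unit_fun_AE[OF w[of H]] by eventually_elim (simp add: power_le_one)
  qed (use wm in \<open>auto simp del: funpow.simps\<close>)
  then show ?thesis by (simp add: prob_space)
qed

text \<open>Both squares expand into finitely many correlations at lags below H. Each lag is the
  mean of a difference \<open>delta T r \<phi>\<close>, treated by \<open>model_mean\<close>;
  conjugation gives the lags of opposite sign.\<close>

lemma window_limit:
  assumes m: "model u \<phi>" and g: "generic x \<phi>" and \<phi>: "\<phi> \<in> unit_fun"
    and per: "\<And>N. periodic (Q N) (u N)" and b: "\<And>N n. cmod (u N n) \<le> 1"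
  shows "(\<lambda>N. mean (cyc (Q N)) (\<lambda>n. (cmod (mean {..<H} (\<lambda>l. u N (n + int l))))\<^sup>2)
    - real (L N) / real (Q N) * (\<integral>y. (cmod (mean {..<H} (\<lambda>l. \<phi> ((T ^^ Suc l) y))))\<^sup>2 \<partial>M)) \<longlonglongrightarrow> 0"
proof -
  define \<Gamma> where "\<Gamma> N l l' = mean (cyc (Q N)) (\<lambda>n. u N (n + int l) * cnj (u N (n + int l')))" for N l l'
  define I where "I l l' = (\<integral>y. \<phi> ((T ^^ Suc l) y) * cnj (\<phi> ((T ^^ Suc l') y)) \<partial>M)" for l l'
  define q where "q N = complex_of_real (real (L N) / real (Q N))" for N
  have cn: "\<Gamma> N l l' = cnj (\<Gamma> N l' l)" for N l l' by (simp add: \<Gamma>_def mean_cnj mult.commute)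
  have cnI: "I l l' = cnj (I l' l)" for l l'
    by (simp add: I_def mult.commute flip: Bochner_Integration.integral_cnj)
  have up: "(\<lambda>N. \<Gamma> N l (l + r) - q N * I l (l + r)) \<longlonglongrightarrow> 0" for l r
  proof -
    have "\<Gamma> N l (l + r) = mean (cyc (Q N)) (zdelta r (u N))" for N
    proof -
      have "periodic (Q N) (zdelta r (u N))" by (rule periodic_zdelta[OF per])
      from mean_cyc_shift[OF this, of "int l"] show ?thesis by (simp add: \<Gamma>_def zdelta_def add_ac)
    qed
    moreover have "I l (l + r) = (\<integral>y. delta T r \<phi> y \<partial>M)"
    proof -
      have "I l (l + r) = (\<integral>y. delta T r \<phi> ((T ^^ Suc l) y) \<partial>M)"
      proof -
        have "(T ^^ r) ((T ^^ Suc l) y) = (T ^^ Suc (l + r)) y" for y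
          by (metis add.commute add_Suc comp_apply funpow_add)
        then show ?thesis by (simp add: I_def delta_def)
      qed
      also have "\<dots> = (\<integral>y. delta T r \<phi> y \<partial>M)"
        by (rule integral_iter[OF unit_funD[OF unit_fun_delta[OF \<phi>]]])
      finally show ?thesis .
    qed
    ultimately show ?thesis
      using model_mean[OF model_zdelta[OF m g per b, of r] generic_delta[OF g]] by (simp add: q_def)
  qed
  have lim: "(\<lambda>N. \<Gamma> N l l' - q N * I l l') \<longlonglongrightarrow> 0" for l l'
  proof (cases "l \<le> l'")
    case True then show ?thesis using up[of l "l' - l"] by simp
  next
    case False
    then have "(\<lambda>N. cnj (\<Gamma> N l' l - q N * I l' l)) \<longlonglongrightarrow> cnj 0" by (intro tendsto_cnj) (use up[of l' "l - l'"] in simp)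
    then show ?thesis by (simp add: cn[of _ l l'] cnI[of l l'] q_def)
  qed
  have G: "complex_of_real (mean (cyc (Q N)) (\<lambda>n. (cmod (mean {..<H} (\<lambda>l. u N (n + int l))))\<^sup>2))
      = mean {..<H} (\<lambda>l. mean {..<H} (\<Gamma> N l))" for N
    using window_corr[of "{()}" "Q N" H "\<lambda>_. 1" "\<lambda>_. u N"] by (simp add: mean_singleton \<Gamma>_def[abs_def])
  have J: "complex_of_real (\<integral>y. (cmod (mean {..<H} (\<lambda>l. \<phi> ((T ^^ Suc l) y))))\<^sup>2 \<partial>M) = mean {..<H} (\<lambda>l. mean {..<H} (I l))"
  proof -
    have int: "integrable M (\<lambda>y. \<phi> ((T ^^ Suc l) y) * cnj (\<phi> ((T ^^ Suc l') y)))" for l l'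
      by (rule unit_fun_integrable[OF unit_fun_pair[OF \<phi>]])
    have "complex_of_real (\<integral>y. (cmod (mean {..<H} (\<lambda>l. \<phi> ((T ^^ Suc l) y))))\<^sup>2 \<partial>M)
      = (\<integral>y. mean {..<H} (\<lambda>l. mean {..<H} (\<lambda>l'. \<phi> ((T ^^ Suc l) y) * cnj (\<phi> ((T ^^ Suc l') y)))) \<partial>M)"
      unfolding integral_complex_of_real[symmetric] norm_power2_mean ..
    also have "\<dots> = mean {..<H} (\<lambda>l. mean {..<H} (I l))"
      unfolding mean_def I_def using int
      by (simp add: Bochner_Integration.integral_sum del: funpow.simps)
    finally show ?thesis .
  qed
  have "(\<lambda>N. mean {..<H} (\<lambda>l. mean {..<H} (\<lambda>l'. \<Gamma> N l l' - q N * I l l'))) \<longlonglongrightarrow> mean {..<H} (\<lambda>l. mean {..<H} (\<lambda>l'. 0))"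
    unfolding mean_def by (intro tendsto_intros lim)
  then have "(\<lambda>N. mean {..<H} (\<lambda>l. mean {..<H} (\<Gamma> N l)) - q N * mean {..<H} (\<lambda>l. mean {..<H} (I l))) \<longlonglongrightarrow> 0"
    by (simp add: mean_diff mean_mult_left) (simp add: mean_def)
  moreover have "(\<lambda>N. complex_of_real (Y N)) \<longlonglongrightarrow> 0 \<longleftrightarrow> Y \<longlonglongrightarrow> 0" for Y
    using tendsto_of_real_iff[of Y 0 sequentially, where 'a = complex] by simp
  ultimately show ?thesis
    unfolding G[symmetric] J[symmetric] q_def of_real_mult[symmetric] of_real_diff[symmetric] by blast
qed

text \<open>A differencing step does not suffice for the base case: it bounds by the averages of
  \<open>\<bar>\<integral> delta T r \<phi>\<bar>\<close>, whereas the signed averages are needed to reach \<open>\<bar>\<integral> \<phi>\<bar>\<^sup>2\<close>. The factor \<open>L N / Q N\<close>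
  need not converge, so it is kept in the limit relation above.\<close>

lemma cube_mean_limit_0:
  assumes \<eta>: "\<eta>0 \<in> cube 1" and m: "model (\<lambda>N. A N \<eta>0) \<phi>" and g: "generic x \<phi>" and \<phi>: "\<phi> \<in> unit_fun"
    and per: "\<And>N \<eta>. periodic (Q N) (A N \<eta>)" and b: "\<And>N \<eta> n. cmod (A N \<eta> n) \<le> 1" and e: "0 < e"
  shows "\<forall>\<^sub>F N in sequentially. (cmod (cube_mean (Q N) (K N) 1 (A N)))\<^sup>2 \<le> 2 * hkp M T 0 \<phi> + e"
proof -
  obtain \<eta>' k where \<eta>0: "\<eta>' \<in> cube 0" "k \<in> {0, 1}" "\<eta>0 = \<eta>'(Suc 0 := k)"
    using cube_SucE[of \<eta>0 0] \<eta> by auto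
  then have \<eta>1: "\<eta>0 = (\<lambda>_. undefined)(Suc 0 := k)" by (simp add: cube_0)
  define u where "u N = A N \<eta>0" for N
  define I where "I H = (\<integral>y. (cmod (mean {..<H} (\<lambda>l. \<phi> ((T ^^ Suc l) y))))\<^sup>2 \<partial>M)" for H
  define V where "V H N = mean (cyc (Q N)) (\<lambda>n. (cmod (mean {..<H} (\<lambda>l. u N (n + int l))))\<^sup>2)" for H N
  have "\<forall>\<^sub>F H in sequentially. I H < (cmod (\<integral>y. \<phi> y \<partial>M))\<^sup>2 + e / 8"
    using e window_tendsto[OF \<phi>] unfolding I_def[symmetric] by (intro order_tendstoD) auto
  then have "\<forall>\<^sub>F H in sequentially. H \<ge> 1 \<and> I H < (cmod (\<integral>y. \<phi> y \<partial>M))\<^sup>2 + e / 8"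
    using eventually_ge_at_top[of 1] by eventually_elim simp
  \<comment> \<open>H is fixed before N grows, so that the window integral is already close to its
    ergodic limit.\<close>
  then obtain H where H: "H \<ge> 1" "I H < (cmod (\<integral>y. \<phi> y \<partial>M))\<^sup>2 + e / 8"
    by (auto simp: eventually_sequentially)
  have "(\<lambda>N. V H N - real (L N) / real (Q N) * I H) \<longlonglongrightarrow> 0"
    unfolding V_def I_def u_def by (rule window_limit[OF m g \<phi> per b])
  then have "\<forall>\<^sub>F N in sequentially. V H N - real (L N) / real (Q N) * I H < e / 8"
    using e by (intro order_tendstoD) auto
  moreover have "(\<lambda>N. 8 * (real H / real (K N))\<^sup>2) \<longlonglongrightarrow> 8 * 0\<^sup>2" by (intro tendsto_intros over_K)
  then have "\<forall>\<^sub>F N in sequentially. 8 * (real H / real (K N))\<^sup>2 < e / 2"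
    by (rule order_tendstoD) (use e in simp)
  ultimately show ?thesis
  proof eventually_elim
    case (elim N)
    \<comment> \<open>As I H is nonnegative and an upper bound is sought, the factor L / Q \<le> 1
      may be dropped without knowing its limit.\<close>
    have "real (L N) / real (Q N) * I H \<le> I H"
      by (rule mult_left_le_one_le) (use LQ[of N] in \<open>auto simp: I_def divide_le_eq_1\<close>)
    moreover have "(cmod (cube_mean (Q N) (K N) (Suc 0) (A N)))\<^sup>2 \<le> 2 * V H N + 8 * (real H / real (K N))\<^sup>2"
      using cube_mean_Suc_window[where Q = "Q N" and M = "K N" and d = 0 and A = "A N" and e = k, OF per b \<eta>0(2) H(1)]
      by (simp only: hbox_0 mean_singleton cube_prod_0 V_def u_def \<eta>1)
    ultimately show ?case using elim H(2) by simp
  qed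
qed

text \<open>The induction hypothesis as a predicate, with C chosen before the family A, the function
  \<phi>, the vertex \<eta>0 and e. Only the functions at \<eta>0 model an orbit; those at other
  vertices are arbitrary bounded periodic functions.\<close>

definition limit_bound :: "nat \<Rightarrow> real \<Rightarrow> bool" where
  "limit_bound d C \<longleftrightarrow> (\<forall>A \<phi> \<eta>0 e. \<eta>0 \<in> cube (Suc d) \<longrightarrow> model (\<lambda>N. A N \<eta>0) \<phi> \<longrightarrow> generic x \<phi> \<longrightarrow> \<phi> \<in> unit_fun
    \<longrightarrow> (\<forall>N \<eta>. periodic (Q N) (A N \<eta>)) \<longrightarrow> (\<forall>N \<eta> n. cmod (A N \<eta> n) \<le> 1) \<longrightarrow> 0 < e
    \<longrightarrow> (\<forall>\<^sub>F N in sequentially. cmod (cube_mean (Q N) (K N) (Suc d) (A N)) ^ (2 ^ Suc d) \<le> C * hkp M T d \<phi> + e))"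

lemma limit_boundD:
  assumes "limit_bound d C" "\<eta>0 \<in> cube (Suc d)" "model (\<lambda>N. A N \<eta>0) \<phi>" "generic x \<phi>" "\<phi> \<in> unit_fun"
    "\<And>N \<eta>. periodic (Q N) (A N \<eta>)" "\<And>N \<eta> n. cmod (A N \<eta> n) \<le> 1" "0 < e"
  shows "\<forall>\<^sub>F N in sequentially. cmod (cube_mean (Q N) (K N) (Suc d) (A N)) ^ (2 ^ Suc d) \<le> C * hkp M T d \<phi> + e"
  using assms(1)[unfolded limit_bound_def, THEN spec[of _ A], THEN spec[of _ \<phi>], THEN spec[of _ \<eta>0], THEN spec[of _ e]] assms(2-8)
  by blast

text \<open>Each step passes to the face containing \<eta>0 and differences the function there.
  Averaging level d over the differences gives level d + 1 of \<phi> by \<open>hkp_tendsto\<close>;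
  the factor 3 * 4 comes from \<open>differencing_step\<close> with the coefficient 4 of
  \<open>cube_mean_Suc_le\<close>.\<close>

lemma cube_mean_limit: "\<exists>C\<ge>0. limit_bound d C"
proof (induction d)
  case 0
  have "limit_bound 0 2"
    unfolding limit_bound_def power_Suc0_right One_nat_def[symmetric]
  proof (intro allI impI)
    fix A \<phi> \<eta>0 and e :: real
    assume "\<eta>0 \<in> cube 1" "model (\<lambda>N. A N \<eta>0) \<phi>" "generic x \<phi>" "\<phi> \<in> unit_fun"
      "\<forall>N \<eta>. periodic (Q N) (A N \<eta>)" "\<forall>N \<eta> n. cmod (A N \<eta> n) \<le> 1" "0 < e"
    then show "\<forall>\<^sub>F N in sequentially. cmod (cube_mean (Q N) (K N) 1 (A N)) ^ (2 ^ 1) \<le> 2 * hkp M T 0 \<phi> + e"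
      unfolding power_one_right by (intro cube_mean_limit_0) simp_all
  qed
  then show ?case by (intro exI[of _ 2]) simp
next
  case (Suc d)
  then obtain C where C: "C \<ge> 0" and IH: "limit_bound d C" by blast
  have "limit_bound (Suc d) ((3 * 4) ^ (2 ^ Suc d) * C)"
    unfolding limit_bound_def
  proof (intro allI impI)
    fix A \<phi> \<eta>0 and e :: real
    assume \<eta>0: "\<eta>0 \<in> cube (Suc (Suc d))" and m: "model (\<lambda>N. A N \<eta>0) \<phi>" and g: "generic x \<phi>" and \<phi>: "\<phi> \<in> unit_fun"
      and per': "\<forall>N \<eta>. periodic (Q N) (A N \<eta>)" and b': "\<forall>N \<eta> n. cmod (A N \<eta> n) \<le> 1" and e: "0 < e"
    have per: "periodic (Q N) (A N \<eta>)" for N \<eta> using per' by blast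
    have b: "cmod (A N \<eta> n) \<le> 1" for N \<eta> n using b' by blast
    obtain \<eta>' k where \<eta>': "\<eta>' \<in> cube (Suc d)" "k \<in> {0, 1}" "\<eta>0 = \<eta>'(Suc (Suc d) := k)"
      by (rule cube_SucE[OF \<eta>0])
    define B where "B r N \<eta> = zdelta r (A N (\<eta>(Suc (Suc d) := k)))" for r N \<eta>
    have "\<forall>\<^sub>F N in sequentially. ((cmod (cube_mean (Q N) (K N) (Suc (Suc d)) (A N)))\<^sup>2) ^ (2 ^ Suc d)
        \<le> ((3 * 4) ^ (2 ^ Suc d) * C) * hkp M T (Suc d) \<phi> + e"
    proof (rule differencing_step[where Y = "\<lambda>r N. cmod (cube_mean (Q N) (K N) (Suc d) (B r N))"
          and \<pi> = "\<lambda>r. hkp M T d (delta T r \<phi>)" and a = 2 and c = "\<lambda>H N. 8 * (real H / real (K N))\<^sup>2"])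
      show "\<forall>\<^sub>F N in sequentially. (cmod (cube_mean (Q N) (K N) (Suc (Suc d)) (A N)))\<^sup>2
        \<le> 2 / real H + 4 * mean {1..H} (\<lambda>r. cmod (cube_mean (Q N) (K N) (Suc d) (B r N))) + 8 * (real H / real (K N))\<^sup>2"
        if "H \<ge> 1" for H
        unfolding B_def by (intro always_eventually allI cube_mean_Suc_le per b \<eta>' that)
      show "(\<lambda>N. 8 * (real H / real (K N))\<^sup>2) \<longlonglongrightarrow> 0" for H
      proof -
        have "(\<lambda>N. 8 * (real H / real (K N))\<^sup>2) \<longlonglongrightarrow> 8 * 0\<^sup>2" by (intro tendsto_intros over_K)
        then show ?thesis by simp
      qed
      show "\<forall>\<^sub>F N in sequentially. cmod (cube_mean (Q N) (K N) (Suc d) (B r N)) ^ 2 ^ Suc d \<le> C * hkp M T d (delta T r \<phi>) + e"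
        if "0 < e" for r e
      proof (rule limit_boundD[OF IH \<eta>'(1) _ generic_delta[OF g] unit_fun_delta[OF \<phi>] _ _ that])
        show "model (\<lambda>N. B r N \<eta>') (delta T r \<phi>)"
          using model_zdelta[OF m g per b] unfolding B_def \<eta>'(3) .
      qed (auto simp: B_def intro: periodic_zdelta norm_zdelta_le per b)
    qed (use e hkp_tendsto[OF \<phi>] in \<open>simp_all del: hkp.simps\<close>)
    then show "\<forall>\<^sub>F N in sequentially. cmod (cube_mean (Q N) (K N) (Suc (Suc d)) (A N)) ^ 2 ^ Suc (Suc d)
        \<le> ((3 * 4) ^ (2 ^ Suc d) * C) * hkp M T (Suc d) \<phi> + e"
      by (simp add: power_mult[symmetric] del: hkp.simps)
  qed
  then show ?case using C by (intro exI[of _ "(3 * 4) ^ (2 ^ Suc d) * C"]) simp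
qed

text \<open>Three levels are stacked: the signed average is controlled by level d, the average of
  moduli by level d + 1, and the average with arbitrary phases by level d + 2, where the hypothesis
  of vanishing applies. Each passage is one differencing step.\<close>

lemma phase_limit:
  assumes \<eta>0: "\<eta>0 \<in> cube (Suc d)" and m: "model (\<lambda>N. A N \<eta>0) \<phi>" and g: "generic x \<phi>" and \<phi>: "\<phi> \<in> unit_fun"
    and per: "\<And>N \<eta>. periodic (Q N) (A N \<eta>)" and b: "\<And>N \<eta> n. cmod (A N \<eta> n) \<le> 1"
    and zero: "hkp M T (Suc (Suc d)) \<phi> = 0"
    and S0: "\<And>N h. 0 \<le> S N h" and \<epsilon>: "\<epsilon> \<longlonglongrightarrow> 0" "\<And>N. 0 \<le> \<epsilon> N"
    and t: "\<forall>\<^sub>F N in sequentially. \<forall>h\<in>hbox (Suc d) (K N). \<exists>t::real. S N h \<le>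
      (cmod (mean (cyc (Q N)) (\<lambda>n. phase t n * zprod (Suc d) (A N) h n)))\<^sup>2 + \<epsilon> N"
  shows "(\<lambda>N. mean (hbox (Suc d) (K N)) (S N)) \<longlonglongrightarrow> 0"
proof -
  obtain C where cm: "limit_bound d C" using cube_mean_limit by blast
  define C' where "C' = (3 * 2) ^ (2 ^ Suc d) * C"
  define R where "R N A = mean (hbox (Suc d) (K N)) (\<lambda>h. cmod (mean (cyc (Q N)) (zprod (Suc d) A h)))" for N A
  have R0: "0 \<le> R N A" for N A by (simp add: R_def mean_nonneg)
  have R: "\<forall>\<^sub>F N in sequentially. R N (A N) ^ (2 ^ Suc (Suc d)) \<le> C' * hkp M T (Suc d) \<phi> + e"
    if m: "model (\<lambda>N. A N \<eta>0) \<phi>" and g: "generic x \<phi>" and \<phi>: "\<phi> \<in> unit_fun"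
      and per: "\<And>N \<eta>. periodic (Q N) (A N \<eta>)" and b: "\<And>N \<eta> n. cmod (A N \<eta> n) \<le> 1" and e: "0 < e" for A \<phi> e
  proof -
    define B where "B r N \<eta> = zdelta r (A N \<eta>)" for r N \<eta>
    have "\<forall>\<^sub>F N in sequentially. ((R N (A N))\<^sup>2) ^ (2 ^ Suc d) \<le> ((3 * 2) ^ (2 ^ Suc d) * C) * hkp M T (Suc d) \<phi> + e"
    proof (rule differencing_step[where Y = "\<lambda>r N. cmod (cube_mean (Q N) (K N) (Suc d) (B r N))"
          and \<pi> = "\<lambda>r. hkp M T d (delta T r \<phi>)" and a = 1 and c = "\<lambda>H N. 0"])
      show "\<forall>\<^sub>F N in sequentially. (R N (A N))\<^sup>2
        \<le> 1 / real H + 2 * mean {1..H} (\<lambda>r. cmod (cube_mean (Q N) (K N) (Suc d) (B r N))) + 0"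
        if "H \<ge> 1" for H
        unfolding B_def R_def add_0_right by (intro always_eventually allI mean_cmod_zprod_le per b that)
      show "\<forall>\<^sub>F N in sequentially. cmod (cube_mean (Q N) (K N) (Suc d) (B r N)) ^ 2 ^ Suc d \<le> C * hkp M T d (delta T r \<phi>) + e"
        if "0 < e" for r e
      proof (rule limit_boundD[OF cm \<eta>0 _ generic_delta[OF g] unit_fun_delta[OF \<phi>] _ _ that])
        show "model (\<lambda>N. B r N \<eta>0) (delta T r \<phi>)"
          using model_zdelta[OF m g per b] unfolding B_def .
      qed (auto simp: B_def intro: periodic_zdelta norm_zdelta_le per b)
    qed (use e hkp_tendsto[OF \<phi>] in \<open>simp_all del: hkp.simps\<close>)
    then show ?thesis by (simp add: C'_def power_mult[symmetric] del: hkp.simps)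
  qed
  have X: "\<forall>\<^sub>F N in sequentially. mean (hbox (Suc d) (K N)) (S N) ^ (2 ^ Suc (Suc d)) \<le> e" if e: "0 < e" for e
  proof -
    define B where "B r N \<eta> = zdelta r (A N \<eta>)" for r N \<eta>
    have "\<forall>\<^sub>F N in sequentially. mean (hbox (Suc d) (K N)) (S N) ^ (2 ^ Suc (Suc d))
        \<le> ((3 * 4) ^ (2 ^ Suc (Suc d)) * C') * hkp M T (Suc (Suc d)) \<phi> + e"
    proof (rule differencing_step[where Y = "\<lambda>r N. R N (B r N)"
          and \<pi> = "\<lambda>r. hkp M T (Suc d) (delta T r \<phi>)" and a = 2 and c = "\<lambda>H N. 8 * (real H / real (Q N))\<^sup>2 + \<epsilon> N"])
      show "\<forall>\<^sub>F N in sequentially. mean (hbox (Suc d) (K N)) (S N)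
        \<le> 2 / real H + 4 * mean {1..H} (\<lambda>r. R N (B r N)) + (8 * (real H / real (Q N))\<^sup>2 + \<epsilon> N)"
        if H: "H \<ge> 1" for H
        using t
      proof eventually_elim
        case (elim N)
        show ?case
          unfolding R_def B_def add.assoc[symmetric]
          by (rule mean_phase_le[OF per b H]) (use elim \<epsilon> in auto)
      qed
      show "(\<lambda>N. 8 * (real H / real (Q N))\<^sup>2 + \<epsilon> N) \<longlonglongrightarrow> 0" for H
      proof -
        have "(\<lambda>N. 8 * (real H / real (Q N))\<^sup>2 + \<epsilon> N) \<longlonglongrightarrow> 8 * 0\<^sup>2 + 0" by (intro tendsto_intros over_Q \<epsilon>)
        then show ?thesis by simp
      qed
      show "\<forall>\<^sub>F N in sequentially. R N (B r N) ^ 2 ^ Suc (Suc d) \<le> C' * hkp M T (Suc d) (delta T r \<phi>) + e"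
        if "0 < e" for r e
      proof (rule R[OF _ generic_delta[OF g] unit_fun_delta[OF \<phi>] _ _ that])
        show "model (\<lambda>N. B r N \<eta>0) (delta T r \<phi>)"
          using model_zdelta[OF m g per b] unfolding B_def .
      qed (auto simp: B_def intro: periodic_zdelta norm_zdelta_le per b)
      show "0 \<le> mean (hbox (Suc d) (K N)) (S N)" for N by (intro mean_nonneg S0)
      show "0 \<le> 8 * (real H / real (Q N))\<^sup>2 + \<epsilon> N" for H N using \<epsilon>(2) by simp
    qed (use e R0 hkp_tendsto[OF \<phi>] in \<open>simp_all del: hkp.simps\<close>)
    then show ?thesis unfolding zero by simp
  qed
  show ?thesis
  proof (rule tendstoI)
    fix e :: real assume e: "0 < e"
    define p :: nat where "p = 2 ^ Suc (Suc d)"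
    have p: "p > 0" by (simp add: p_def)
    have "0 < (e / 2) ^ p" using e by simp
    from X[OF this] show "\<forall>\<^sub>F N in sequentially. dist (mean (hbox (Suc d) (K N)) (S N)) 0 < e"
    proof eventually_elim
      case (elim N)
      have "mean (hbox (Suc d) (K N)) (S N) \<le> e / 2"
      proof (rule ccontr)
        assume "\<not> mean (hbox (Suc d) (K N)) (S N) \<le> e / 2"
        then have "(e / 2) ^ p < mean (hbox (Suc d) (K N)) (S N) ^ p"
          using e p by (intro power_strict_mono) auto
        then show False using elim by (simp add: p_def)
      qed
      then show ?case using e mean_nonneg[of "hbox (Suc d) (K N)" "S N"] S0 by simp
    qed
  qed
qed

end

text \<open>Otherwise the square root of W^2 - e, with W the supremum, would be a smaller upper
  bound.\<close>

lemma WW_sup_approx_power2: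
  assumes e: "e > 0"
  shows "\<exists>t. (WW_sup T N F x)\<^sup>2 \<le> (ww T N F x t)\<^sup>2 + e"
proof (rule ccontr)
  let ?W = "WW_sup T N F x"
  assume "\<nexists>t. ?W\<^sup>2 \<le> (ww T N F x t)\<^sup>2 + e"
  then have less: "(ww T N F x t)\<^sup>2 \<le> ?W\<^sup>2 - e" for t by (meson less_eq_real_def linorder_not_less le_diff_eq)
  have "?W \<le> sqrt (?W\<^sup>2 - e)"
    unfolding WW_sup_eq by (rule cSUP_least) (auto intro!: real_le_rsqrt less simp flip: WW_sup_eq)
  then have "?W\<^sup>2 \<le> (sqrt (?W\<^sup>2 - e))\<^sup>2" by (intro power_mono WW_sup_nonneg)
  also have "\<dots> = ?W\<^sup>2 - e" using less[of 0] by (intro real_sqrt_pow2) (meson order_trans zero_le_power2)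
  finally show False using e by simp
qed

context ergodic_system
begin

text \<open>The range K is quantified inside the almost everywhere statement: genericity of the
  point does not involve K, so one null set serves all ranges.\<close>

theorem box_averages_vanish:
  assumes g: "\<And>\<eta>. \<eta> \<in> cube (Suc d) \<Longrightarrow> g \<eta> \<in> unit_fun" and \<eta>0: "\<eta>0 \<in> cube (Suc d)"
    and f: "f \<in> unit_fun" "AE x in M. g \<eta>0 x = f x" and zero: "hkp M T (Suc (Suc d)) f = 0"
  shows "AE x in M. \<forall>K. filterlim K at_top sequentially \<longrightarrow> (\<forall>N. K N \<le> N) \<longrightarrow>
    (\<lambda>N. mean (hbox (Suc d) (K N)) (\<lambda>h. (WW_sup T N (cube_prod T (Suc d) g h) x)\<^sup>2)) \<longlonglongrightarrow> 0"
proof -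
  have "AE x in M. \<forall>\<eta>\<in>cube (Suc d). \<forall>n. cmod (g \<eta> ((T ^^ n) x)) \<le> 1"
    by (intro AE_finite_allI finite_cube AE_orbit unit_fun_AE g)
  then show ?thesis using AE_generic[OF f(1)] AE_orbit[OF f(2)]
  proof eventually_elim
    case (elim x)
    \<comment> \<open>The value 0 off the cube makes the bound 1 hold at every index, as the
      estimates on the cyclic group require.\<close>
    define a where "a \<eta> m = (if \<eta> \<in> cube (Suc d) then g \<eta> ((T ^^ Suc m) x) else 0)" for \<eta> m
    have a: "cmod (a \<eta> m) \<le> 1" for \<eta> m using elim(1) by (auto simp: a_def simp del: funpow.simps)
    define z :: "nat \<Rightarrow> nat" where "z = (\<lambda>i\<in>{1..Suc d}. 0)"
    have z: "z \<in> cube (Suc d)" by (auto simp: z_def cube_def)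
    \<comment> \<open>An index n < N, increased in d + 1 coordinates by at most K N \<le> N each,
      stays below (d + 2) N.\<close>
    define Q where "Q N = Suc (Suc d) * N" for N
    define L where "L \<eta> N = (if \<eta> = z then N else Q N)" for \<eta> N
    \<comment> \<open>Truncating only the vertex \<open>0\<close> restricts all products to \<open>n < N\<close>, where no index
      \<open>n + h \<cdot> \<eta>\<close> wraps around.\<close>
    define A where "A N \<eta> = wrap (Q N) (L \<eta> N) (a \<eta>)" for N \<eta>
    show ?case
    proof (intro allI impI)
      fix K :: "nat \<Rightarrow> nat" assume K: "filterlim K at_top sequentially" "\<forall>N. K N \<le> N"
      have Qlim: "filterlim Q at_top sequentially"
        by (rule filterlim_at_top_mono[OF filterlim_ident]) (simp add: Q_def)
      interpret orbit_model M T x Q "L \<eta>0" K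
      proof
        show "filterlim (L \<eta>0) at_top sequentially"
          using Qlim filterlim_ident by (cases "\<eta>0 = z") (simp_all add: L_def[abs_def])
        show "L \<eta>0 N \<le> Q N" for N by (simp add: L_def Q_def)
      qed (rule Qlim K)+
      have zprod_eq: "zprod (Suc d) (A N) h (int n) = (if n < N then cube_prod T (Suc d) g h ((T ^^ Suc n) x) else 0)"
        if h: "h \<in> hbox (Suc d) (K N)" and n: "n < Q N" for N h n
      proof (cases "n < N")
        case False
        have Az: "A N z (int n) = 0" using n False by (simp add: A_def wrap_small L_def)
        have s0: "(\<Sum>j=1..Suc d. h j * z j) = 0" by (simp add: z_def)
        have "(cnj ^^ (\<Sum>j=1..Suc d. z j)) (A N z (((\<lambda>n. n + 1) ^^ (\<Sum>j=1..Suc d. h j * z j)) (int n))) = 0"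
          unfolding succ_pow s0 by (simp only: of_nat_0 add_0_right Az cnj_pow_0)
        then have "zprod (Suc d) (A N) h (int n) = 0"
          unfolding cube_prod_def using z by (intro prod_zero finite_cube) blast
        then show ?thesis using False by simp
      next
        case True
        have "A N \<eta> (int n + int (\<Sum>j=1..Suc d. h j * \<eta> j)) = g \<eta> ((T ^^ (\<Sum>j=1..Suc d. h j * \<eta> j)) ((T ^^ Suc n) x))"
          if \<eta>: "\<eta> \<in> cube (Suc d)" for \<eta>
        proof -
          let ?s = "\<Sum>j=1..Suc d. h j * \<eta> j"
          have "?s \<le> (\<Sum>j=1..Suc d. N * 1)"
          proof (rule sum_mono)
            fix j assume j: "j \<in> {1..Suc d}"
            have "h j \<le> K N" using h j unfolding hbox_def by (auto dest!: PiE_mem)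
            then have "h j \<le> N" using K(2) le_trans by blast
            moreover have "\<eta> j \<in> {0, 1}" using \<eta> j unfolding cube_def by (rule PiE_mem)
            ultimately show "h j * \<eta> j \<le> N * 1" by auto
          qed
          then have s: "n + ?s < Q N" using True by (simp add: Q_def)
          have s0: "?s = 0" if "\<eta> = z" unfolding that by (simp add: z_def)
          have "n + ?s < L \<eta> N"
          proof (cases "\<eta> = z")
            case z: True
            then show ?thesis unfolding s0[OF z] using True by (simp add: L_def)
          next
            case False
            then show ?thesis using s by (simp only: L_def if_False)
          qed
          then have "A N \<eta> (int (n + ?s)) = g \<eta> ((T ^^ Suc (n + ?s)) x)"
            unfolding A_def wrap_small[OF s] using \<eta> by (simp add: a_def)
          moreover have "(T ^^ Suc (n + ?s)) x = (T ^^ ?s) ((T ^^ Suc n) x)"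
            by (metis add.commute add_Suc comp_apply funpow_add)
          ultimately show ?thesis by simp
        qed
        then show ?thesis unfolding cube_prod_def succ_pow using True by simp
      qed
      \<comment> \<open>The cyclic average divides by (d + 2) N instead of N; squaring gives this
        factor.\<close>
      let ?c = "(real (Suc (Suc d)))\<^sup>2"
      have "(\<lambda>N. mean (hbox (Suc d) (K N)) (\<lambda>h. (WW_sup T N (cube_prod T (Suc d) g h) x)\<^sup>2 / ?c)) \<longlonglongrightarrow> 0"
      proof (rule phase_limit[where A = A and \<phi> = f and \<epsilon> = "\<lambda>N. (1 / real N) / ?c", OF \<eta>0])
        have "A N \<eta>0 = wrap (Q N) (L \<eta>0 N) (orb f)" for N
          using \<eta>0 elim(3) by (simp add: A_def a_def[abs_def] orb_def[abs_def] del: funpow.simps)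
        then show "model (\<lambda>N. A N \<eta>0) f" by (simp add: model_def mean_def)
        show "periodic (Q N) (A N \<eta>)" for N \<eta> unfolding A_def by (rule periodic_wrap)
        show "cmod (A N \<eta> n) \<le> 1" for N \<eta> n unfolding A_def by (rule norm_wrap_le) (rule a)
        have "(\<lambda>N. (1 / real N) / ?c) \<longlonglongrightarrow> 0 / ?c"
          by (intro tendsto_intros lim_const_over_n) simp
        then show "(\<lambda>N. (1 / real N) / ?c) \<longlonglongrightarrow> 0" by simp
        show "\<forall>\<^sub>F N in sequentially. \<forall>h\<in>hbox (Suc d) (K N). \<exists>t::real.
          (WW_sup T N (cube_prod T (Suc d) g h) x)\<^sup>2 / ?c \<le>
          (cmod (mean (cyc (Q N)) (\<lambda>n. phase t n * zprod (Suc d) (A N) h n)))\<^sup>2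
           + (1 / real N) / ?c"
          using eventually_ge_at_top[of 1]
        proof eventually_elim
          case (elim N)
          show ?case
          proof
            fix h assume h: "h \<in> hbox (Suc d) (K N)"
            let ?F = "cube_prod T (Suc d) g h"
            obtain t where t: "(WW_sup T N ?F x)\<^sup>2 \<le> (ww T N ?F x t)\<^sup>2 + 1 / real N"
              using WW_sup_approx_power2[of "1 / real N" T N ?F x] elim by auto
            have "mean (cyc (Q N)) (\<lambda>n. phase t n * zprod (Suc d) (A N) h n)
              = mean {..<Q N} (\<lambda>n. cis (2 * pi * (real n * t)) * zprod (Suc d) (A N) h (int n))"
              unfolding mean_cyc_nat of_int_of_nat_eq cis_exp ..
            also have "\<dots> = mean {..<Q N} (\<lambda>n. if n < N then ?F ((T ^^ Suc n) x) * cis (2 * pi * (real n * t)) else 0)"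
              by (intro mean_cong refl) (simp add: zprod_eq[OF h] mult.commute)
            also have "\<dots> = (1 / real (Q N)) *\<^sub>R (\<Sum>n<N. ?F ((T ^^ Suc n) x) * cis (2 * pi * (real n * t)))"
              unfolding mean_def card_lessThan
              by (intro arg_cong2[where f = scaleR] refl sum.mono_neutral_cong_right) (auto simp: Q_def)
            also have "\<dots> = (1 / of_nat (Suc (Suc d))) * ((1 / of_nat N) * (\<Sum>n<N. ?F ((T ^^ Suc n) x) * cis (2 * pi * (real n * t))))"
              using elim by (simp add: Q_def scaleR_conv_of_real algebra_simps)
            finally have "cmod (mean (cyc (Q N)) (\<lambda>n. phase t n * zprod (Suc d) (A N) h n))
               = ww T N ?F x t / real (Suc (Suc d))"
              by (simp only: norm_mult[of "1 / of_nat (Suc (Suc d))"] ww_Suc norm_divide norm_one norm_of_nat) simp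
            moreover have "(WW_sup T N ?F x)\<^sup>2 / ?c \<le> ((ww T N ?F x t)\<^sup>2 + 1 / real N) / ?c"
              by (intro divide_right_mono t) simp
            ultimately show "\<exists>t::real. (WW_sup T N ?F x)\<^sup>2 / ?c \<le>
              (cmod (mean (cyc (Q N)) (\<lambda>n. phase t n * zprod (Suc d) (A N) h n)))\<^sup>2
               + (1 / real N) / ?c"
              by (intro exI[of _ t]) (simp only: power_divide add_divide_distrib)
          qed
        qed
      qed (use f zero elim(2) in simp_all)
      then have "(\<lambda>N. ?c * mean (hbox (Suc d) (K N)) (\<lambda>h. (WW_sup T N (cube_prod T (Suc d) g h) x)\<^sup>2 / ?c))
         \<longlonglongrightarrow> ?c * 0" by (intro tendsto_mult tendsto_const)
      then show "(\<lambda>N. mean (hbox (Suc d) (K N)) (\<lambda>h. (WW_sup T N (cube_prod T (Suc d) g h) x)\<^sup>2)) \<longlonglongrightarrow> 0"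
        by (simp only: mean_mult_left[symmetric]) simp
    qed
  qed
qed

end

section \<open>Scaling and the equivalences\<close>

lemma cube_prod_scale:
  "cube_prod T d (\<lambda>\<eta> x. of_real c * g \<eta> x) h = (\<lambda>x. of_real (c ^ (2 ^ d)) * cube_prod T d g h x)"
proof
  fix x
  have *: "(cnj ^^ m) (of_real c * z) = of_real c * (cnj ^^ m) z" for m z
    by (induction m) auto
  show "cube_prod T d (\<lambda>\<eta> x. of_real c * g \<eta> x) h x = of_real (c ^ (2 ^ d)) * cube_prod T d g h x"
    unfolding cube_prod_def * prod.distrib by (simp add: card_cube)
qed

lemma WW_sup_scale:
  assumes "c > 0"
  shows "WW_sup T N (\<lambda>x. of_real c * F x) = (\<lambda>x. c * WW_sup T N F x)"
proof
  fix x
  have ww: "ww T N (\<lambda>x. of_real b * F x) x t = b * ww T N F x t" if "b > 0" for b t and F :: "'a \<Rightarrow> complex"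
  proof -
    have "(\<Sum>n=1..N. exp (2 * of_real pi * \<i> * of_nat n * of_real t) * (of_real b * F ((T ^^ n) x)))
        = of_real b * (\<Sum>n=1..N. exp (2 * of_real pi * \<i> * of_nat n * of_real t) * F ((T ^^ n) x))"
      unfolding sum_distrib_left by (rule sum.cong[OF refl]) (simp only: mult_ac)
    then show ?thesis using that by (simp add: ww_def norm_mult norm_divide)
  qed
  have le: "WW_sup T N (\<lambda>x. of_real b * F x) x \<le> b * WW_sup T N F x" if "b > 0" for b and F :: "'a \<Rightarrow> complex"
    unfolding WW_sup_eq[of T N "\<lambda>x. of_real b * F x"] ww[OF that]
    by (rule cSUP_least) (use that in \<open>auto intro!: mult_left_mono ww_le_WW_sup\<close>)
  \<comment> \<open>The reverse inequality is \<open>le\<close> for 1 / c, applied to the scaled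
    function.\<close>
  have "WW_sup T N F x \<le> (1 / c) * WW_sup T N (\<lambda>x. of_real c * F x) x"
    using le[of "1 / c" "\<lambda>x. of_real c * F x"] assms by simp
  then show "WW_sup T N (\<lambda>x. of_real c * F x) x = c * WW_sup T N F x"
    using le[OF assms, of F] assms by (simp add: field_simps)
qed

lemma L2norm_nonneg: "0 \<le> L2norm M F"
  by (simp add: L2norm_def)

lemma L2norm_scale: "0 \<le> c \<Longrightarrow> L2norm M (\<lambda>x. c * F x) = c * L2norm M F"
  by (simp add: L2norm_def power_mult_distrib real_sqrt_mult)

lemma WW_cube_prod_scale:
  assumes "C > 0"
  shows "WW_sup T N (cube_prod T d (\<lambda>\<eta> x. of_real C * g \<eta> x) h) = (\<lambda>x. C ^ (2 ^ d) * WW_sup T N (cube_prod T d g h) x)"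
  unfolding cube_prod_scale by (rule WW_sup_scale) (use assms in simp)

lemma pointwise_vanishing_iff:
  "pointwise_vanishing M T d g \<longleftrightarrow> (AE x in M. (\<lambda>N. mean (hbox d N) (\<lambda>h. (WW_sup T N (cube_prod T d g h) x)\<^sup>2)) \<longlonglongrightarrow> 0)"
  by (simp add: pointwise_vanishing_def mean_real card_hbox)

lemma norm_vanishing_iff:
  "norm_vanishing M T d g \<longleftrightarrow> (\<lambda>N. mean (hbox d N) (\<lambda>h. (L2norm M (WW_sup T N (cube_prod T d g h)))\<^sup>2)) \<longlonglongrightarrow> 0"
  by (simp add: norm_vanishing_def mean_real card_hbox)

lemma sqrt_norm_vanishing_iff:
  "sqrt_norm_vanishing M T d g \<longleftrightarrow> (\<lambda>N. mean (hbox d (nat \<lfloor>sqrt (real N)\<rfloor>))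
     (\<lambda>h. L2norm M (WW_sup T N (cube_prod T d g h)) powr (2 / 3))) \<longlonglongrightarrow> 0"
  by (simp add: sqrt_norm_vanishing_def mean_real card_hbox)

lemma tendsto_0_scale_iff:
  fixes f :: "nat \<Rightarrow> real"
  assumes "c > 0"
  shows "(\<lambda>n. c * f n) \<longlonglongrightarrow> 0 \<longleftrightarrow> f \<longlonglongrightarrow> 0"
  using tendsto_mult_left_iff[of c f 0 sequentially] assms by simp

lemma
  assumes C: "C > 0"
  shows pointwise_vanishing_scale: "pointwise_vanishing M T d (\<lambda>\<eta> x. of_real C * g \<eta> x) \<longleftrightarrow> pointwise_vanishing M T d g"
    and norm_vanishing_scale: "norm_vanishing M T d (\<lambda>\<eta> x. of_real C * g \<eta> x) \<longleftrightarrow> norm_vanishing M T d g"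
    and sqrt_norm_vanishing_scale: "sqrt_norm_vanishing M T d (\<lambda>\<eta> x. of_real C * g \<eta> x) \<longleftrightarrow> sqrt_norm_vanishing M T d g"
proof -
  define D where "D = C ^ (2 ^ d)"
  have D: "D > 0" using C by (simp add: D_def)
  show "pointwise_vanishing M T d (\<lambda>\<eta> x. of_real C * g \<eta> x) \<longleftrightarrow> pointwise_vanishing M T d g"
    unfolding pointwise_vanishing_iff WW_cube_prod_scale[OF C] D_def[symmetric] power_mult_distrib mean_mult_left
    using D by (simp add: tendsto_0_scale_iff)
  show "norm_vanishing M T d (\<lambda>\<eta> x. of_real C * g \<eta> x) \<longleftrightarrow> norm_vanishing M T d g"
    unfolding norm_vanishing_iff WW_cube_prod_scale[OF C] D_def[symmetric] L2norm_scale[OF less_imp_le[OF D]]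
      power_mult_distrib mean_mult_left
    using D by (simp add: tendsto_0_scale_iff)
  have p: "(D * L2norm M F) powr (2 / 3) = D powr (2 / 3) * L2norm M F powr (2 / 3)" for F
    by (rule powr_mult)
  show "sqrt_norm_vanishing M T d (\<lambda>\<eta> x. of_real C * g \<eta> x) \<longleftrightarrow> sqrt_norm_vanishing M T d g"
    unfolding sqrt_norm_vanishing_iff WW_cube_prod_scale[OF C] D_def[symmetric] L2norm_scale[OF less_imp_le[OF D]]
      p mean_mult_left
    using D by (simp add: tendsto_0_scale_iff)
qed

lemma filterlim_floor_sqrt: "filterlim (\<lambda>N. nat \<lfloor>sqrt (real N)\<rfloor>) at_top sequentially"
  unfolding filterlim_at_top
proof
  fix B
  show "\<forall>\<^sub>F N in sequentially. B \<le> nat \<lfloor>sqrt (real N)\<rfloor>"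
    using eventually_ge_at_top[of "B\<^sup>2"]
  proof eventually_elim
    case (elim N)
    then have "real B \<le> sqrt (real N)" by (intro real_le_rsqrt) (metis of_nat_le_iff of_nat_power)
    then show ?case by (simp add: le_nat_floor)
  qed
qed

lemma floor_sqrt_le: "nat \<lfloor>sqrt (real N)\<rfloor> \<le> N"
proof -
  have "sqrt (real N) \<le> real N"
  proof (cases "N = 0")
    case False
    then have "real N * 1 \<le> real N * real N" by (intro mult_left_mono) auto
    then show ?thesis by (intro real_le_lsqrt) (auto simp: power2_eq_square)
  qed simp
  then have "nat \<lfloor>sqrt (real N)\<rfloor> \<le> nat \<lfloor>real N\<rfloor>" by (intro nat_mono floor_mono)
  then show ?thesis by simp
qed

context ergodic_system
begin

text \<open>Differencing squares the factor, which doubles the degree at each level. Convergence of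
  the averages is what lets \<open>lim\<close> commute with scaling.\<close>

lemma hkp_scale:
  assumes "f \<in> unit_fun" "c \<ge> 0"
  shows "hkp M T m (\<lambda>x. of_real c * f x) = c ^ (2 ^ Suc m) * hkp M T m f"
  using assms
proof (induction m arbitrary: f c)
  case 0
  then show ?case by (simp add: norm_mult power_mult_distrib)
next
  case (Suc m)
  have d: "delta T h (\<lambda>x. of_real c * f x) = (\<lambda>x. of_real (c\<^sup>2) * delta T h f x)" for h
    by (simp add: delta_def fun_eq_iff power2_eq_square)
  have "hkp M T m (delta T h (\<lambda>x. of_real c * f x)) = c ^ (2 ^ Suc (Suc m)) * hkp M T m (delta T h f)" for h
    unfolding d using Suc.IH[OF unit_fun_delta[OF Suc.prems(1)], of "c\<^sup>2" h]
    by (simp add: power_mult[symmetric])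
  then have "(\<lambda>H. (1 / real H) * (\<Sum>h=1..H. hkp M T m (delta T h (\<lambda>x. of_real c * f x))))
     = (\<lambda>H. c ^ (2 ^ Suc (Suc m)) * mean {1..H} (\<lambda>h. hkp M T m (delta T h f)))"
    by (simp add: mean_real sum_distrib_left[symmetric] del: power_Suc)
  moreover have "(\<lambda>H. c ^ (2 ^ Suc (Suc m)) * mean {1..H} (\<lambda>h. hkp M T m (delta T h f)))
     \<longlonglongrightarrow> c ^ (2 ^ Suc (Suc m)) * hkp M T (Suc m) f"
    by (intro tendsto_intros hkp_tendsto Suc.prems)
  ultimately show ?case
    unfolding hkp.simps(2)[of M T m "\<lambda>x. of_real c * f x"] by (simp only: limI)
qed

section \<open>Passing between the vanishing conditions\<close>

lemma L2norm_WW_sup_le_1: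
  assumes "F \<in> unit_fun"
  shows "L2norm M (WW_sup T N F) \<le> 1"
proof -
  have "(\<integral>x. (WW_sup T N F x)\<^sup>2 \<partial>M) \<le> (\<integral>x. 1 \<partial>M)"
  proof (rule integral_mono_AE[OF integrable_WW_sup_power2[OF assms]])
    show "AE x in M. (WW_sup T N F x)\<^sup>2 \<le> 1"
      using WW_sup_le_1[OF assms, of N] by eventually_elim (simp add: power_le_one WW_sup_nonneg)
  qed simp
  then show ?thesis by (simp add: L2norm_def prob_space)
qed

text \<open>The bound of \<open>hkp_le_norm_average\<close> holds for every large N with a left side
  free of N, so it may be evaluated in the limit.\<close>

lemma hkp_zero_of_norm:
  assumes f: "f \<in> unit_fun" and K: "filterlim K at_top sequentially"
    and lim: "(\<lambda>N. mean (hbox d (K N)) (\<lambda>h. (L2norm M (WW_sup T N (cube_prod T d (\<lambda>\<eta>. f) h)))\<^sup>2)) \<longlonglongrightarrow> 0"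
  shows "hkp M T (Suc d) f = 0"
proof -
  let ?V = "\<lambda>N. mean (hbox d (K N)) (\<lambda>h. (L2norm M (WW_sup T N (cube_prod T d (\<lambda>\<eta>. f) h)))\<^sup>2)"
  have "(\<lambda>N. 2 ^ d / real (K N) + 2 ^ d / real N + 4 * 2 ^ d * ?V N) \<longlonglongrightarrow> 0 + 0 + 4 * 2 ^ d * 0"
    by (intro tendsto_add tendsto_mult tendsto_const lim lim_const_over_n
        real_tendsto_divide_at_top[OF tendsto_const] filterlim_compose[OF filterlim_real_sequentially K])
  moreover have "\<forall>\<^sub>F N in sequentially. 1 \<le> K N" using K unfolding filterlim_at_top by blast
  then have "\<forall>\<^sub>F N in sequentially. hkp M T (Suc d) f \<le> 2 ^ d / real (K N) + 2 ^ d / real N + 4 * 2 ^ d * ?V N"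
    using eventually_ge_at_top[of 1] by eventually_elim (rule hkp_le_norm_average[OF f])
  ultimately have "hkp M T (Suc d) f \<le> 0 + 0 + 4 * 2 ^ d * 0"
    by (rule tendsto_lowerbound) simp
  then show ?thesis using hkp_nonneg[OF f, of "Suc d"] by linarith
qed

text \<open>Integrating the box average termwise gives the average of squared norms; all box
  averages are at most 1 almost everywhere, so dominated convergence applies.\<close>

lemma norm_of_pointwise:
  assumes g: "\<And>\<eta>. \<eta> \<in> cube d \<Longrightarrow> g \<eta> \<in> unit_fun"
    and lim: "AE x in M. (\<lambda>N. mean (hbox d (K N)) (\<lambda>h. (WW_sup T N (cube_prod T d g h) x)\<^sup>2)) \<longlonglongrightarrow> 0"
  shows "(\<lambda>N. mean (hbox d (K N)) (\<lambda>h. (L2norm M (WW_sup T N (cube_prod T d g h)))\<^sup>2)) \<longlonglongrightarrow> 0"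
proof -
  have u: "cube_prod T d g h \<in> unit_fun" for h by (rule unit_fun_cube_prod[OF g])
  have meas: "(\<lambda>x. (WW_sup T N (cube_prod T d g h) x)\<^sup>2) \<in> borel_measurable M" for N h
    by (intro borel_measurable_power WW_sup_measurable unit_funD u)
  have eq: "mean (hbox d (K N)) (\<lambda>h. (L2norm M (WW_sup T N (cube_prod T d g h)))\<^sup>2)
     = (\<integral>x. mean (hbox d (K N)) (\<lambda>h. (WW_sup T N (cube_prod T d g h) x)\<^sup>2) \<partial>M)" for N
    unfolding mean_real L2norm_power2
    by (simp add: Bochner_Integration.integral_sum integrable_WW_sup_power2[OF u])
  have "(\<lambda>N. \<integral>x. mean (hbox d (K N)) (\<lambda>h. (WW_sup T N (cube_prod T d g h) x)\<^sup>2) \<partial>M) \<longlonglongrightarrow> (\<integral>x. 0 \<partial>M)"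
  proof (rule integral_dominated_convergence[where w = "\<lambda>_. 1"])
    show "(\<lambda>x. mean (hbox d (K N)) (\<lambda>h. (WW_sup T N (cube_prod T d g h) x)\<^sup>2)) \<in> borel_measurable M" for N
      unfolding mean_real by (intro borel_measurable_divide borel_measurable_sum meas borel_measurable_const)
    show "AE x in M. norm (mean (hbox d (K N)) (\<lambda>h. (WW_sup T N (cube_prod T d g h) x)\<^sup>2)) \<le> 1" for N
    proof -
      have "AE x in M. \<forall>h\<in>hbox d (K N). WW_sup T N (cube_prod T d g h) x \<le> 1"
        by (intro AE_finite_allI finite_hbox WW_sup_le_1 u)
      then show ?thesis
      proof eventually_elim
        case (elim x)
        have "mean (hbox d (K N)) (\<lambda>h. (WW_sup T N (cube_prod T d g h) x)\<^sup>2) \<le> 1"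
          by (rule mean_le_const) (use elim in \<open>auto intro!: power_le_one WW_sup_nonneg\<close>)
        moreover have "0 \<le> mean (hbox d (K N)) (\<lambda>h. (WW_sup T N (cube_prod T d g h) x)\<^sup>2)" by (rule mean_nonneg) simp
        ultimately show ?case by simp
      qed
    qed
  qed (use lim in auto)
  then show ?thesis unfolding eq by simp
qed

text \<open>For \<open>y = L powr (2 / 3)\<close> the bound \<open>y \<le> e + y\<^sup>3 / e\<^sup>2\<close> replaces Jensen's inequality.\<close>

lemma powr_mean_limit_iff:
  fixes L :: "nat \<Rightarrow> 'b \<Rightarrow> real"
  assumes L: "\<And>N h. 0 \<le> L N h" "\<And>N h. L N h \<le> 1"
  shows "(\<lambda>N. mean (B N) (\<lambda>h. L N h powr (2 / 3))) \<longlonglongrightarrow> 0 \<longleftrightarrow> (\<lambda>N. mean (B N) (\<lambda>h. (L N h)\<^sup>2)) \<longlonglongrightarrow> 0"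
proof
  assume lim: "(\<lambda>N. mean (B N) (\<lambda>h. L N h powr (2 / 3))) \<longlonglongrightarrow> 0"
  have "(L N h)\<^sup>2 \<le> L N h powr (2 / 3)" for N h
  proof (cases "L N h = 0")
    case False
    then have "L N h powr 2 \<le> L N h powr (2 / 3)" using L[of N h] by (intro powr_mono') auto
    then show ?thesis using False L[of N h] by (simp add: powr_numeral)
  qed simp
  then show "(\<lambda>N. mean (B N) (\<lambda>h. (L N h)\<^sup>2)) \<longlonglongrightarrow> 0"
    by (intro null_squeeze[OF _ _ lim] mean_mono mean_nonneg) auto
next
  assume lim: "(\<lambda>N. mean (B N) (\<lambda>h. (L N h)\<^sup>2)) \<longlonglongrightarrow> 0"
  show "(\<lambda>N. mean (B N) (\<lambda>h. L N h powr (2 / 3))) \<longlonglongrightarrow> 0"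
  proof (rule tendstoI)
    fix e :: real assume "0 < e"
    define s where "s = e / 2"
    have s: "s > 0" using \<open>0 < e\<close> by (simp add: s_def)
    have pt: "L N h powr (2 / 3) \<le> (1 / s\<^sup>2) * (L N h)\<^sup>2 + s" for N h
    proof -
      define y where "y = L N h powr (2 / 3)"
      have "y ^ 3 = (L N h)\<^sup>2"
      proof (cases "L N h = 0")
        case False
        then have "y ^ 3 = (L N h powr (2 / 3)) powr 3" using L[of N h] by (simp add: y_def powr_numeral)
        also have "\<dots> = L N h powr 2" by (simp add: powr_powr)
        finally show ?thesis using False L[of N h] by (simp add: powr_numeral)
      qed (simp add: y_def)
      moreover have "y \<le> (1 / s\<^sup>2) * y ^ 3 + s"
      proof (cases "y \<le> s")
        case True
        moreover have "0 \<le> (1 / s\<^sup>2) * y ^ 3" by (simp add: y_def)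
        ultimately show ?thesis by linarith
      next
        case False
        then have "s\<^sup>2 * y \<le> y\<^sup>2 * y" using s by (intro mult_right_mono power_mono) auto
        then have "y \<le> (1 / s\<^sup>2) * y ^ 3" using s by (simp add: field_simps power3_eq_cube power2_eq_square)
        then show ?thesis using s by linarith
      qed
      ultimately show ?thesis by (simp add: y_def)
    qed
    have "(\<lambda>N. (1 / s\<^sup>2) * mean (B N) (\<lambda>h. (L N h)\<^sup>2)) \<longlonglongrightarrow> (1 / s\<^sup>2) * 0" by (intro tendsto_intros lim)
    then have "\<forall>\<^sub>F N in sequentially. (1 / s\<^sup>2) * mean (B N) (\<lambda>h. (L N h)\<^sup>2) < s"
      by (rule order_tendstoD) (use s in simp)
    then show "\<forall>\<^sub>F N in sequentially. dist (mean (B N) (\<lambda>h. L N h powr (2 / 3))) 0 < e"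
    proof eventually_elim
      case (elim N)
      have "mean (B N) (\<lambda>h. L N h powr (2 / 3)) \<le> mean (B N) (\<lambda>h. (1 / s\<^sup>2) * (L N h)\<^sup>2 + s)"
        by (intro mean_mono pt)
      also have "\<dots> \<le> (1 / s\<^sup>2) * mean (B N) (\<lambda>h. (L N h)\<^sup>2) + s"
        unfolding mean_add mean_mult_left using s by (intro add_left_mono mean_const_le) simp
      finally have "mean (B N) (\<lambda>h. L N h powr (2 / 3)) < e" using elim unfolding s_def by linarith
      moreover have "0 \<le> mean (B N) (\<lambda>h. L N h powr (2 / 3))" by (rule mean_nonneg) simp
      ultimately show ?case by simp
    qed
  qed
qed

text \<open>One constant for the whole family, because the homogeneity lemmas scale all vertices of
  the cube alike.\<close>

lemma Linfty_scale:
  assumes "finite I" "\<And>i. i \<in> I \<Longrightarrow> F i \<in> Linfty M"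
  shows "\<exists>C>0. \<forall>i\<in>I. (\<lambda>x. of_real (1 / C) * F i x) \<in> unit_fun"
proof -
  have "\<exists>B. AE x in M. cmod (F i x) \<le> B" if "i \<in> I" for i
    using assms(2)[OF that] by (auto simp: Linfty_def)
  then obtain B where B: "\<And>i. i \<in> I \<Longrightarrow> AE x in M. cmod (F i x) \<le> B i" by metis
  define C where "C = 1 + (\<Sum>i\<in>I. \<bar>B i\<bar>)"
  have C: "C > 0" unfolding C_def by (intro add_pos_nonneg sum_nonneg) auto
  have "(\<lambda>x. of_real (1 / C) * F i x) \<in> unit_fun" if i: "i \<in> I" for i
  proof -
    have [measurable]: "F i \<in> borel_measurable M" using assms(2)[OF i] by (simp add: Linfty_def)
    have "\<bar>B i\<bar> \<le> (\<Sum>i\<in>I. \<bar>B i\<bar>)" using assms(1) i by (intro member_le_sum) auto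
    then have "B i \<le> C" by (simp add: C_def)
    have "AE x in M. cmod (of_real (1 / C) * F i x) \<le> 1"
      using B[OF i]
    proof eventually_elim
      case (elim x)
      then have "cmod (F i x) \<le> C" using \<open>B i \<le> C\<close> by linarith
      then show ?case using C by (simp add: norm_mult norm_divide)
    qed
    then show ?thesis by (simp add: unit_fun_def)
  qed
  then show ?thesis using C by blast
qed

text \<open>Matches the indices: the factor of order d + 1 belongs to the seminorm of order d + 2,
  which is level d + 1 of \<open>hkp\<close>. The root vanishes only at 0, and a bounded f is square
  integrable.\<close>

lemma L2_perp_iff:
  assumes f: "f \<in> Linfty M" and Z: "HKZ_factor M T (Suc d) Z"
  shows "f \<in> L2_perp M Z \<longleftrightarrow> hkp M T (Suc d) f = 0"
proof -
  have [measurable]: "f \<in> borel_measurable M" using f by (simp add: Linfty_def)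
  obtain C where C: "AE x in M. cmod (f x) \<le> C" using f by (auto simp: Linfty_def)
  have "integrable M (\<lambda>x. (cmod (f x))\<^sup>2)"
  proof (rule integrable_const_bound[of _ "C\<^sup>2"])
    show "AE x in M. norm ((cmod (f x))\<^sup>2) \<le> C\<^sup>2"
      using C by eventually_elim (simp add: power_mono)
  qed measurable
  then have "f \<in> L2_perp M Z \<longleftrightarrow> (AE x in M. complex_cond_exp M Z f x = 0)"
    by (simp add: L2_perp_def)
  also have "\<dots> \<longleftrightarrow> HK_seminorm M T (Suc d + 1) f = 0"
    using Z f unfolding HKZ_factor_def by blast
  also have "\<dots> \<longleftrightarrow> hkp M T (Suc d) f = 0"
    by (simp add: HK_seminorm_def HK_power_eq_hkp del: hkp.simps)
  finally show ?thesis .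
qed

lemma vanishing_of_L2_perp:
  assumes f: "f \<in> Linfty M" and zero: "hkp M T (Suc (Suc d)) f = 0" and g: "cube_family M (Suc d) f g"
  shows "pointwise_vanishing M T (Suc d) g" "norm_vanishing M T (Suc d) g" "sqrt_norm_vanishing M T (Suc d) g"
proof -
  obtain \<eta>0 where \<eta>0: "\<eta>0 \<in> cube (Suc d)" "AE x in M. g \<eta>0 x = f x" using g by (auto simp: cube_family_def)
  \<comment> \<open>\<open>None\<close> adds f itself to the family: f agrees with a member only
    almost everywhere, and both must be scaled by the same constant.\<close>
  define F where "F i = (case i of None \<Rightarrow> f | Some \<eta> \<Rightarrow> g \<eta>)" for i
  have "finite (insert None (Some ` cube (Suc d)))" by (simp add: finite_cube)
  moreover have "F i \<in> Linfty M" if "i \<in> insert None (Some ` cube (Suc d))" for i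
    using that f g by (auto simp: F_def cube_family_def)
  ultimately obtain C where C: "C > 0"
    and CF: "\<forall>i\<in>insert None (Some ` cube (Suc d)). (\<lambda>x. of_real (1 / C) * F i x) \<in> unit_fun"
    using Linfty_scale[of "insert None (Some ` cube (Suc d))" F] by blast
  define f' where "f' x = of_real (1 / C) * f x" for x
  define g' where "g' \<eta> x = of_real (1 / C) * g \<eta> x" for \<eta> x
  have f': "f' \<in> unit_fun" using bspec[OF CF, of None] by (simp add: F_def f'_def[abs_def])
  have g': "g' \<eta> \<in> unit_fun" if "\<eta> \<in> cube (Suc d)" for \<eta>
    using bspec[OF CF, of "Some \<eta>"] that by (simp add: F_def g'_def[abs_def])
  have g_eq: "g = (\<lambda>\<eta> x. of_real C * g' \<eta> x)" and f_eq: "f = (\<lambda>x. of_real C * f' x)"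
    using C by (simp_all add: g'_def f'_def)
  have "hkp M T (Suc (Suc d)) f' = 0"
    using zero C unfolding f_eq hkp_scale[OF f' less_imp_le[OF C]] by (simp del: hkp.simps)
  moreover have "AE x in M. g' \<eta>0 x = f' x" using \<eta>0(2) by eventually_elim (simp add: g'_def f'_def)
  ultimately have fw: "AE x in M. \<forall>K. filterlim K at_top sequentially \<longrightarrow> (\<forall>N. K N \<le> N) \<longrightarrow>
    (\<lambda>N. mean (hbox (Suc d) (K N)) (\<lambda>h. (WW_sup T N (cube_prod T (Suc d) g' h) x)\<^sup>2)) \<longlonglongrightarrow> 0"
    using g' \<eta>0(1) f' by (intro box_averages_vanish) auto
  have pt: "AE x in M. (\<lambda>N. mean (hbox (Suc d) (K N)) (\<lambda>h. (WW_sup T N (cube_prod T (Suc d) g' h) x)\<^sup>2)) \<longlonglongrightarrow> 0"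
    if "filterlim K at_top sequentially" "\<And>N. K N \<le> N" for K
    using fw by eventually_elim (use that in blast)
  have "pointwise_vanishing M T (Suc d) g'"
    unfolding pointwise_vanishing_iff by (rule pt[of "\<lambda>N. N"]) (simp_all add: filterlim_ident)
  then show "pointwise_vanishing M T (Suc d) g" unfolding g_eq pointwise_vanishing_scale[OF C] .
  have "norm_vanishing M T (Suc d) g'"
    unfolding norm_vanishing_iff
    by (rule norm_of_pointwise[where K = "\<lambda>N. N"], rule g', assumption, rule pt) (simp_all add: filterlim_ident)
  then show "norm_vanishing M T (Suc d) g" unfolding g_eq norm_vanishing_scale[OF C] .
  have "sqrt_norm_vanishing M T (Suc d) g'"
    unfolding sqrt_norm_vanishing_iff
  proof (subst powr_mean_limit_iff)
    show "(\<lambda>N. mean (hbox (Suc d) (nat \<lfloor>sqrt (real N)\<rfloor>)) (\<lambda>h. (L2norm M (WW_sup T N (cube_prod T (Suc d) g' h)))\<^sup>2)) \<longlonglongrightarrow> 0"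
      by (rule norm_of_pointwise, rule g', assumption, rule pt) (simp_all add: filterlim_floor_sqrt floor_sqrt_le)
    show "L2norm M (WW_sup T N (cube_prod T (Suc d) g' h)) \<le> 1" for N h
      by (rule L2norm_WW_sup_le_1[OF unit_fun_cube_prod[OF g']])
  qed (rule L2norm_nonneg)
  then show "sqrt_norm_vanishing M T (Suc d) g" unfolding g_eq sqrt_norm_vanishing_scale[OF C] .
qed

text \<open>Each alternative reduces to vanishing averages of squared norms: the pointwise one by
  dominated convergence, the one with exponent 2/3 because the norms are at most 1. Both box sides
  tend to infinity.\<close>

lemma L2_perp_of_vanishing:
  assumes f: "f \<in> Linfty M"
    and van: "pointwise_vanishing M T d (\<lambda>\<eta>. f) \<or> norm_vanishing M T d (\<lambda>\<eta>. f) \<or> sqrt_norm_vanishing M T d (\<lambda>\<eta>. f)"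
  shows "hkp M T (Suc d) f = 0"
proof -
  obtain C where C: "C > 0" and CF: "(\<lambda>x. of_real (1 / C) * f x) \<in> unit_fun"
    using Linfty_scale[of "{()}" "\<lambda>_. f"] f by auto
  define f' where "f' x = of_real (1 / C) * f x" for x
  have f': "f' \<in> unit_fun" using CF by (simp add: f'_def[abs_def])
  have f_eq: "f = (\<lambda>x. of_real C * f' x)" using C by (simp add: f'_def)
  have id: "filterlim (\<lambda>N::nat. N) at_top sequentially" by (simp add: filterlim_ident)
  have u: "cube_prod T d (\<lambda>\<eta>. f') h \<in> unit_fun" for h by (rule unit_fun_cube_prod[OF f'])
  have "pointwise_vanishing M T d (\<lambda>\<eta>. f') \<or> norm_vanishing M T d (\<lambda>\<eta>. f') \<or> sqrt_norm_vanishing M T d (\<lambda>\<eta>. f')"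
    using van unfolding f_eq pointwise_vanishing_scale[OF C] norm_vanishing_scale[OF C] sqrt_norm_vanishing_scale[OF C] .
  then consider "pointwise_vanishing M T d (\<lambda>\<eta>. f')" | "norm_vanishing M T d (\<lambda>\<eta>. f')" | "sqrt_norm_vanishing M T d (\<lambda>\<eta>. f')"
    by blast
  then have "hkp M T (Suc d) f' = 0"
  proof cases
    case 1
    then show ?thesis
      unfolding pointwise_vanishing_iff
      by (intro hkp_zero_of_norm[OF f' id] norm_of_pointwise[where K = "\<lambda>N. N"] f')
  next
    case 2
    then show ?thesis unfolding norm_vanishing_iff by (rule hkp_zero_of_norm[OF f' id])
  next
    case 3
    then have "(\<lambda>N. mean (hbox d (nat \<lfloor>sqrt (real N)\<rfloor>)) (\<lambda>h. (L2norm M (WW_sup T N (cube_prod T d (\<lambda>\<eta>. f') h)))\<^sup>2)) \<longlonglongrightarrow> 0"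
      unfolding sqrt_norm_vanishing_iff
      by (subst (asm) powr_mean_limit_iff) (auto intro: L2norm_WW_sup_le_1[OF u] L2norm_nonneg)
    then show ?thesis by (rule hkp_zero_of_norm[OF f' filterlim_floor_sqrt])
  qed
  then show ?thesis unfolding f_eq hkp_scale[OF f' less_imp_le[OF C]] by (simp del: hkp.simps)
qed

end

theorem theorem6p3:
  fixes M :: "'a measure" and T :: "'a \<Rightarrow> 'a" and Z :: "'a measure"
    and f :: "'a \<Rightarrow> complex" and k :: nat
  assumes "invertible_ergodic_system M T"
    and "f \<in> Linfty M"
    and "k \<ge> 2"
    and "HKZ_factor M T k Z"
  shows
    "(f \<in> L2_perp M Z \<longleftrightarrow> (\<forall>g. cube_family M (k - 1) f g \<longrightarrow> pointwise_vanishing M T (k - 1) g)) \<and>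
     (f \<in> L2_perp M Z \<longleftrightarrow> pointwise_vanishing M T (k - 1) (\<lambda>\<eta>. f)) \<and>
     (f \<in> L2_perp M Z \<longleftrightarrow> (\<forall>g. cube_family M (k - 1) f g \<longrightarrow> norm_vanishing M T (k - 1) g)) \<and>
     (f \<in> L2_perp M Z \<longleftrightarrow> norm_vanishing M T (k - 1) (\<lambda>\<eta>. f)) \<and>
     (f \<in> L2_perp M Z \<longleftrightarrow> (\<forall>g. cube_family M (k - 1) f g \<longrightarrow> sqrt_norm_vanishing M T (k - 1) g)) \<and>
     (f \<in> L2_perp M Z \<longleftrightarrow> sqrt_norm_vanishing M T (k - 1) (\<lambda>\<eta>. f))"
proof -
  interpret ergodic_system M T by unfold_locales (rule assms(1))
  define d where "d = k - 2"
  have k: "k = Suc (Suc d)" using assms(3) by (simp add: d_def)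
  have k1: "k - 1 = Suc d" by (simp add: k)
  have perp: "f \<in> L2_perp M Z \<longleftrightarrow> hkp M T (Suc (Suc d)) f = 0"
    using L2_perp_iff[OF assms(2), of "Suc d" Z] assms(4) unfolding k .
  have const: "cube_family M (Suc d) f (\<lambda>\<eta>. f)"
  proof -
    have "(\<lambda>i\<in>{1..Suc d}. 0) \<in> cube (Suc d)" by (auto simp: cube_def)
    then show ?thesis
      unfolding cube_family_def by (intro conjI ballI assms(2) bexI[of _ "\<lambda>i\<in>{1..Suc d}. 0"]) simp_all
  qed
  \<comment> \<open>The cycle (1), all families, constant family, (1), for an arbitrary notion V of
    vanishing; the middle implication holds because the constant family is admissible.\<close>
  have iffs: "(f \<in> L2_perp M Z \<longleftrightarrow> (\<forall>g. cube_family M (Suc d) f g \<longrightarrow> V g)) \<and> (f \<in> L2_perp M Z \<longleftrightarrow> V (\<lambda>\<eta>. f))"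
    if to: "\<And>g. hkp M T (Suc (Suc d)) f = 0 \<Longrightarrow> cube_family M (Suc d) f g \<Longrightarrow> V g"
      and from_const: "V (\<lambda>\<eta>. f) \<Longrightarrow> hkp M T (Suc (Suc d)) f = 0" for V
  proof (intro conjI iffI allI impI)
    show "V g" if "f \<in> L2_perp M Z" "cube_family M (Suc d) f g" for g
      using \<open>f \<in> L2_perp M Z\<close> \<open>cube_family M (Suc d) f g\<close> unfolding perp by (rule to)
    show "V (\<lambda>\<eta>. f)" if "f \<in> L2_perp M Z"
      using that const unfolding perp by (rule to)
    show "f \<in> L2_perp M Z" if "\<forall>g. cube_family M (Suc d) f g \<longrightarrow> V g"
      unfolding perp using that const by (intro from_const) simp
    show "f \<in> L2_perp M Z" if "V (\<lambda>\<eta>. f)"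
      unfolding perp using that by (rule from_const)
  qed
  note fwd = vanishing_of_L2_perp[OF assms(2)] and bwd = L2_perp_of_vanishing[OF assms(2)]
  have "(f \<in> L2_perp M Z \<longleftrightarrow> (\<forall>g. cube_family M (Suc d) f g \<longrightarrow> pointwise_vanishing M T (Suc d) g)) \<and>
     (f \<in> L2_perp M Z \<longleftrightarrow> pointwise_vanishing M T (Suc d) (\<lambda>\<eta>. f))"
    by (rule iffs[OF fwd(1) bwd], assumption+, rule disjI1)
  moreover have "(f \<in> L2_perp M Z \<longleftrightarrow> (\<forall>g. cube_family M (Suc d) f g \<longrightarrow> norm_vanishing M T (Suc d) g)) \<and>
     (f \<in> L2_perp M Z \<longleftrightarrow> norm_vanishing M T (Suc d) (\<lambda>\<eta>. f))"
    by (rule iffs[OF fwd(2) bwd], assumption+, rule disjI2, rule disjI1)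
  moreover have "(f \<in> L2_perp M Z \<longleftrightarrow> (\<forall>g. cube_family M (Suc d) f g \<longrightarrow> sqrt_norm_vanishing M T (Suc d) g)) \<and>
     (f \<in> L2_perp M Z \<longleftrightarrow> sqrt_norm_vanishing M T (Suc d) (\<lambda>\<eta>. f))"
    by (rule iffs[OF fwd(3) bwd], assumption+, rule disjI2, rule disjI2)
  ultimately show ?thesis unfolding k1 by argo
qed

end
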